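(* Let $A,B,C$ be permutative categories. Composition with the bilinear map $u\colon A,B\to A\otimes B$ defines an isomorphism of categories $$\mathrm{PermCat}_s(A\otimes B,C)\cong\mathrm{Bilin}(A,B;C)$$ that is 2-natural with respect to strict symmetric monoidal functors $C\to\overline{C}$ and not-necessarily-strict symmetric monoidal functors $\overline{A}\to A$ and $\overline{B}\to B$.
   Context: **Permutative categories.** A permutative category $C=(C,+,0,\beta)$ is a strict monoidal category $(C,+,0)$ with a natural isomorphism $\beta_{x,y}\colon x+y\to y+x$ such that $\beta_{y,x}\beta_{x,y}=1$ and $\beta_{x,y+z}=(1_y+\beta_{x,z})\circ(\beta_{x,y}+1_z)$. A symmetric monoidal functor $F\colon C\to C'$ (always in the strong sense) is a functor with a natural isomorphism $F_2\colon Fx+Fy\to F(x+y)$ and an isomorphism $F_0\colon 0\to F0$ satisfying the usual associativity, unity and symmetry axioms; it is strict if $F_2,F_0$ are identities. A monoidal transformation $\phi\colon F\Rightarrow G$ is a natural transformation with $\phi_{x+y}\circ F_2=G_2\circ(\phi_x+\phi_y)$ and $\phi_0\circ F_0=G_0$. $\mathrm{PermCat}$ is the 2-category of permutative categories, symmetric monoidal functors and monoidal transformations; $\mathrm{PermCat}_s$ is the sub-2-category with the same objects, strict symmetric monoidal functors, and all monoidal transformations between them. **Bilinear maps.** A bilinear map $H\colon A,B\to C$ is a functor $H\colon A\times B\to C$ with natural isomorphisms $H_a(b,b')\colon H(a,b)+H(a,b')\to H(a,b+b')$, $H_b(a,a')\colon H(a,b)+H(a',b)\to H(a+a',b)$ (natural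 in all three variables), $H_{a,0}\colon 0\to H(a,0)$ natural in $a$, $H_{0,b}\colon 0\to H(0,b)$ natural in $b$, such that: (i) for fixed $a$, $(H(a,-),H_a,H_{a,0})$, and for fixed $b$, $(H(-,b),H_b,H_{0,b})$, are symmetric monoidal functors; (ii) $H_{b+b'}\circ(H_a+H_{a'})=H_{a+a'}\circ(H_b+H_{b'})\circ(1+\beta+1)$ as morphisms $H(a,b)+H(a,b')+H(a',b)+H(a',b')\to H(a+a',b+b')$; (iii) the morphism $H_{a,0}$ at $a=0$ equals $H_{0,b}$ at $b=0$; (iv) $H_{b}(a,a')|_{b=0}\circ(H_{a,0}+H_{a',0})=H_{a+a',0}$ and $H_a(b,b')|_{a=0}\circ(H_{0,b}+H_{0,b'})=H_{0,b+b'}$. A bilinear transformation $H\Rightarrow J$ is a natural transformation of functors $A\times B\to C$ that is monoidal in each variable separately. These form the category $\mathrm{Bilin}(A,B;C)$. Bilinear maps compose with symmetric monoidal functors: for $P\colon\overline A\to A$, $Q\colon\overline B\to B$, the map $H(P-,Q-)$ has constraints $H(1,Q_2)\circ H_{Pa}$, $H(P_2,1)\circ H_{Qb}$, $H(1,Q_0)\circ H_{Pa,0}$, $H(P_0,1)\circ H_{0,Qb}$; for $R\colon C\to\overline C$, $RH$ has constraints $R(H_a)\circ R_2$, $R(H_b)\circ R_2$, $R(H_{a,0})\circ R_0$, $R(H_{0,b})\circ R_0$; similarly for transformations. **Tensor product of objects.** For permutative categories $A,B$, start with the free strict monoidal category $\coprod_{n\ge 0}(A\times B)^n$ on $A\times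 B$, writing objects as finite formal sums $\sum a_i.b_i$ (the empty sum is $0$) and morphisms of $A\times B$ as $f.g$. Freely adjoin (in strict monoidal categories) isomorphisms $\delta^L_a(b,b')\colon a.b+a.b'\to a.(b+b')$, $\delta^R_b(a,a')\colon a.b+a'.b\to(a+a').b$, $\beta_{a.b,a'.b'}\colon a.b+a'.b'\to a'.b'+a.b$, $\zeta^L_a\colon 0\to a.0$, $\zeta^R_b\colon 0\to 0.b$ for all $a,a'\in A$, $b,b'\in B$. Impose the relations: (1) all of these are natural in every variable; (2) $\beta$ together with $+,0$ gives a permutative structure; (3) each $a.(-)$ is a symmetric monoidal functor with constraints $\delta^L_a,\zeta^L_a$ and each $(-).b$ is a symmetric monoidal functor with constraints $\delta^R_b,\zeta^R_b$; (4) $\delta^L_{a+a'}\circ(\delta^R_b+\delta^R_{b'})=\delta^R_{b+b'}\circ(\delta^L_a+\delta^L_{a'})\circ(1+\beta+1)$ as morphisms $a.b+a'.b+a.b'+a'.b'\to(a+a').(b+b')$; (5) $\zeta^L_0=\zeta^R_0\colon 0\to 0.0$; (6) $\delta^R_0(a,a')\circ(\zeta^L_a+\zeta^L_{a'})=\zeta^L_{a+a'}$ and $\delta^L_0(b,b')\circ(\zeta^R_b+\zeta^R_{b'})=\zeta^R_{b+b'}$. The result is the permutative category $A\otimes B$. The bilinear map $u\colon A,B\to A\otimes B$ has underlying functor $(a,b)\mapsto a.b$ and constraints $\delta^L_a,\delta^R_b,\zeta^L_a,\zeta^R_b$. **Tensor product of 1- and 2-cells.** For symmetric monoidal functors $F\colon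 A\to A'$, $G\colon B\to B'$, the strict symmetric monoidal functor $F\otimes G$ is given by $a.b\mapsto Fa.Gb$, $f.g\mapsto Ff.Gg$, $\delta^L_a\mapsto(1.G_2)\circ\delta^L_{Fa}$, $\delta^R_b\mapsto(F_2.1)\circ\delta^R_{Gb}$, $\beta\mapsto\beta$, $\zeta^L_a\mapsto(1.G_0)\circ\zeta^L_{Fa}$, $\zeta^R_b\mapsto(F_0.1)\circ\zeta^R_{Gb}$. For monoidal transformations, $(\phi\otimes\psi)_{\sum a_i.b_i}=\sum\phi_{a_i}.\psi_{b_i}$ and $(\phi\otimes\psi)_0=1_0$. *)

theory Defs
  imports Main "HOL-Library.FuncSet"
begin

section \<open>Categories, functors, natural transformations\<close>

text \<open>Composition is written in applicative order: \<open>g \<cdot> f\<close> is \<open>g\<close> after \<open>f\<close>.\<close>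

record ('o, 'm) cat =
  Obj :: "'o set"
  Arr :: "'m set"
  Dom :: "'m \<Rightarrow> 'o"
  Cod :: "'m \<Rightarrow> 'o"
  Ide :: "'o \<Rightarrow> 'm"
  Cmp :: "'m \<Rightarrow> 'm \<Rightarrow> 'm" (infixr "\<cdot>\<index>" 60)

definition hom :: "('o, 'm, 'x) cat_scheme \<Rightarrow> 'o \<Rightarrow> 'o \<Rightarrow> 'm set" where
  "hom C x y = {f \<in> Arr C. Dom C f = x \<and> Cod C f = y}"

locale category =
  fixes C :: "('o, 'm, 'x) cat_scheme" (structure)
  assumes dom_obj: "f \<in> Arr C \<Longrightarrow> Dom C f \<in> Obj C"
    and cod_obj: "f \<in> Arr C \<Longrightarrow> Cod C f \<in> Obj C"
    and ide_hom: "x \<in> Obj C \<Longrightarrow> Ide C x \<in> hom C x x"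
    and cmp_hom: "\<lbrakk>f \<in> hom C x y; g \<in> hom C y z\<rbrakk> \<Longrightarrow> g \<cdot> f \<in> hom C x z"
    and cmp_ide_right: "f \<in> hom C x y \<Longrightarrow> f \<cdot> Ide C x = f"
    and cmp_ide_left: "f \<in> hom C x y \<Longrightarrow> Ide C y \<cdot> f = f"
    and cmp_assoc: "\<lbrakk>f \<in> hom C w x; g \<in> hom C x y; h \<in> hom C y z\<rbrakk>
      \<Longrightarrow> (h \<cdot> g) \<cdot> f = h \<cdot> (g \<cdot> f)"

definition inverse_arrs :: "('o, 'm, 'x) cat_scheme \<Rightarrow> 'm \<Rightarrow> 'm \<Rightarrow> bool" where
  "inverse_arrs C f g \<longleftrightarrow> f \<in> Arr C \<and> g \<in> hom C (Cod C f) (Dom C f) \<and>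
     g \<cdot>\<^bsub>C\<^esub> f = Ide C (Dom C f) \<and> f \<cdot>\<^bsub>C\<^esub> g = Ide C (Cod C f)"

definition is_iso :: "('o, 'm, 'x) cat_scheme \<Rightarrow> 'm \<Rightarrow> bool" where
  "is_iso C f \<longleftrightarrow> (\<exists>g. inverse_arrs C f g)"

definition inv_arr :: "('o, 'm, 'x) cat_scheme \<Rightarrow> 'm \<Rightarrow> 'm" where
  "inv_arr C f = (THE g. inverse_arrs C f g)"

definition prod_cat ::
    "('o, 'm, 'x) cat_scheme \<Rightarrow> ('p, 'n, 'y) cat_scheme \<Rightarrow> ('o \<times> 'p, 'm \<times> 'n) cat" where
  "prod_cat A B =
    \<lparr>Obj = Obj A \<times> Obj B, Arr = Arr A \<times> Arr B,
     Dom = (\<lambda>(f, g). (Dom A f, Dom B g)), Cod = (\<lambda>(f, g). (Cod A f, Cod B g)),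
     Ide = (\<lambda>(a, b). (Ide A a, Ide B b)),
     Cmp = (\<lambda>(f', g') (f, g). (f' \<cdot>\<^bsub>A\<^esub> f, g' \<cdot>\<^bsub>B\<^esub> g))\<rparr>"

text \<open>
  All structure maps of functors, transformations and bilinear maps are required to be
  extensional (equal to \<open>undefined\<close> off their mathematical domain), so that HOL equality of
  such data is equality of the mathematical objects.
\<close>

record ('o, 'm, 'p, 'n) fct =
  fob :: "'o \<Rightarrow> 'p"
  far :: "'m \<Rightarrow> 'n"

locale cat_functor = dom: category A + cod: category C
  for A :: "('o, 'm, 'x) cat_scheme" and C :: "('p, 'n, 'y) cat_scheme" +
  fixes F :: "('o, 'm, 'p, 'n, 'z) fct_scheme"
  assumes fob_type: "fob F \<in> Obj A \<rightarrow>\<^sub>E Obj C"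
    and far_ext: "far F \<in> extensional (Arr A)"
    and far_hom: "f \<in> hom A x y \<Longrightarrow> far F f \<in> hom C (fob F x) (fob F y)"
    and far_ide: "x \<in> Obj A \<Longrightarrow> far F (Ide A x) = Ide C (fob F x)"
    and far_cmp: "\<lbrakk>f \<in> hom A x y; g \<in> hom A y z\<rbrakk>
      \<Longrightarrow> far F (g \<cdot>\<^bsub>A\<^esub> f) = far F g \<cdot>\<^bsub>C\<^esub> far F f"

definition nat_trans ::
    "('o, 'm, 'x) cat_scheme \<Rightarrow> ('p, 'n, 'y) cat_scheme \<Rightarrow>
     ('o, 'm, 'p, 'n, 'u) fct_scheme \<Rightarrow> ('o, 'm, 'p, 'n, 'v) fct_scheme \<Rightarrow> ('o \<Rightarrow> 'n) \<Rightarrow> bool" where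
  "nat_trans A C F G t \<longleftrightarrow>
     cat_functor A C F \<and> cat_functor A C G \<and>
     t \<in> (\<Pi>\<^sub>E x\<in>Obj A. hom C (fob F x) (fob G x)) \<and>
     (\<forall>x\<in>Obj A. \<forall>y\<in>Obj A. \<forall>f\<in>hom A x y. far G f \<cdot>\<^bsub>C\<^esub> t x = t y \<cdot>\<^bsub>C\<^esub> far F f)"

definition id_fct :: "('o, 'm, 'x) cat_scheme \<Rightarrow> ('o, 'm, 'o, 'm) fct" where
  "id_fct A = \<lparr>fob = (\<lambda>x\<in>Obj A. x), far = (\<lambda>f\<in>Arr A. f)\<rparr>"

definition comp_fct ::
    "('o, 'm, 'x) cat_scheme \<Rightarrow> ('p, 'n, 'q, 'k) fct \<Rightarrow> ('o, 'm, 'p, 'n) fct \<Rightarrow> ('o, 'm, 'q, 'k) fct" where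
  "comp_fct A G F =
    \<lparr>fob = (\<lambda>x\<in>Obj A. fob G (fob F x)), far = (\<lambda>f\<in>Arr A. far G (far F f))\<rparr>"

definition cat_isomorphism ::
    "('o, 'm, 'x) cat_scheme \<Rightarrow> ('p, 'n, 'y) cat_scheme \<Rightarrow> ('o, 'm, 'p, 'n) fct \<Rightarrow> bool" where
  "cat_isomorphism X Y F \<longleftrightarrow>
     cat_functor X Y F \<and>
     (\<exists>G. cat_functor Y X G \<and> comp_fct X G F = id_fct X \<and> comp_fct Y F G = id_fct Y)"

text \<open>
  The category whose objects are the elements of \<open>\<F>\<close> (functors \<open>D \<rightarrow> C\<close>, possibly with
  structure) and whose arrows \<open>F \<Rightarrow> G\<close> are the families \<open>t\<close> with \<open>T F G t\<close>, composed
  componentwise.  An arrow is the triple \<open>(F, t, G)\<close>, so that it determines its ends.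
\<close>

definition trans_cat ::
    "('o, 'm, 'x) cat_scheme \<Rightarrow> ('p, 'n, 'y) cat_scheme \<Rightarrow> ('o, 'm, 'p, 'n, 'z) fct_scheme set \<Rightarrow>
     (('o, 'm, 'p, 'n, 'z) fct_scheme \<Rightarrow> ('o, 'm, 'p, 'n, 'z) fct_scheme \<Rightarrow> ('o \<Rightarrow> 'n) \<Rightarrow> bool) \<Rightarrow>
     (('o, 'm, 'p, 'n, 'z) fct_scheme,
      ('o, 'm, 'p, 'n, 'z) fct_scheme \<times> ('o \<Rightarrow> 'n) \<times> ('o, 'm, 'p, 'n, 'z) fct_scheme) cat" where
  "trans_cat D C \<F> T =
    \<lparr>Obj = \<F>,
     Arr = {(F, t, G). F \<in> \<F> \<and> G \<in> \<F> \<and> T F G t},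
     Dom = (\<lambda>(F, t, G). F),
     Cod = (\<lambda>(F, t, G). G),
     Ide = (\<lambda>F. (F, (\<lambda>x\<in>Obj D. Ide C (fob F x)), F)),
     Cmp = (\<lambda>(_, s, H) (F, t, _). (F, (\<lambda>x\<in>Obj D. s x \<cdot>\<^bsub>C\<^esub> t x), H))\<rparr>"


section \<open>Permutative categories and symmetric monoidal functors\<close>

record ('o, 'm) perm = "('o, 'm) cat" +
  Zero :: 'o
  Plus :: "'o \<Rightarrow> 'o \<Rightarrow> 'o" (infixl "\<oplus>\<index>" 65)
  PlusA :: "'m \<Rightarrow> 'm \<Rightarrow> 'm" (infixl "\<boxplus>\<index>" 65)
  Beta :: "'o \<Rightarrow> 'o \<Rightarrow> 'm"

locale permutative = category C for C :: "('o, 'm) perm" (structure) +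
  assumes zero_obj: "Zero C \<in> Obj C"
    and plus_obj: "\<lbrakk>x \<in> Obj C; y \<in> Obj C\<rbrakk> \<Longrightarrow> x \<oplus> y \<in> Obj C"
    and plus_hom: "\<lbrakk>f \<in> hom C x y; g \<in> hom C z w\<rbrakk> \<Longrightarrow> f \<boxplus> g \<in> hom C (x \<oplus> z) (y \<oplus> w)"
    and plus_ide: "\<lbrakk>x \<in> Obj C; y \<in> Obj C\<rbrakk> \<Longrightarrow> Ide C x \<boxplus> Ide C y = Ide C (x \<oplus> y)"
    and plus_cmp: "\<lbrakk>f \<in> hom C x y; f' \<in> hom C y z; g \<in> hom C u v; g' \<in> hom C v w\<rbrakk>
      \<Longrightarrow> (f' \<cdot> f) \<boxplus> (g' \<cdot> g) = (f' \<boxplus> g') \<cdot> (f \<boxplus> g)"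
    and plus_assoc: "\<lbrakk>x \<in> Obj C; y \<in> Obj C; z \<in> Obj C\<rbrakk> \<Longrightarrow> (x \<oplus> y) \<oplus> z = x \<oplus> (y \<oplus> z)"
    and plus_assoc_arr: "\<lbrakk>f \<in> Arr C; g \<in> Arr C; h \<in> Arr C\<rbrakk> \<Longrightarrow> (f \<boxplus> g) \<boxplus> h = f \<boxplus> (g \<boxplus> h)"
    and zero_left: "x \<in> Obj C \<Longrightarrow> Zero C \<oplus> x = x"
    and zero_right: "x \<in> Obj C \<Longrightarrow> x \<oplus> Zero C = x"
    and zero_left_arr: "f \<in> Arr C \<Longrightarrow> Ide C (Zero C) \<boxplus> f = f"
    and zero_right_arr: "f \<in> Arr C \<Longrightarrow> f \<boxplus> Ide C (Zero C) = f"
    and beta_hom: "\<lbrakk>x \<in> Obj C; y \<in> Obj C\<rbrakk> \<Longrightarrow> Beta C x y \<in> hom C (x \<oplus> y) (y \<oplus> x)"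
    and beta_natural: "\<lbrakk>f \<in> hom C x x'; g \<in> hom C y y'\<rbrakk>
      \<Longrightarrow> Beta C x' y' \<cdot> (f \<boxplus> g) = (g \<boxplus> f) \<cdot> Beta C x y"
    and beta_inv: "\<lbrakk>x \<in> Obj C; y \<in> Obj C\<rbrakk> \<Longrightarrow> Beta C y x \<cdot> Beta C x y = Ide C (x \<oplus> y)"
    and beta_plus: "\<lbrakk>x \<in> Obj C; y \<in> Obj C; z \<in> Obj C\<rbrakk>
      \<Longrightarrow> Beta C x (y \<oplus> z) = (Ide C y \<boxplus> Beta C x z) \<cdot> (Beta C x y \<boxplus> Ide C z)"

text \<open>\<open>cst2 F (x, y)\<close> is \<open>F\<^sub>2 : F x + F y \<rightarrow> F (x + y)\<close> and \<open>cst0 F\<close> is \<open>F\<^sub>0 : 0 \<rightarrow> F 0\<close>.\<close>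

record ('o, 'm, 'p, 'n) smf = "('o, 'm, 'p, 'n) fct" +
  cst2 :: "'o \<times> 'o \<Rightarrow> 'n"
  cst0 :: 'n

locale sm_functor = dom: permutative A + cod: permutative C + cat_functor A C F
  for A :: "('o, 'm) perm" and C :: "('p, 'n) perm" and F :: "('o, 'm, 'p, 'n) smf" +
  assumes cst2_ext: "cst2 F \<in> extensional (Obj A \<times> Obj A)"
    and cst2_hom: "\<lbrakk>x \<in> Obj A; y \<in> Obj A\<rbrakk>
      \<Longrightarrow> cst2 F (x, y) \<in> hom C (fob F x \<oplus>\<^bsub>C\<^esub> fob F y) (fob F (x \<oplus>\<^bsub>A\<^esub> y))"
    and cst2_iso: "\<lbrakk>x \<in> Obj A; y \<in> Obj A\<rbrakk> \<Longrightarrow> is_iso C (cst2 F (x, y))"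
    and cst2_natural: "\<lbrakk>f \<in> hom A x x'; g \<in> hom A y y'\<rbrakk>
      \<Longrightarrow> far F (f \<boxplus>\<^bsub>A\<^esub> g) \<cdot>\<^bsub>C\<^esub> cst2 F (x, y) = cst2 F (x', y') \<cdot>\<^bsub>C\<^esub> (far F f \<boxplus>\<^bsub>C\<^esub> far F g)"
    and cst0_hom: "cst0 F \<in> hom C (Zero C) (fob F (Zero A))"
    and cst0_iso: "is_iso C (cst0 F)"
    and cst_assoc: "\<lbrakk>x \<in> Obj A; y \<in> Obj A; z \<in> Obj A\<rbrakk>
      \<Longrightarrow> cst2 F (x \<oplus>\<^bsub>A\<^esub> y, z) \<cdot>\<^bsub>C\<^esub> (cst2 F (x, y) \<boxplus>\<^bsub>C\<^esub> Ide C (fob F z)) =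
          cst2 F (x, y \<oplus>\<^bsub>A\<^esub> z) \<cdot>\<^bsub>C\<^esub> (Ide C (fob F x) \<boxplus>\<^bsub>C\<^esub> cst2 F (y, z))"
    and cst_unit_right: "x \<in> Obj A
      \<Longrightarrow> cst2 F (x, Zero A) \<cdot>\<^bsub>C\<^esub> (Ide C (fob F x) \<boxplus>\<^bsub>C\<^esub> cst0 F) = Ide C (fob F x)"
    and cst_unit_left: "x \<in> Obj A
      \<Longrightarrow> cst2 F (Zero A, x) \<cdot>\<^bsub>C\<^esub> (cst0 F \<boxplus>\<^bsub>C\<^esub> Ide C (fob F x)) = Ide C (fob F x)"
    and cst_symm: "\<lbrakk>x \<in> Obj A; y \<in> Obj A\<rbrakk>
      \<Longrightarrow> far F (Beta A x y) \<cdot>\<^bsub>C\<^esub> cst2 F (x, y) = cst2 F (y, x) \<cdot>\<^bsub>C\<^esub> Beta C (fob F x) (fob F y)"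

locale strict_sm_functor = sm_functor A C F
  for A :: "('o, 'm) perm" and C :: "('p, 'n) perm" and F :: "('o, 'm, 'p, 'n) smf" +
  assumes cst2_strict: "\<lbrakk>x \<in> Obj A; y \<in> Obj A\<rbrakk> \<Longrightarrow> cst2 F (x, y) = Ide C (fob F (x \<oplus>\<^bsub>A\<^esub> y))"
    and cst0_strict: "cst0 F = Ide C (Zero C)"

definition sm_trans ::
    "('o, 'm) perm \<Rightarrow> ('p, 'n) perm \<Rightarrow> ('o, 'm, 'p, 'n) smf \<Rightarrow> ('o, 'm, 'p, 'n) smf \<Rightarrow>
     ('o \<Rightarrow> 'n) \<Rightarrow> bool" where
  "sm_trans A C F G t \<longleftrightarrow>
     sm_functor A C F \<and> sm_functor A C G \<and> nat_trans A C F G t \<and>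
     (\<forall>x\<in>Obj A. \<forall>y\<in>Obj A.
        t (x \<oplus>\<^bsub>A\<^esub> y) \<cdot>\<^bsub>C\<^esub> cst2 F (x, y) = cst2 G (x, y) \<cdot>\<^bsub>C\<^esub> (t x \<boxplus>\<^bsub>C\<^esub> t y)) \<and>
     t (Zero A) \<cdot>\<^bsub>C\<^esub> cst0 F = cst0 G"

definition smf_comp ::
    "('o, 'm) perm \<Rightarrow> ('q, 'k) perm \<Rightarrow> ('p, 'n, 'q, 'k) smf \<Rightarrow> ('o, 'm, 'p, 'n) smf \<Rightarrow>
     ('o, 'm, 'q, 'k) smf" where
  "smf_comp A C G F =
    \<lparr>fob = (\<lambda>x\<in>Obj A. fob G (fob F x)),
     far = (\<lambda>f\<in>Arr A. far G (far F f)),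
     cst2 = (\<lambda>(x, y)\<in>Obj A \<times> Obj A. far G (cst2 F (x, y)) \<cdot>\<^bsub>C\<^esub> cst2 G (fob F x, fob F y)),
     cst0 = far G (cst0 F) \<cdot>\<^bsub>C\<^esub> cst0 G\<rparr>"

definition PermCat_s ::
    "('o, 'm) perm \<Rightarrow> ('p, 'n) perm \<Rightarrow>
     (('o, 'm, 'p, 'n) smf, ('o, 'm, 'p, 'n) smf \<times> ('o \<Rightarrow> 'n) \<times> ('o, 'm, 'p, 'n) smf) cat" where
  "PermCat_s A C = trans_cat A C {F. strict_sm_functor A C F} (sm_trans A C)"


section \<open>Bilinear maps\<close>

text \<open>
  For a bilinear map \<open>H\<close> the constraints are
  \<open>bdl H (a, b, b') : H(a,b) + H(a,b') \<rightarrow> H(a,b+b')\<close> (written \<open>H\<^sub>a(b,b')\<close> on paper),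
  \<open>bdr H (a, a', b) : H(a,b) + H(a',b) \<rightarrow> H(a+a',b)\<close> (written \<open>H\<^sub>b(a,a')\<close>),
  \<open>bzl H a : 0 \<rightarrow> H(a,0)\<close> and \<open>bzr H b : 0 \<rightarrow> H(0,b)\<close>.
\<close>

record ('oa, 'ma, 'ob, 'mb, 'oc, 'mc) bil = "('oa \<times> 'ob, 'ma \<times> 'mb, 'oc, 'mc) fct" +
  bdl :: "'oa \<times> 'ob \<times> 'ob \<Rightarrow> 'mc"
  bdr :: "'oa \<times> 'oa \<times> 'ob \<Rightarrow> 'mc"
  bzl :: "'oa \<Rightarrow> 'mc"
  bzr :: "'ob \<Rightarrow> 'mc"

definition fix_left ::
    "('oa, 'ma) perm \<Rightarrow> ('ob, 'mb) perm \<Rightarrow> ('oa, 'ma, 'ob, 'mb, 'oc, 'mc) bil \<Rightarrow> 'oa \<Rightarrow>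
     ('ob, 'mb, 'oc, 'mc) smf" where
  "fix_left A B H a =
    \<lparr>fob = (\<lambda>b\<in>Obj B. fob H (a, b)),
     far = (\<lambda>g\<in>Arr B. far H (Ide A a, g)),
     cst2 = (\<lambda>(b, b')\<in>Obj B \<times> Obj B. bdl H (a, b, b')),
     cst0 = bzl H a\<rparr>"

definition fix_right ::
    "('oa, 'ma) perm \<Rightarrow> ('ob, 'mb) perm \<Rightarrow> ('oa, 'ma, 'ob, 'mb, 'oc, 'mc) bil \<Rightarrow> 'ob \<Rightarrow>
     ('oa, 'ma, 'oc, 'mc) smf" where
  "fix_right A B H b =
    \<lparr>fob = (\<lambda>a\<in>Obj A. fob H (a, b)),
     far = (\<lambda>f\<in>Arr A. far H (f, Ide B b)),
     cst2 = (\<lambda>(a, a')\<in>Obj A \<times> Obj A. bdr H (a, a', b)),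
     cst0 = bzr H b\<rparr>"

locale bilinear = fst: permutative A + snd: permutative B + cod: permutative C +
    cat_functor "prod_cat A B" C H
  for A :: "('oa, 'ma) perm" and B :: "('ob, 'mb) perm" and C :: "('oc, 'mc) perm"
    and H :: "('oa, 'ma, 'ob, 'mb, 'oc, 'mc) bil" +
  assumes bdl_ext: "bdl H \<in> extensional (Obj A \<times> Obj B \<times> Obj B)"
    and bdr_ext: "bdr H \<in> extensional (Obj A \<times> Obj A \<times> Obj B)"
    and bzl_ext: "bzl H \<in> extensional (Obj A)"
    and bzr_ext: "bzr H \<in> extensional (Obj B)"
    and fix_left_sm: "a \<in> Obj A \<Longrightarrow> sm_functor B C (fix_left A B H a)"
    and fix_right_sm: "b \<in> Obj B \<Longrightarrow> sm_functor A C (fix_right A B H b)"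
    and bdl_natural: "\<lbrakk>f \<in> hom A a a1; g \<in> hom B b b1; g' \<in> hom B b' b1'\<rbrakk>
      \<Longrightarrow> far H (f, g \<boxplus>\<^bsub>B\<^esub> g') \<cdot>\<^bsub>C\<^esub> bdl H (a, b, b') =
          bdl H (a1, b1, b1') \<cdot>\<^bsub>C\<^esub> (far H (f, g) \<boxplus>\<^bsub>C\<^esub> far H (f, g'))"
    and bdr_natural: "\<lbrakk>f \<in> hom A a a1; f' \<in> hom A a' a1'; g \<in> hom B b b1\<rbrakk>
      \<Longrightarrow> far H (f \<boxplus>\<^bsub>A\<^esub> f', g) \<cdot>\<^bsub>C\<^esub> bdr H (a, a', b) =
          bdr H (a1, a1', b1) \<cdot>\<^bsub>C\<^esub> (far H (f, g) \<boxplus>\<^bsub>C\<^esub> far H (f', g))"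
    and bzl_natural: "f \<in> hom A a a1 \<Longrightarrow> far H (f, Ide B (Zero B)) \<cdot>\<^bsub>C\<^esub> bzl H a = bzl H a1"
    and bzr_natural: "g \<in> hom B b b1 \<Longrightarrow> far H (Ide A (Zero A), g) \<cdot>\<^bsub>C\<^esub> bzr H b = bzr H b1"
    and interchange: "\<lbrakk>a \<in> Obj A; a' \<in> Obj A; b \<in> Obj B; b' \<in> Obj B\<rbrakk>
      \<Longrightarrow> bdr H (a, a', b \<oplus>\<^bsub>B\<^esub> b') \<cdot>\<^bsub>C\<^esub> (bdl H (a, b, b') \<boxplus>\<^bsub>C\<^esub> bdl H (a', b, b')) =
          bdl H (a \<oplus>\<^bsub>A\<^esub> a', b, b') \<cdot>\<^bsub>C\<^esub> (bdr H (a, a', b) \<boxplus>\<^bsub>C\<^esub> bdr H (a, a', b')) \<cdot>\<^bsub>C\<^esub>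
            (Ide C (fob H (a, b)) \<boxplus>\<^bsub>C\<^esub> Beta C (fob H (a, b')) (fob H (a', b))
               \<boxplus>\<^bsub>C\<^esub> Ide C (fob H (a', b')))"
    and zero_zero: "bzl H (Zero A) = bzr H (Zero B)"
    and bdr_zero: "\<lbrakk>a \<in> Obj A; a' \<in> Obj A\<rbrakk>
      \<Longrightarrow> bdr H (a, a', Zero B) \<cdot>\<^bsub>C\<^esub> (bzl H a \<boxplus>\<^bsub>C\<^esub> bzl H a') = bzl H (a \<oplus>\<^bsub>A\<^esub> a')"
    and bdl_zero: "\<lbrakk>b \<in> Obj B; b' \<in> Obj B\<rbrakk>
      \<Longrightarrow> bdl H (Zero A, b, b') \<cdot>\<^bsub>C\<^esub> (bzr H b \<boxplus>\<^bsub>C\<^esub> bzr H b') = bzr H (b \<oplus>\<^bsub>B\<^esub> b')"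

definition bil_trans ::
    "('oa, 'ma) perm \<Rightarrow> ('ob, 'mb) perm \<Rightarrow> ('oc, 'mc) perm \<Rightarrow>
     ('oa, 'ma, 'ob, 'mb, 'oc, 'mc) bil \<Rightarrow> ('oa, 'ma, 'ob, 'mb, 'oc, 'mc) bil \<Rightarrow>
     ('oa \<times> 'ob \<Rightarrow> 'mc) \<Rightarrow> bool" where
  "bil_trans A B C H J t \<longleftrightarrow>
     bilinear A B C H \<and> bilinear A B C J \<and> nat_trans (prod_cat A B) C H J t \<and>
     (\<forall>a\<in>Obj A. sm_trans B C (fix_left A B H a) (fix_left A B J a) (\<lambda>b\<in>Obj B. t (a, b))) \<and>
     (\<forall>b\<in>Obj B. sm_trans A C (fix_right A B H b) (fix_right A B J b) (\<lambda>a\<in>Obj A. t (a, b)))"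

definition Bilin ::
    "('oa, 'ma) perm \<Rightarrow> ('ob, 'mb) perm \<Rightarrow> ('oc, 'mc) perm \<Rightarrow>
     (('oa, 'ma, 'ob, 'mb, 'oc, 'mc) bil,
      ('oa, 'ma, 'ob, 'mb, 'oc, 'mc) bil \<times> ('oa \<times> 'ob \<Rightarrow> 'mc) \<times> ('oa, 'ma, 'ob, 'mb, 'oc, 'mc) bil) cat"
  where "Bilin A B C = trans_cat (prod_cat A B) C {H. bilinear A B C H} (bil_trans A B C)"

text \<open>\<open>bil_pre\<close> is \<open>H(P-, Q-)\<close> for \<open>P : A' \<rightarrow> A\<close> and \<open>Q : B' \<rightarrow> B\<close>; \<open>bil_post\<close> is \<open>R H\<close> for \<open>R : C \<rightarrow> C'\<close>.\<close>

definition bil_pre ::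
    "('oa', 'ma') perm \<Rightarrow> ('ob', 'mb') perm \<Rightarrow> ('oa, 'ma) perm \<Rightarrow> ('ob, 'mb) perm \<Rightarrow>
     ('oc, 'mc) perm \<Rightarrow> ('oa', 'ma', 'oa, 'ma) smf \<Rightarrow> ('ob', 'mb', 'ob, 'mb) smf \<Rightarrow>
     ('oa, 'ma, 'ob, 'mb, 'oc, 'mc) bil \<Rightarrow> ('oa', 'ma', 'ob', 'mb', 'oc, 'mc) bil" where
  "bil_pre A' B' A B C P Q H =
    \<lparr>fob = (\<lambda>(a, b)\<in>Obj A' \<times> Obj B'. fob H (fob P a, fob Q b)),
     far = (\<lambda>(f, g)\<in>Arr A' \<times> Arr B'. far H (far P f, far Q g)),
     bdl = (\<lambda>(a, b, b')\<in>Obj A' \<times> Obj B' \<times> Obj B'.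
              far H (Ide A (fob P a), cst2 Q (b, b')) \<cdot>\<^bsub>C\<^esub> bdl H (fob P a, fob Q b, fob Q b')),
     bdr = (\<lambda>(a, a', b)\<in>Obj A' \<times> Obj A' \<times> Obj B'.
              far H (cst2 P (a, a'), Ide B (fob Q b)) \<cdot>\<^bsub>C\<^esub> bdr H (fob P a, fob P a', fob Q b)),
     bzl = (\<lambda>a\<in>Obj A'. far H (Ide A (fob P a), cst0 Q) \<cdot>\<^bsub>C\<^esub> bzl H (fob P a)),
     bzr = (\<lambda>b\<in>Obj B'. far H (cst0 P, Ide B (fob Q b)) \<cdot>\<^bsub>C\<^esub> bzr H (fob Q b))\<rparr>"

definition bil_post ::
    "('oa, 'ma) perm \<Rightarrow> ('ob, 'mb) perm \<Rightarrow> ('oc', 'mc') perm \<Rightarrow> ('oc, 'mc, 'oc', 'mc') smf \<Rightarrow>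
     ('oa, 'ma, 'ob, 'mb, 'oc, 'mc) bil \<Rightarrow> ('oa, 'ma, 'ob, 'mb, 'oc', 'mc') bil" where
  "bil_post A B C' R H =
    \<lparr>fob = (\<lambda>(a, b)\<in>Obj A \<times> Obj B. fob R (fob H (a, b))),
     far = (\<lambda>(f, g)\<in>Arr A \<times> Arr B. far R (far H (f, g))),
     bdl = (\<lambda>(a, b, b')\<in>Obj A \<times> Obj B \<times> Obj B.
              far R (bdl H (a, b, b')) \<cdot>\<^bsub>C'\<^esub> cst2 R (fob H (a, b), fob H (a, b'))),
     bdr = (\<lambda>(a, a', b)\<in>Obj A \<times> Obj A \<times> Obj B.
              far R (bdr H (a, a', b)) \<cdot>\<^bsub>C'\<^esub> cst2 R (fob H (a, b), fob H (a', b))),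
     bzl = (\<lambda>a\<in>Obj A. far R (bzl H a) \<cdot>\<^bsub>C'\<^esub> cst0 R),
     bzr = (\<lambda>b\<in>Obj B. far R (bzr H b) \<cdot>\<^bsub>C'\<^esub> cst0 R)\<rparr>"


section \<open>The tensor product of permutative categories\<close>

text \<open>
  Objects of \<open>A \<otimes> B\<close> are lists of pairs, \<open>[(a\<^sub>1, b\<^sub>1), \<dots>, (a\<^sub>n, b\<^sub>n)]\<close> standing for
  \<open>\<Sum> a\<^sub>i.b\<^sub>i\<close>.  Arrows are classes of formal expressions built from identities, the arrows
  \<open>f.g\<close> of \<open>A \<times> B\<close>, the adjoined generators and their formal inverses, modulo the
  congruence \<open>teq\<close> generated by the strict monoidal category axioms, functoriality of
  \<open>(f, g) \<mapsto> f.g\<close>, invertibility of the generators, and the listed relations.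

  \<open>DeltaL a b b'\<close> is \<open>\<delta>\<^sup>L\<^sub>a(b,b')\<close>, \<open>DeltaR a a' b\<close> is \<open>\<delta>\<^sup>R\<^sub>b(a,a')\<close>.
\<close>

datatype ('oa, 'ob) gen =
    DeltaL 'oa 'ob 'ob
  | DeltaR 'oa 'oa 'ob
  | Braid "'oa \<times> 'ob" "'oa \<times> 'ob"
  | ZetaL 'oa
  | ZetaR 'ob

datatype ('oa, 'ma, 'ob, 'mb) tm =
    TId "('oa \<times> 'ob) list"
  | TDot 'ma 'mb
  | TGen "('oa, 'ob) gen"
  | TInv "('oa, 'ob) gen"
  | TComp "('oa, 'ma, 'ob, 'mb) tm" "('oa, 'ma, 'ob, 'mb) tm" (infixr "\<circ>\<^sub>t" 60)
  | TPlus "('oa, 'ma, 'ob, 'mb) tm" "('oa, 'ma, 'ob, 'mb) tm" (infixl "+\<^sub>t" 65)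

fun gwf :: "('oa, 'ma) perm \<Rightarrow> ('ob, 'mb) perm \<Rightarrow> ('oa, 'ob) gen \<Rightarrow> bool" where
  "gwf A B (DeltaL a b b') \<longleftrightarrow> a \<in> Obj A \<and> b \<in> Obj B \<and> b' \<in> Obj B"
| "gwf A B (DeltaR a a' b) \<longleftrightarrow> a \<in> Obj A \<and> a' \<in> Obj A \<and> b \<in> Obj B"
| "gwf A B (Braid p q) \<longleftrightarrow> p \<in> Obj A \<times> Obj B \<and> q \<in> Obj A \<times> Obj B"
| "gwf A B (ZetaL a) \<longleftrightarrow> a \<in> Obj A"
| "gwf A B (ZetaR b) \<longleftrightarrow> b \<in> Obj B"

fun gsrc :: "('oa, 'ob) gen \<Rightarrow> ('oa \<times> 'ob) list" where
  "gsrc (DeltaL a b b') = [(a, b), (a, b')]"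
| "gsrc (DeltaR a a' b) = [(a, b), (a', b)]"
| "gsrc (Braid p q) = [p, q]"
| "gsrc (ZetaL a) = []"
| "gsrc (ZetaR b) = []"

fun gtgt :: "('oa, 'ma) perm \<Rightarrow> ('ob, 'mb) perm \<Rightarrow> ('oa, 'ob) gen \<Rightarrow> ('oa \<times> 'ob) list" where
  "gtgt A B (DeltaL a b b') = [(a, b \<oplus>\<^bsub>B\<^esub> b')]"
| "gtgt A B (DeltaR a a' b) = [(a \<oplus>\<^bsub>A\<^esub> a', b)]"
| "gtgt A B (Braid p q) = [q, p]"
| "gtgt A B (ZetaL a) = [(a, Zero B)]"
| "gtgt A B (ZetaR b) = [(Zero A, b)]"

primrec tsrc :: "('oa, 'ma) perm \<Rightarrow> ('ob, 'mb) perm \<Rightarrow> ('oa, 'ma, 'ob, 'mb) tm \<Rightarrow> ('oa \<times> 'ob) list"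
  where
  "tsrc A B (TId xs) = xs"
| "tsrc A B (TDot f g) = [(Dom A f, Dom B g)]"
| "tsrc A B (TGen e) = gsrc e"
| "tsrc A B (TInv e) = gtgt A B e"
| "tsrc A B (t \<circ>\<^sub>t s) = tsrc A B s"
| "tsrc A B (t +\<^sub>t s) = tsrc A B t @ tsrc A B s"

primrec ttgt :: "('oa, 'ma) perm \<Rightarrow> ('ob, 'mb) perm \<Rightarrow> ('oa, 'ma, 'ob, 'mb) tm \<Rightarrow> ('oa \<times> 'ob) list"
  where
  "ttgt A B (TId xs) = xs"
| "ttgt A B (TDot f g) = [(Cod A f, Cod B g)]"
| "ttgt A B (TGen e) = gtgt A B e"
| "ttgt A B (TInv e) = gsrc e"
| "ttgt A B (t \<circ>\<^sub>t s) = ttgt A B t"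
| "ttgt A B (t +\<^sub>t s) = ttgt A B t @ ttgt A B s"

primrec twf :: "('oa, 'ma) perm \<Rightarrow> ('ob, 'mb) perm \<Rightarrow> ('oa, 'ma, 'ob, 'mb) tm \<Rightarrow> bool" where
  "twf A B (TId xs) \<longleftrightarrow> xs \<in> lists (Obj A \<times> Obj B)"
| "twf A B (TDot f g) \<longleftrightarrow> f \<in> Arr A \<and> g \<in> Arr B"
| "twf A B (TGen e) \<longleftrightarrow> gwf A B e"
| "twf A B (TInv e) \<longleftrightarrow> gwf A B e"
| "twf A B (t \<circ>\<^sub>t s) \<longleftrightarrow> twf A B t \<and> twf A B s \<and> ttgt A B s = tsrc A B t"
| "twf A B (t +\<^sub>t s) \<longleftrightarrow> twf A B t \<and> twf A B s"

definition thom ::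
    "('oa, 'ma) perm \<Rightarrow> ('ob, 'mb) perm \<Rightarrow> ('oa \<times> 'ob) list \<Rightarrow> ('oa \<times> 'ob) list \<Rightarrow>
     ('oa, 'ma, 'ob, 'mb) tm set" where
  "thom A B xs ys = {t. twf A B t \<and> tsrc A B t = xs \<and> ttgt A B t = ys}"

text \<open>
  The symmetry on arbitrary sums, assembled from the adjoined \<open>\<beta>\<close>'s on pairs \<open>a.b\<close> in the
  only way compatible with \<open>\<beta>(x, y+z) = (1 + \<beta>(x,z)) (\<beta>(x,y) + 1)\<close> and
  \<open>\<beta>(x+y, z) = (\<beta>(x,z) + 1) (1 + \<beta>(y,z))\<close>.
\<close>

primrec tbeta1 :: "'oa \<times> 'ob \<Rightarrow> ('oa \<times> 'ob) list \<Rightarrow> ('oa, 'ma, 'ob, 'mb) tm" where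
  "tbeta1 p [] = TId [p]"
| "tbeta1 p (q # ys) = (TId [q] +\<^sub>t tbeta1 p ys) \<circ>\<^sub>t (TGen (Braid p q) +\<^sub>t TId ys)"

primrec tbeta :: "('oa \<times> 'ob) list \<Rightarrow> ('oa \<times> 'ob) list \<Rightarrow> ('oa, 'ma, 'ob, 'mb) tm" where
  "tbeta [] ys = TId ys"
| "tbeta (p # xs) ys = (tbeta1 p ys +\<^sub>t TId xs) \<circ>\<^sub>t (TId [p] +\<^sub>t tbeta xs ys)"

inductive teq ::
    "('oa, 'ma) perm \<Rightarrow> ('ob, 'mb) perm \<Rightarrow>
     ('oa, 'ma, 'ob, 'mb) tm \<Rightarrow> ('oa, 'ma, 'ob, 'mb) tm \<Rightarrow> bool"
  for A :: "('oa, 'ma) perm" and B :: "('ob, 'mb) perm" where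
  refl: "twf A B t \<Longrightarrow> teq A B t t"
| sym: "teq A B t s \<Longrightarrow> teq A B s t"
| trans: "\<lbrakk>teq A B t s; teq A B s r\<rbrakk> \<Longrightarrow> teq A B t r"
| comp_cong: "\<lbrakk>teq A B t t'; teq A B s s'; ttgt A B s = tsrc A B t\<rbrakk>
    \<Longrightarrow> teq A B (t \<circ>\<^sub>t s) (t' \<circ>\<^sub>t s')"
| plus_cong: "\<lbrakk>teq A B t t'; teq A B s s'\<rbrakk> \<Longrightarrow> teq A B (t +\<^sub>t s) (t' +\<^sub>t s')"
| id_left: "t \<in> thom A B xs ys \<Longrightarrow> teq A B (TId ys \<circ>\<^sub>t t) t"
| id_right: "t \<in> thom A B xs ys \<Longrightarrow> teq A B (t \<circ>\<^sub>t TId xs) t"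
| comp_assoc: "\<lbrakk>t \<in> thom A B ws xs; s \<in> thom A B xs ys; r \<in> thom A B ys zs\<rbrakk>
    \<Longrightarrow> teq A B ((r \<circ>\<^sub>t s) \<circ>\<^sub>t t) (r \<circ>\<^sub>t (s \<circ>\<^sub>t t))"
| plus_id: "\<lbrakk>xs \<in> lists (Obj A \<times> Obj B); ys \<in> lists (Obj A \<times> Obj B)\<rbrakk>
    \<Longrightarrow> teq A B (TId xs +\<^sub>t TId ys) (TId (xs @ ys))"
| plus_comp: "\<lbrakk>t \<in> thom A B xs ys; t' \<in> thom A B ys zs; s \<in> thom A B us vs; s' \<in> thom A B vs ws\<rbrakk>
    \<Longrightarrow> teq A B ((t' \<circ>\<^sub>t t) +\<^sub>t (s' \<circ>\<^sub>t s)) ((t' +\<^sub>t s') \<circ>\<^sub>t (t +\<^sub>t s))"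
| plus_assoc: "\<lbrakk>twf A B t; twf A B s; twf A B r\<rbrakk> \<Longrightarrow> teq A B ((t +\<^sub>t s) +\<^sub>t r) (t +\<^sub>t (s +\<^sub>t r))"
| zero_left: "twf A B t \<Longrightarrow> teq A B (TId [] +\<^sub>t t) t"
| zero_right: "twf A B t \<Longrightarrow> teq A B (t +\<^sub>t TId []) t"
| dot_id: "\<lbrakk>a \<in> Obj A; b \<in> Obj B\<rbrakk> \<Longrightarrow> teq A B (TDot (Ide A a) (Ide B b)) (TId [(a, b)])"
| dot_comp: "\<lbrakk>f \<in> hom A a a1; f' \<in> hom A a1 a2; g \<in> hom B b b1; g' \<in> hom B b1 b2\<rbrakk>
    \<Longrightarrow> teq A B (TDot (f' \<cdot>\<^bsub>A\<^esub> f) (g' \<cdot>\<^bsub>B\<^esub> g)) (TDot f' g' \<circ>\<^sub>t TDot f g)"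
| inv_left: "gwf A B e \<Longrightarrow> teq A B (TInv e \<circ>\<^sub>t TGen e) (TId (gsrc e))"
| inv_right: "gwf A B e \<Longrightarrow> teq A B (TGen e \<circ>\<^sub>t TInv e) (TId (gtgt A B e))"
| deltaL_natural: "\<lbrakk>f \<in> hom A a a1; g \<in> hom B b b1; g' \<in> hom B b' b1'\<rbrakk>
    \<Longrightarrow> teq A B (TDot f (g \<boxplus>\<^bsub>B\<^esub> g') \<circ>\<^sub>t TGen (DeltaL a b b'))
                (TGen (DeltaL a1 b1 b1') \<circ>\<^sub>t (TDot f g +\<^sub>t TDot f g'))"
| deltaR_natural: "\<lbrakk>f \<in> hom A a a1; f' \<in> hom A a' a1'; g \<in> hom B b b1\<rbrakk>
    \<Longrightarrow> teq A B (TDot (f \<boxplus>\<^bsub>A\<^esub> f') g \<circ>\<^sub>t TGen (DeltaR a a' b))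
                (TGen (DeltaR a1 a1' b1) \<circ>\<^sub>t (TDot f g +\<^sub>t TDot f' g))"
| zetaL_natural: "f \<in> hom A a a1
    \<Longrightarrow> teq A B (TDot f (Ide B (Zero B)) \<circ>\<^sub>t TGen (ZetaL a)) (TGen (ZetaL a1))"
| zetaR_natural: "g \<in> hom B b b1
    \<Longrightarrow> teq A B (TDot (Ide A (Zero A)) g \<circ>\<^sub>t TGen (ZetaR b)) (TGen (ZetaR b1))"
  \<comment> \<open>naturality of the symmetry on sums is required against all arrows, so it covers the adjoined ones\<close>
| beta_natural: "\<lbrakk>t \<in> thom A B xs xs'; s \<in> thom A B ys ys'\<rbrakk>
    \<Longrightarrow> teq A B (tbeta xs' ys' \<circ>\<^sub>t (t +\<^sub>t s)) ((s +\<^sub>t t) \<circ>\<^sub>t tbeta xs ys)"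
| beta_inv: "\<lbrakk>xs \<in> lists (Obj A \<times> Obj B); ys \<in> lists (Obj A \<times> Obj B)\<rbrakk>
    \<Longrightarrow> teq A B (tbeta ys xs \<circ>\<^sub>t tbeta xs ys) (TId (xs @ ys))"
| beta_plus: "\<lbrakk>xs \<in> lists (Obj A \<times> Obj B); ys \<in> lists (Obj A \<times> Obj B); zs \<in> lists (Obj A \<times> Obj B)\<rbrakk>
    \<Longrightarrow> teq A B (tbeta xs (ys @ zs)) ((TId ys +\<^sub>t tbeta xs zs) \<circ>\<^sub>t (tbeta xs ys +\<^sub>t TId zs))"
| deltaL_assoc: "\<lbrakk>a \<in> Obj A; b \<in> Obj B; b' \<in> Obj B; b'' \<in> Obj B\<rbrakk>
    \<Longrightarrow> teq A B (TGen (DeltaL a (b \<oplus>\<^bsub>B\<^esub> b') b'') \<circ>\<^sub>t (TGen (DeltaL a b b') +\<^sub>t TId [(a, b'')]))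
                (TGen (DeltaL a b (b' \<oplus>\<^bsub>B\<^esub> b'')) \<circ>\<^sub>t (TId [(a, b)] +\<^sub>t TGen (DeltaL a b' b'')))"
| deltaL_unit_right: "\<lbrakk>a \<in> Obj A; b \<in> Obj B\<rbrakk>
    \<Longrightarrow> teq A B (TGen (DeltaL a b (Zero B)) \<circ>\<^sub>t (TId [(a, b)] +\<^sub>t TGen (ZetaL a))) (TId [(a, b)])"
| deltaL_unit_left: "\<lbrakk>a \<in> Obj A; b \<in> Obj B\<rbrakk>
    \<Longrightarrow> teq A B (TGen (DeltaL a (Zero B) b) \<circ>\<^sub>t (TGen (ZetaL a) +\<^sub>t TId [(a, b)])) (TId [(a, b)])"
| deltaL_symm: "\<lbrakk>a \<in> Obj A; b \<in> Obj B; b' \<in> Obj B\<rbrakk>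
    \<Longrightarrow> teq A B (TDot (Ide A a) (Beta B b b') \<circ>\<^sub>t TGen (DeltaL a b b'))
                (TGen (DeltaL a b' b) \<circ>\<^sub>t TGen (Braid (a, b) (a, b')))"
| deltaR_assoc: "\<lbrakk>a \<in> Obj A; a' \<in> Obj A; a'' \<in> Obj A; b \<in> Obj B\<rbrakk>
    \<Longrightarrow> teq A B (TGen (DeltaR (a \<oplus>\<^bsub>A\<^esub> a') a'' b) \<circ>\<^sub>t (TGen (DeltaR a a' b) +\<^sub>t TId [(a'', b)]))
                (TGen (DeltaR a (a' \<oplus>\<^bsub>A\<^esub> a'') b) \<circ>\<^sub>t (TId [(a, b)] +\<^sub>t TGen (DeltaR a' a'' b)))"
| deltaR_unit_right: "\<lbrakk>a \<in> Obj A; b \<in> Obj B\<rbrakk>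
    \<Longrightarrow> teq A B (TGen (DeltaR a (Zero A) b) \<circ>\<^sub>t (TId [(a, b)] +\<^sub>t TGen (ZetaR b))) (TId [(a, b)])"
| deltaR_unit_left: "\<lbrakk>a \<in> Obj A; b \<in> Obj B\<rbrakk>
    \<Longrightarrow> teq A B (TGen (DeltaR (Zero A) a b) \<circ>\<^sub>t (TGen (ZetaR b) +\<^sub>t TId [(a, b)])) (TId [(a, b)])"
| deltaR_symm: "\<lbrakk>a \<in> Obj A; a' \<in> Obj A; b \<in> Obj B\<rbrakk>
    \<Longrightarrow> teq A B (TDot (Beta A a a') (Ide B b) \<circ>\<^sub>t TGen (DeltaR a a' b))
                (TGen (DeltaR a' a b) \<circ>\<^sub>t TGen (Braid (a, b) (a', b)))"
| delta_delta: "\<lbrakk>a \<in> Obj A; a' \<in> Obj A; b \<in> Obj B; b' \<in> Obj B\<rbrakk>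
    \<Longrightarrow> teq A B
          (TGen (DeltaL (a \<oplus>\<^bsub>A\<^esub> a') b b') \<circ>\<^sub>t (TGen (DeltaR a a' b) +\<^sub>t TGen (DeltaR a a' b')))
          (TGen (DeltaR a a' (b \<oplus>\<^bsub>B\<^esub> b')) \<circ>\<^sub>t (TGen (DeltaL a b b') +\<^sub>t TGen (DeltaL a' b b')) \<circ>\<^sub>t
             (TId [(a, b)] +\<^sub>t TGen (Braid (a', b) (a, b')) +\<^sub>t TId [(a', b')]))"
| zeta_zeta: "teq A B (TGen (ZetaL (Zero A))) (TGen (ZetaR (Zero B)))"
| deltaR_zeta: "\<lbrakk>a \<in> Obj A; a' \<in> Obj A\<rbrakk>
    \<Longrightarrow> teq A B (TGen (DeltaR a a' (Zero B)) \<circ>\<^sub>t (TGen (ZetaL a) +\<^sub>t TGen (ZetaL a')))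
                (TGen (ZetaL (a \<oplus>\<^bsub>A\<^esub> a')))"
| deltaL_zeta: "\<lbrakk>b \<in> Obj B; b' \<in> Obj B\<rbrakk>
    \<Longrightarrow> teq A B (TGen (DeltaL (Zero A) b b') \<circ>\<^sub>t (TGen (ZetaR b) +\<^sub>t TGen (ZetaR b')))
                (TGen (ZetaR (b \<oplus>\<^bsub>B\<^esub> b')))"

type_synonym ('oa, 'ma, 'ob, 'mb) tarr = "('oa, 'ma, 'ob, 'mb) tm set"

definition teq_rel ::
    "('oa, 'ma) perm \<Rightarrow> ('ob, 'mb) perm \<Rightarrow> ('oa, 'ma, 'ob, 'mb) tm rel" where
  "teq_rel A B = {(t, s). teq A B t s}"

definition tcls ::
    "('oa, 'ma) perm \<Rightarrow> ('ob, 'mb) perm \<Rightarrow> ('oa, 'ma, 'ob, 'mb) tm \<Rightarrow> ('oa, 'ma, 'ob, 'mb) tarr" where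
  "tcls A B t = teq_rel A B `` {t}"

definition trep :: "('oa, 'ma, 'ob, 'mb) tarr \<Rightarrow> ('oa, 'ma, 'ob, 'mb) tm" where
  "trep X = (SOME t. t \<in> X)"

definition tensor ::
    "('oa, 'ma) perm \<Rightarrow> ('ob, 'mb) perm \<Rightarrow>
     (('oa \<times> 'ob) list, ('oa, 'ma, 'ob, 'mb) tarr) perm" (infixl "\<otimes>" 70) where
  "A \<otimes> B =
    \<lparr>Obj = lists (Obj A \<times> Obj B),
     Arr = {t. twf A B t} // teq_rel A B,
     Dom = (\<lambda>X. tsrc A B (trep X)),
     Cod = (\<lambda>X. ttgt A B (trep X)),
     Ide = (\<lambda>xs. tcls A B (TId xs)),
     Cmp = (\<lambda>X Y. tcls A B (trep X \<circ>\<^sub>t trep Y)),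
     Zero = [],
     Plus = (@),
     PlusA = (\<lambda>X Y. tcls A B (trep X +\<^sub>t trep Y)),
     Beta = (\<lambda>xs ys. tcls A B (tbeta xs ys))\<rparr>"

definition tensor_univ ::
    "('oa, 'ma) perm \<Rightarrow> ('ob, 'mb) perm \<Rightarrow>
     ('oa, 'ma, 'ob, 'mb, ('oa \<times> 'ob) list, ('oa, 'ma, 'ob, 'mb) tarr) bil" where
  "tensor_univ A B =
    \<lparr>fob = (\<lambda>(a, b)\<in>Obj A \<times> Obj B. [(a, b)]),
     far = (\<lambda>(f, g)\<in>Arr A \<times> Arr B. tcls A B (TDot f g)),
     bdl = (\<lambda>(a, b, b')\<in>Obj A \<times> Obj B \<times> Obj B. tcls A B (TGen (DeltaL a b b'))),
     bdr = (\<lambda>(a, a', b)\<in>Obj A \<times> Obj A \<times> Obj B. tcls A B (TGen (DeltaR a a' b))),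
     bzl = (\<lambda>a\<in>Obj A. tcls A B (TGen (ZetaL a))),
     bzr = (\<lambda>b\<in>Obj B. tcls A B (TGen (ZetaR b)))\<rparr>"

text \<open>
  \<open>F \<otimes> G : A \<otimes> B \<rightarrow> A' \<otimes> B'\<close> on formal expressions; a formal inverse is sent to the inverse
  of the image of the generator.
\<close>

fun tens_gen ::
    "('oa', 'ma') perm \<Rightarrow> ('ob', 'mb') perm \<Rightarrow> ('oa, 'ma, 'oa', 'ma') smf \<Rightarrow>
     ('ob, 'mb, 'ob', 'mb') smf \<Rightarrow> ('oa, 'ob) gen \<Rightarrow> ('oa', 'ma', 'ob', 'mb') tm" where
  "tens_gen A' B' F G (DeltaL a b b') =
     TDot (Ide A' (fob F a)) (cst2 G (b, b')) \<circ>\<^sub>t TGen (DeltaL (fob F a) (fob G b) (fob G b'))"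
| "tens_gen A' B' F G (DeltaR a a' b) =
     TDot (cst2 F (a, a')) (Ide B' (fob G b)) \<circ>\<^sub>t TGen (DeltaR (fob F a) (fob F a') (fob G b))"
| "tens_gen A' B' F G (Braid p q) =
     TGen (Braid (map_prod (fob F) (fob G) p) (map_prod (fob F) (fob G) q))"
| "tens_gen A' B' F G (ZetaL a) = TDot (Ide A' (fob F a)) (cst0 G) \<circ>\<^sub>t TGen (ZetaL (fob F a))"
| "tens_gen A' B' F G (ZetaR b) = TDot (cst0 F) (Ide B' (fob G b)) \<circ>\<^sub>t TGen (ZetaR (fob G b))"

fun tens_inv ::
    "('oa', 'ma') perm \<Rightarrow> ('ob', 'mb') perm \<Rightarrow> ('oa, 'ma, 'oa', 'ma') smf \<Rightarrow>
     ('ob, 'mb, 'ob', 'mb') smf \<Rightarrow> ('oa, 'ob) gen \<Rightarrow> ('oa', 'ma', 'ob', 'mb') tm" where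
  "tens_inv A' B' F G (DeltaL a b b') =
     TInv (DeltaL (fob F a) (fob G b) (fob G b')) \<circ>\<^sub>t TDot (Ide A' (fob F a)) (inv_arr B' (cst2 G (b, b')))"
| "tens_inv A' B' F G (DeltaR a a' b) =
     TInv (DeltaR (fob F a) (fob F a') (fob G b)) \<circ>\<^sub>t TDot (inv_arr A' (cst2 F (a, a'))) (Ide B' (fob G b))"
| "tens_inv A' B' F G (Braid p q) =
     TInv (Braid (map_prod (fob F) (fob G) p) (map_prod (fob F) (fob G) q))"
| "tens_inv A' B' F G (ZetaL a) =
     TInv (ZetaL (fob F a)) \<circ>\<^sub>t TDot (Ide A' (fob F a)) (inv_arr B' (cst0 G))"
| "tens_inv A' B' F G (ZetaR b) =
     TInv (ZetaR (fob G b)) \<circ>\<^sub>t TDot (inv_arr A' (cst0 F)) (Ide B' (fob G b))"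

primrec tens_tm ::
    "('oa', 'ma') perm \<Rightarrow> ('ob', 'mb') perm \<Rightarrow> ('oa, 'ma, 'oa', 'ma') smf \<Rightarrow>
     ('ob, 'mb, 'ob', 'mb') smf \<Rightarrow> ('oa, 'ma, 'ob, 'mb) tm \<Rightarrow> ('oa', 'ma', 'ob', 'mb') tm" where
  "tens_tm A' B' F G (TId xs) = TId (map (map_prod (fob F) (fob G)) xs)"
| "tens_tm A' B' F G (TDot f g) = TDot (far F f) (far G g)"
| "tens_tm A' B' F G (TGen e) = tens_gen A' B' F G e"
| "tens_tm A' B' F G (TInv e) = tens_inv A' B' F G e"
| "tens_tm A' B' F G (t \<circ>\<^sub>t s) = tens_tm A' B' F G t \<circ>\<^sub>t tens_tm A' B' F G s"
| "tens_tm A' B' F G (t +\<^sub>t s) = tens_tm A' B' F G t +\<^sub>t tens_tm A' B' F G s"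

definition tensor_fct ::
    "('oa, 'ma) perm \<Rightarrow> ('ob, 'mb) perm \<Rightarrow> ('oa', 'ma') perm \<Rightarrow> ('ob', 'mb') perm \<Rightarrow>
     ('oa, 'ma, 'oa', 'ma') smf \<Rightarrow> ('ob, 'mb, 'ob', 'mb') smf \<Rightarrow>
     (('oa \<times> 'ob) list, ('oa, 'ma, 'ob, 'mb) tarr, ('oa' \<times> 'ob') list, ('oa', 'ma', 'ob', 'mb') tarr) smf"
  where
  "tensor_fct A B A' B' F G =
    \<lparr>fob = (\<lambda>xs\<in>Obj (A \<otimes> B). map (map_prod (fob F) (fob G)) xs),
     far = (\<lambda>X\<in>Arr (A \<otimes> B). tcls A' B' (tens_tm A' B' F G (trep X))),
     cst2 = (\<lambda>(xs, ys)\<in>Obj (A \<otimes> B) \<times> Obj (A \<otimes> B).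
               Ide (A' \<otimes> B') (map (map_prod (fob F) (fob G)) (xs @ ys))),
     cst0 = Ide (A' \<otimes> B') []\<rparr>"

primrec tens_sum :: "('oa \<Rightarrow> 'ma') \<Rightarrow> ('ob \<Rightarrow> 'mb') \<Rightarrow> ('oa \<times> 'ob) list \<Rightarrow> ('oa', 'ma', 'ob', 'mb') tm" where
  "tens_sum \<phi> \<psi> [] = TId []"
| "tens_sum \<phi> \<psi> (p # xs) = TDot (\<phi> (fst p)) (\<psi> (snd p)) +\<^sub>t tens_sum \<phi> \<psi> xs"

definition tensor_trans ::
    "('oa, 'ma) perm \<Rightarrow> ('ob, 'mb) perm \<Rightarrow> ('oa', 'ma') perm \<Rightarrow> ('ob', 'mb') perm \<Rightarrow>
     ('oa \<Rightarrow> 'ma') \<Rightarrow> ('ob \<Rightarrow> 'mb') \<Rightarrow> ('oa \<times> 'ob) list \<Rightarrow> ('oa', 'ma', 'ob', 'mb') tarr" where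
  "tensor_trans A B A' B' \<phi> \<psi> = (\<lambda>xs\<in>Obj (A \<otimes> B). tcls A' B' (tens_sum \<phi> \<psi> xs))"


section \<open>The two 2-functors and the comparison\<close>

text \<open>
  Action of \<open>(A, B, C) \<mapsto> PermCat_s (A \<otimes> B) C\<close> and of \<open>(A, B, C) \<mapsto> Bilin A B C\<close>
  on 1-cells \<open>P : A' \<rightarrow> A\<close>, \<open>Q : B' \<rightarrow> B\<close>, \<open>R : C \<rightarrow> C'\<close> (a functor between hom categories)
  and on 2-cells \<open>\<pi> : P \<Rightarrow> P'\<close>, \<open>\<chi> : Q \<Rightarrow> Q'\<close>, \<open>\<rho> : R \<Rightarrow> R'\<close> (a natural transformation, whose
  component at an object is an arrow of the target hom category); \<open>comp_univ A B C\<close> is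
  composition with \<open>u = tensor_univ A B\<close>.
\<close>

definition PermCat_s_map where
  "PermCat_s_map A B C A' B' C' P Q R =
    (let X = PermCat_s (A \<otimes> B) C; PQ = tensor_fct A' B' A B P Q;
         act = (\<lambda>S. smf_comp (A' \<otimes> B') C' R (smf_comp (A' \<otimes> B') C S PQ))
     in \<lparr>fob = (\<lambda>S\<in>Obj X. act S),
         far = (\<lambda>(S, t, S')\<in>Arr X.
                  (act S, (\<lambda>x\<in>Obj (A' \<otimes> B'). far R (t (fob PQ x))), act S'))\<rparr>)"

definition PermCat_s_map2 where
  "PermCat_s_map2 A B C A' B' C' P Q R P' Q' R' \<pi> \<chi> \<rho> =
    (\<lambda>S\<in>Obj (PermCat_s (A \<otimes> B) C).
       (fob (PermCat_s_map A B C A' B' C' P Q R) S,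
        (\<lambda>x\<in>Obj (A' \<otimes> B').
           \<rho> (fob S (fob (tensor_fct A' B' A B P' Q') x)) \<cdot>\<^bsub>C'\<^esub>
           far R (far S (tensor_trans A' B' A B \<pi> \<chi> x))),
        fob (PermCat_s_map A B C A' B' C' P' Q' R') S))"

definition Bilin_map where
  "Bilin_map A B C A' B' C' P Q R =
    (let X = Bilin A B C;
         act = (\<lambda>H. bil_post A' B' C' R (bil_pre A' B' A B C P Q H))
     in \<lparr>fob = (\<lambda>H\<in>Obj X. act H),
         far = (\<lambda>(H, t, H')\<in>Arr X.
                  (act H, (\<lambda>(a, b)\<in>Obj A' \<times> Obj B'. far R (t (fob P a, fob Q b))), act H'))\<rparr>)"

definition Bilin_map2 where
  "Bilin_map2 A B C A' B' C' P Q R P' Q' R' \<pi> \<chi> \<rho> =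
    (\<lambda>H\<in>Obj (Bilin A B C).
       (fob (Bilin_map A B C A' B' C' P Q R) H,
        (\<lambda>(a, b)\<in>Obj A' \<times> Obj B'.
           \<rho> (fob H (fob P' a, fob Q' b)) \<cdot>\<^bsub>C'\<^esub> far R (far H (\<pi> a, \<chi> b))),
        fob (Bilin_map A B C A' B' C' P' Q' R') H))"

definition comp_univ where
  "comp_univ A B C =
    (let X = PermCat_s (A \<otimes> B) C; u = tensor_univ A B; act = (\<lambda>S. bil_post A B C S u)
     in \<lparr>fob = (\<lambda>S\<in>Obj X. act S),
         far = (\<lambda>(S, t, S')\<in>Arr X. (act S, (\<lambda>(a, b)\<in>Obj A \<times> Obj B. t (fob u (a, b))), act S'))\<rparr>)"

end

theory Submission
  imports Defs
begin

text \<open>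
  Given a bilinear map \<open>H\<close>, evaluate formal expressions in \<open>C\<close>: a generator goes to the corresponding
  constraint of \<open>H\<close> (or to a symmetry of \<open>C\<close>) and a formal inverse to the inverse.  Each defining
  relation of \<open>A \<otimes> B\<close> is an axiom of bilinear maps or of permutative categories, so evaluation is well
  defined on arrows; it is a strict symmetric monoidal functor, and it is the only one that restricts
  to \<open>H\<close> along \<open>u\<close>, by induction on expressions.  A bilinear transformation extends additively to sums of
  pairs, and its naturality against all expressions again follows by induction.

  The functor \<open>P \<otimes> Q\<close> is the one induced by the bilinear map \<open>u(P-, Q-)\<close>, and the transformation
  \<open>\<pi> \<otimes> \<chi>\<close> is the additive extension of \<open>u(\<pi>, \<chi>)\<close>.  Hence \<open>P \<otimes> Q\<close> composed with \<open>u\<close> is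
  \<open>u(P-, Q-)\<close>, and naturality of the comparison reduces to associativity of composition.
\<close>

section \<open>Categories of functors and transformations\<close>

text \<open>The isomorphism holds on the nose, so functors, constraints and transformations have to
  be equal, not just isomorphic. Strictness makes this possible: a strict functor on
  \<open>A \<otimes> B\<close> carries no constraint data beyond its values, and lists of pairs form
  a free monoid, so values on singletons and generators settle everything. Arrows, however, are
  classes of terms without normal forms; a statement about an arrow is proved for a representing
  term, by induction or by one rule of \<open>teq\<close>, and \<open>tcls\<close> transports it to
  the class. Invariance under \<open>teq\<close> is checked only once, for evaluation in an
  arbitrary target; the translation of terms behind \<open>P \<otimes> Q\<close> is an instance of
  it with target \<open>A \<otimes> B\<close> and needs no check of its own. Arrows of both hom
  categories are triples (source, family, target), so an equality of two-cells includes an equality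
  of their ends; this is where naturality on one-cells enters naturality on two-cells.\<close>

lemma hom_iff: "f \<in> hom C x y \<longleftrightarrow> f \<in> Arr C \<and> Dom C f = x \<and> Cod C f = y"
  by (auto simp: hom_def)

section \<open>Isomorphisms and commuting squares in a category\<close>

context category
begin

declare dom_obj [simp] cod_obj [simp]

lemma ide_simps [simp]:
  "x \<in> Obj C \<Longrightarrow> Ide C x \<in> Arr C"
  "x \<in> Obj C \<Longrightarrow> Dom C (Ide C x) = x"
  "x \<in> Obj C \<Longrightarrow> Cod C (Ide C x) = x"
  using ide_hom by (auto simp: hom_iff)

lemma cmp_simps [simp]:
  assumes "f \<in> Arr C" "g \<in> Arr C" "Cod C f = Dom C g"
  shows "g \<cdot> f \<in> Arr C" "Dom C (g \<cdot> f) = Dom C f" "Cod C (g \<cdot> f) = Cod C g"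
  using cmp_hom [of f "Dom C f" "Cod C f" g "Cod C g"] assms by (auto simp: hom_iff)

lemma cmp_ide_r [simp]: "\<lbrakk>f \<in> Arr C; Dom C f = x\<rbrakk> \<Longrightarrow> f \<cdot> Ide C x = f"
  using cmp_ide_right by (auto simp: hom_iff)

lemma cmp_ide_l [simp]: "\<lbrakk>f \<in> Arr C; Cod C f = x\<rbrakk> \<Longrightarrow> Ide C x \<cdot> f = f"
  using cmp_ide_left by (auto simp: hom_iff)

lemma cmp_assoc_arr [simp]:
  "\<lbrakk>f \<in> Arr C; g \<in> Arr C; h \<in> Arr C; Cod C f = Dom C g; Cod C g = Dom C h\<rbrakk>
    \<Longrightarrow> (h \<cdot> g) \<cdot> f = h \<cdot> (g \<cdot> f)"
  using cmp_assoc by (auto simp: hom_iff)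

text \<open>Simplification nests composites to the right, which hides the side
  \<open>g \<cdot> f\<close> of a commuting square inside \<open>g \<cdot> (f \<cdot> r)\<close>. In
  this form a square can be used as a rewrite rule there; it is the main device for pasting diagrams
  below. That \<open>Dom C f = Dom C h\<close> follows from the equation itself.\<close>

lemma cmp_square_extend:
  assumes "g \<cdot> f = k \<cdot> h" "f \<in> Arr C" "g \<in> Arr C" "h \<in> Arr C" "k \<in> Arr C" "r \<in> Arr C"
    "Cod C f = Dom C g" "Cod C h = Dom C k" "Cod C r = Dom C f"
  shows "g \<cdot> (f \<cdot> r) = k \<cdot> (h \<cdot> r)"
proof -
  have "Dom C (g \<cdot> f) = Dom C (k \<cdot> h)" using assms(1) by simp
  then have "Dom C f = Dom C h"
    using cmp_simps(2) [of f g] cmp_simps(2) [of h k] assms(2-) by simp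
  then show ?thesis
    using assms cmp_assoc_arr [of r f g] cmp_assoc_arr [of r h k] by simp
qed



lemma inverse_arrs_unique:
  assumes "inverse_arrs C f g" "inverse_arrs C f h"
  shows "g = h"
proof -
  have "g \<cdot> (f \<cdot> h) = (g \<cdot> f) \<cdot> h"
    using assms by (subst cmp_assoc_arr) (auto simp: inverse_arrs_def hom_iff)
  then show ?thesis
    using assms by (auto simp: inverse_arrs_def hom_iff)
qed

lemma inv_arr_eqI: "inverse_arrs C f g \<Longrightarrow> inv_arr C f = g"
  unfolding inv_arr_def using inverse_arrs_unique by blast

lemma inverse_arrs_inv_arr: "is_iso C f \<Longrightarrow> inverse_arrs C f (inv_arr C f)"
  unfolding is_iso_def using inv_arr_eqI by auto

lemma iso_simps [simp]:
  assumes "is_iso C f"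
  shows "inv_arr C f \<in> Arr C" "Dom C (inv_arr C f) = Cod C f"
    "Cod C (inv_arr C f) = Dom C f" "inv_arr C f \<cdot> f = Ide C (Dom C f)"
    "f \<cdot> inv_arr C f = Ide C (Cod C f)"
  using inverse_arrs_inv_arr [OF assms] by (simp_all only: inverse_arrs_def hom_iff)

lemma iso_arr: "is_iso C f \<Longrightarrow> f \<in> Arr C"
  by (auto simp: is_iso_def inverse_arrs_def)

lemma inverse_arrs_ide: "x \<in> Obj C \<Longrightarrow> inverse_arrs C (Ide C x) (Ide C x)"
  by (auto simp: inverse_arrs_def hom_iff)

lemma is_iso_ide [simp]: "x \<in> Obj C \<Longrightarrow> is_iso C (Ide C x)"
  unfolding is_iso_def by (rule exI) (rule inverse_arrs_ide)

lemma iso_cancel_right: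
  assumes "is_iso C f" "g \<cdot> f = h \<cdot> f" "g \<in> Arr C" "h \<in> Arr C" "Dom C g = Cod C f" "Dom C h = Cod C f"
  shows "g = h"
proof -
  have "(g \<cdot> f) \<cdot> inv_arr C f = (h \<cdot> f) \<cdot> inv_arr C f"
    using assms(2) by simp
  then show ?thesis
    using assms(1,3-) iso_arr [OF assms(1)] by simp
qed

lemma iso_cancel_left:
  assumes "is_iso C f" "f \<cdot> g = f \<cdot> h" "g \<in> Arr C" "h \<in> Arr C" "Cod C g = Dom C f" "Cod C h = Dom C f"
  shows "g = h"
proof -
  have "(inv_arr C f \<cdot> f) \<cdot> g = (inv_arr C f \<cdot> f) \<cdot> h"
    using assms iso_arr [OF assms(1)] by (subst (1 2) cmp_assoc_arr) auto
  then show ?thesis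
    using assms iso_arr [OF assms(1)] by simp
qed

lemma inverse_arrs_cmp:
  assumes "inverse_arrs C f f'" "inverse_arrs C g g'" "Cod C f = Dom C g"
  shows "inverse_arrs C (g \<cdot> f) (f' \<cdot> g')"
proof -
  note assms [unfolded inverse_arrs_def hom_iff, simp]
  have "f' \<cdot> (g' \<cdot> (g \<cdot> f)) = f' \<cdot> ((g' \<cdot> g) \<cdot> f)"
    by (subst cmp_assoc_arr) simp_all
  moreover have "g \<cdot> (f \<cdot> (f' \<cdot> g')) = g \<cdot> ((f \<cdot> f') \<cdot> g')"
    by (subst cmp_assoc_arr) simp_all
  ultimately show ?thesis
    by (simp add: inverse_arrs_def hom_iff)
qed

lemma is_iso_cmp: "\<lbrakk>is_iso C f; is_iso C g; Cod C f = Dom C g\<rbrakk> \<Longrightarrow> is_iso C (g \<cdot> f)"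
  unfolding is_iso_def using inverse_arrs_cmp by blast

text \<open>Carries the naturality square of a generator over to its formal inverse: the arrows
  \<open>f\<close> and \<open>g\<close> are turned around.\<close>

lemma inv_arr_square:
  assumes "is_iso C f" "is_iso C g" "s \<in> Arr C" "t \<in> Arr C" "Cod C f = Dom C s" "Cod C t = Dom C g"
    "s \<cdot> f = g \<cdot> t"
  shows "t \<cdot> inv_arr C f = inv_arr C g \<cdot> s"
proof -
  note [simp] = assms(1-6) iso_arr [OF assms(1)] iso_arr [OF assms(2)]
  \<comment> \<open>The ends of \<open>s\<close> and \<open>t\<close> that the hypotheses leave open
    are read off the equation.\<close>
  have "Dom C (s \<cdot> f) = Dom C (g \<cdot> t)" "Cod C (s \<cdot> f) = Cod C (g \<cdot> t)"
    using assms(7) by simp_all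
  then have [simp]: "Dom C t = Dom C f" "Cod C s = Cod C g" by simp_all
  show ?thesis
  proof (rule iso_cancel_left [OF assms(2)])
    have "(g \<cdot> t) \<cdot> inv_arr C f = (s \<cdot> f) \<cdot> inv_arr C f"
      using assms(7) by simp
    then have "g \<cdot> (t \<cdot> inv_arr C f) = s"
      by simp
    moreover have "(g \<cdot> inv_arr C g) \<cdot> s = g \<cdot> (inv_arr C g \<cdot> s)"
      by (rule cmp_assoc_arr) simp_all
    ultimately show "g \<cdot> (t \<cdot> inv_arr C f) = g \<cdot> (inv_arr C g \<cdot> s)"
      by simp
  qed simp_all
qed

end

context cat_functor
begin

lemma fob_obj [simp]: "x \<in> Obj A \<Longrightarrow> fob F x \<in> Obj C"
  using fob_type by auto

lemma fob_undefined: "x \<notin> Obj A \<Longrightarrow> fob F x = undefined"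
  using fob_type by (auto simp: PiE_iff extensional_def)

lemma far_simps [simp]:
  assumes "f \<in> Arr A"
  shows "far F f \<in> Arr C" "Dom C (far F f) = fob F (Dom A f)" "Cod C (far F f) = fob F (Cod A f)"
  using far_hom [of f "Dom A f" "Cod A f"] assms by (auto simp: hom_iff)

declare far_ide [simp]

lemma far_cmp_arr [simp]:
  "\<lbrakk>f \<in> Arr A; g \<in> Arr A; Cod A f = Dom A g\<rbrakk> \<Longrightarrow> far F (g \<cdot>\<^bsub>A\<^esub> f) = far F g \<cdot>\<^bsub>C\<^esub> far F f"
  using far_cmp by (auto simp: hom_iff)

lemma far_inverse_arrs:
  assumes "inverse_arrs A f g" shows "inverse_arrs C (far F f) (far F g)"
proof -
  note assms [unfolded inverse_arrs_def hom_iff, simp]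
  have "far F g \<cdot>\<^bsub>C\<^esub> far F f = Ide C (fob F (Dom A f))" "far F f \<cdot>\<^bsub>C\<^esub> far F g = Ide C (fob F (Cod A f))"
    using far_cmp_arr [of f g] far_cmp_arr [of g f] by simp_all
  then show ?thesis
    by (simp add: inverse_arrs_def hom_iff)
qed

lemma far_iso: "is_iso A f \<Longrightarrow> is_iso C (far F f)"
  unfolding is_iso_def using far_inverse_arrs by blast

lemma far_inv_arr: "is_iso A f \<Longrightarrow> far F (inv_arr A f) = inv_arr C (far F f)"
  using far_inverse_arrs dom.inverse_arrs_inv_arr cod.inv_arr_eqI by metis

end



section \<open>Product categories and natural transformations\<close>

lemma prod_cat_simps [simp]:
  "Obj (prod_cat A B) = Obj A \<times> Obj B"
  "Arr (prod_cat A B) = Arr A \<times> Arr B"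
  "Dom (prod_cat A B) (f, g) = (Dom A f, Dom B g)"
  "Cod (prod_cat A B) (f, g) = (Cod A f, Cod B g)"
  "Ide (prod_cat A B) (a, b) = (Ide A a, Ide B b)"
  "(f', g') \<cdot>\<^bsub>prod_cat A B\<^esub> (f, g) = (f' \<cdot>\<^bsub>A\<^esub> f, g' \<cdot>\<^bsub>B\<^esub> g)"
  by (auto simp: prod_cat_def)

lemma category_prod_cat:
  assumes "category A" "category B"
  shows "category (prod_cat A B)"
proof -
  interpret A: category A by fact
  interpret B: category B by fact
  show ?thesis
    by unfold_locales (auto simp: hom_iff)
qed

lemma nat_transI:
  assumes "cat_functor A C F" "cat_functor A C G" "t \<in> extensional (Obj A)"
    and "\<And>x. x \<in> Obj A \<Longrightarrow> t x \<in> hom C (fob F x) (fob G x)"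
    and "\<And>f. f \<in> Arr A \<Longrightarrow> far G f \<cdot>\<^bsub>C\<^esub> t (Dom A f) = t (Cod A f) \<cdot>\<^bsub>C\<^esub> far F f"
  shows "nat_trans A C F G t"
  using assms by (auto simp: nat_trans_def PiE_iff hom_iff)

lemma nat_transD:
  assumes "nat_trans A C F G t"
  shows "cat_functor A C F" "cat_functor A C G" "t \<in> extensional (Obj A)"
    and "x \<in> Obj A \<Longrightarrow> t x \<in> Arr C" "x \<in> Obj A \<Longrightarrow> Dom C (t x) = fob F x"
    and "x \<in> Obj A \<Longrightarrow> Cod C (t x) = fob G x"
    and "f \<in> Arr A \<Longrightarrow> far G f \<cdot>\<^bsub>C\<^esub> t (Dom A f) = t (Cod A f) \<cdot>\<^bsub>C\<^esub> far F f"
proof -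
  interpret F: cat_functor A C F using assms by (simp add: nat_trans_def)
  show "cat_functor A C F" "cat_functor A C G" "t \<in> extensional (Obj A)"
    and "x \<in> Obj A \<Longrightarrow> t x \<in> Arr C" "x \<in> Obj A \<Longrightarrow> Dom C (t x) = fob F x"
    and "x \<in> Obj A \<Longrightarrow> Cod C (t x) = fob G x"
    and "f \<in> Arr A \<Longrightarrow> far G f \<cdot>\<^bsub>C\<^esub> t (Dom A f) = t (Cod A f) \<cdot>\<^bsub>C\<^esub> far F f"
    using assms by (auto simp: nat_trans_def PiE_iff hom_iff)
qed



lemma nat_trans_vcomp:
  assumes "nat_trans A C F G t" "nat_trans A C G H s"
  shows "nat_trans A C F H (\<lambda>x\<in>Obj A. s x \<cdot>\<^bsub>C\<^esub> t x)"
proof -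
  interpret F: cat_functor A C F using assms by (simp add: nat_trans_def)
  interpret G: cat_functor A C G using assms by (simp add: nat_trans_def)
  interpret H: cat_functor A C H using assms by (simp add: nat_trans_def)
  note [simp] = nat_transD(4-6) [OF assms(1)] nat_transD(4-6) [OF assms(2)]
  show ?thesis
  proof (rule nat_transI)
    fix f assume f [simp]: "f \<in> Arr A"
    have "far H f \<cdot>\<^bsub>C\<^esub> (s (Dom A f) \<cdot>\<^bsub>C\<^esub> t (Dom A f)) = s (Cod A f) \<cdot>\<^bsub>C\<^esub> (far G f \<cdot>\<^bsub>C\<^esub> t (Dom A f))"
      by (rule F.cod.cmp_square_extend) (auto simp: nat_transD(7) [OF assms(2)])
    also have "\<dots> = s (Cod A f) \<cdot>\<^bsub>C\<^esub> (t (Cod A f) \<cdot>\<^bsub>C\<^esub> far F f)"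
      by (simp add: nat_transD(7) [OF assms(1)])
    finally show "far H f \<cdot>\<^bsub>C\<^esub> (\<lambda>x\<in>Obj A. s x \<cdot>\<^bsub>C\<^esub> t x) (Dom A f) =
        (\<lambda>x\<in>Obj A. s x \<cdot>\<^bsub>C\<^esub> t x) (Cod A f) \<cdot>\<^bsub>C\<^esub> far F f"
      by simp
  qed (auto simp: hom_iff F.cat_functor_axioms H.cat_functor_axioms)
qed

section \<open>Hom categories, functors between them, and transformations of such functors\<close>

lemma trans_cat_simps [simp]:
  "Obj (trans_cat D C \<F> T) = \<F>"
  "(F, t, G) \<in> Arr (trans_cat D C \<F> T) \<longleftrightarrow> F \<in> \<F> \<and> G \<in> \<F> \<and> T F G t"
  "Dom (trans_cat D C \<F> T) (F, t, G) = F"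
  "Cod (trans_cat D C \<F> T) (F, t, G) = G"
  "Ide (trans_cat D C \<F> T) F = (F, (\<lambda>x\<in>Obj D. Ide C (fob F x)), F)"
  "(G', s, H) \<cdot>\<^bsub>trans_cat D C \<F> T\<^esub> (F, t, G) = (F, (\<lambda>x\<in>Obj D. s x \<cdot>\<^bsub>C\<^esub> t x), H)"
  by (auto simp: trans_cat_def)

lemma arr_trans_cat:
  "f \<in> Arr (trans_cat D C \<F> T) \<longleftrightarrow> (\<exists>F t G. f = (F, t, G) \<and> F \<in> \<F> \<and> G \<in> \<F> \<and> T F G t)"
  by (auto simp: trans_cat_def)

text \<open>The properties shared by strict functors with monoidal transformations and by bilinear
  maps with bilinear transformations. Category laws, functoriality and naturality are derived from
  these alone, so each is proved once for both \<open>PermCat_s\<close> and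
  \<open>Bilin\<close>.\<close>

locale trans_family = dom: category D + cod: category C
  for D :: "('o, 'm, 'x) cat_scheme" and C :: "('p, 'n, 'y) cat_scheme" +
  fixes \<F> :: "('o, 'm, 'p, 'n, 'z) fct_scheme set"
    and T :: "('o, 'm, 'p, 'n, 'z) fct_scheme \<Rightarrow> ('o, 'm, 'p, 'n, 'z) fct_scheme \<Rightarrow> ('o \<Rightarrow> 'n) \<Rightarrow> bool"
  assumes functors: "F \<in> \<F> \<Longrightarrow> cat_functor D C F"
    and nat: "T F G t \<Longrightarrow> nat_trans D C F G t"
    and trans_ide: "F \<in> \<F> \<Longrightarrow> T F F (\<lambda>x\<in>Obj D. Ide C (fob F x))"
    and trans_vcomp: "\<lbrakk>T F G t; T G H s\<rbrakk> \<Longrightarrow> T F H (\<lambda>x\<in>Obj D. s x \<cdot>\<^bsub>C\<^esub> t x)"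
begin

abbreviation "TC \<equiv> trans_cat D C \<F> T"



lemma category_TC: "category TC"
proof
  fix F assume "F \<in> Obj TC" then show "Ide TC F \<in> hom TC F F"
    by (auto simp: hom_iff trans_ide)
next
  fix f F G assume "f \<in> hom TC F G"
  then obtain t where f: "f = (F, t, G)" "F \<in> \<F>" "G \<in> \<F>" "T F G t"
    by (auto simp: hom_iff arr_trans_cat)
  note n = nat_transD [OF nat [OF f(4)]]
  \<comment> \<open>Families are extensional, so composing with the restricted identity family
    returns the same function.\<close>
  show "f \<cdot>\<^bsub>TC\<^esub> Ide TC F = f"
    using n f by (auto simp: fun_eq_iff extensional_def)
  show "Ide TC G \<cdot>\<^bsub>TC\<^esub> f = f"
    using n f by (auto simp: fun_eq_iff extensional_def)
next
  fix f g h F G H K assume *: "f \<in> hom TC F G" "g \<in> hom TC G H" "h \<in> hom TC H K"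
  obtain t where f: "f = (F, t, G)" "T F G t"
    using * by (auto simp: hom_iff arr_trans_cat)
  obtain s where g: "g = (G, s, H)" "T G H s"
    using * by (auto simp: hom_iff arr_trans_cat)
  obtain r where h: "h = (H, r, K)" "T H K r"
    using * by (auto simp: hom_iff arr_trans_cat)
  note n = nat_transD [OF nat [OF f(2)]] nat_transD [OF nat [OF g(2)]] nat_transD [OF nat [OF h(2)]]
  show "(h \<cdot>\<^bsub>TC\<^esub> g) \<cdot>\<^bsub>TC\<^esub> f = h \<cdot>\<^bsub>TC\<^esub> (g \<cdot>\<^bsub>TC\<^esub> f)"
    using n f g h by (auto simp: fun_eq_iff)
qed (auto simp: hom_iff arr_trans_cat trans_vcomp)

end

text \<open>Identities and composites need to be compared only at objects of \<open>D'\<close>: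
  \<open>T'\<close> implies \<open>nat_trans\<close>, hence extensionality, and for extensional
  families pointwise agreement is equality.\<close>

lemma trans_cat_functor:
  assumes "trans_family D C \<F> T" "trans_family D' C' \<F>' T'"
    and act: "\<And>F. F \<in> \<F> \<Longrightarrow> act F \<in> \<F>'"
    and tr: "\<And>F G t. \<lbrakk>F \<in> \<F>; G \<in> \<F>; T F G t\<rbrakk> \<Longrightarrow> T' (act F) (act G) (tr t)"
    and ide: "\<And>F x. \<lbrakk>F \<in> \<F>; x \<in> Obj D'\<rbrakk> \<Longrightarrow> tr (\<lambda>x\<in>Obj D. Ide C (fob F x)) x = Ide C' (fob (act F) x)"
    and cmp: "\<And>F G H t s x. \<lbrakk>F \<in> \<F>; G \<in> \<F>; H \<in> \<F>; T F G t; T G H s; x \<in> Obj D'\<rbrakk>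
      \<Longrightarrow> tr (\<lambda>x\<in>Obj D. s x \<cdot>\<^bsub>C\<^esub> t x) x = tr s x \<cdot>\<^bsub>C'\<^esub> tr t x"
  shows "cat_functor (trans_cat D C \<F> T) (trans_cat D' C' \<F>' T')
    \<lparr>fob = (\<lambda>F\<in>\<F>. act F),
     far = (\<lambda>(F, t, G)\<in>Arr (trans_cat D C \<F> T). (act F, tr t, act G))\<rparr>"
    (is "cat_functor ?X ?Y ?K")
proof -
  interpret X: trans_family D C \<F> T by fact
  interpret Y: trans_family D' C' \<F>' T' by fact
  interpret XC: category ?X by (rule X.category_TC)
  interpret YC: category ?Y by (rule Y.category_TC)
  have eq: "f = g" if "f \<in> extensional S" "g \<in> extensional S" "\<And>x. x \<in> S \<Longrightarrow> f x = g x" for f g S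
    using that by (auto intro: extensionalityI)
  show ?thesis
  proof
    fix F assume F: "F \<in> Obj ?X"
    have "tr (\<lambda>x\<in>Obj D. Ide C (fob F x)) = (\<lambda>x\<in>Obj D'. Ide C' (fob (act F) x))"
      using F act by (intro eq [of _ "Obj D'"] nat_transD(3) [OF Y.nat [OF tr]])
        (auto simp: ide X.trans_ide)
    then show "far ?K (Ide ?X F) = Ide ?Y (fob ?K F)"
      using F by (auto simp: X.trans_ide)
  next
    fix f g F G H assume *: "f \<in> hom ?X F G" "g \<in> hom ?X G H"
    obtain t where f: "f = (F, t, G)" "T F G t" and m: "F \<in> \<F>" "G \<in> \<F>"
      using * by (auto simp: hom_iff arr_trans_cat)
    obtain s where g: "g = (G, s, H)" "T G H s" and m': "H \<in> \<F>"
      using * by (auto simp: hom_iff arr_trans_cat)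
    have "tr (\<lambda>x\<in>Obj D. s x \<cdot>\<^bsub>C\<^esub> t x) = (\<lambda>x\<in>Obj D'. tr s x \<cdot>\<^bsub>C'\<^esub> tr t x)"
      using f g m m' by (intro eq [of _ "Obj D'"] nat_transD(3) [OF Y.nat [OF tr [of F H]]])
        (auto simp: cmp intro: X.trans_vcomp)
    then show "far ?K (g \<cdot>\<^bsub>?X\<^esub> f) = far ?K g \<cdot>\<^bsub>?Y\<^esub> far ?K f"
      using f g m m' by (auto simp: X.trans_vcomp)
  qed (auto simp: hom_iff arr_trans_cat act tr)
qed

text \<open>Since an arrow of a hom category records its ends, a component is the triple
  \<open>(fob K F, c F, fob L F)\<close>, and the ends of the two composites in the naturality
  square match automatically; what remains is a pointwise equation in \<open>C'\<close>.\<close>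

lemma trans_cat_nat_trans:
  assumes "trans_family D C \<F> T" "trans_family D' C' \<F>' T'"
    and K: "cat_functor (trans_cat D C \<F> T) (trans_cat D' C' \<F>' T') K"
    and L: "cat_functor (trans_cat D C \<F> T) (trans_cat D' C' \<F>' T') L"
    and far_K: "\<And>F t G. \<lbrakk>F \<in> \<F>; G \<in> \<F>; T F G t\<rbrakk> \<Longrightarrow> far K (F, t, G) = (fob K F, tr t, fob K G)"
    and far_L: "\<And>F t G. \<lbrakk>F \<in> \<F>; G \<in> \<F>; T F G t\<rbrakk> \<Longrightarrow> far L (F, t, G) = (fob L F, tr' t, fob L G)"
    and c: "\<And>F. F \<in> \<F> \<Longrightarrow> T' (fob K F) (fob L F) (c F)"
    and nat: "\<And>F G t x. \<lbrakk>F \<in> \<F>; G \<in> \<F>; T F G t; x \<in> Obj D'\<rbrakk>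
      \<Longrightarrow> tr' t x \<cdot>\<^bsub>C'\<^esub> c F x = c G x \<cdot>\<^bsub>C'\<^esub> tr t x"
  shows "nat_trans (trans_cat D C \<F> T) (trans_cat D' C' \<F>' T') K L (\<lambda>F\<in>\<F>. (fob K F, c F, fob L F))"
proof -
  interpret X: trans_family D C \<F> T by fact
  interpret Y: trans_family D' C' \<F>' T' by fact
  interpret K: cat_functor "trans_cat D C \<F> T" "trans_cat D' C' \<F>' T'" K by fact
  interpret L: cat_functor "trans_cat D C \<F> T" "trans_cat D' C' \<F>' T'" L by fact
  have m: "fob K F \<in> \<F>'" "fob L F \<in> \<F>'" if "F \<in> \<F>" for F
    using K.fob_obj [of F] L.fob_obj [of F] that by simp_all
  show ?thesis
  proof (rule nat_transI [OF K L])
    fix f assume f: "f \<in> Arr X.TC"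
    then obtain F t G where "f = (F, t, G)" "F \<in> \<F>" "G \<in> \<F>" "T F G t"
      by (auto simp: arr_trans_cat)
    then show "far L f \<cdot>\<^bsub>Y.TC\<^esub> (\<lambda>F\<in>\<F>. (fob K F, c F, fob L F)) (Dom X.TC f) =
        (\<lambda>F\<in>\<F>. (fob K F, c F, fob L F)) (Cod X.TC f) \<cdot>\<^bsub>Y.TC\<^esub> far K f"
      by (auto simp: far_K far_L nat)
  qed (auto simp: hom_iff c m)
qed

section \<open>Symmetric monoidal functors\<close>

context permutative
begin

declare zero_obj [simp] plus_obj [simp] plus_ide [simp] plus_assoc [simp] plus_assoc_arr [simp]
  zero_left [simp] zero_right [simp] zero_left_arr [simp] zero_right_arr [simp]

lemma plusA_simps [simp]:
  assumes "f \<in> Arr C" "g \<in> Arr C"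
  shows "f \<boxplus> g \<in> Arr C" "Dom C (f \<boxplus> g) = Dom C f \<oplus> Dom C g" "Cod C (f \<boxplus> g) = Cod C f \<oplus> Cod C g"
  using plus_hom [of f "Dom C f" "Cod C f" g "Dom C g" "Cod C g"] assms by (auto simp: hom_iff)

lemma plus_cmp_arr:
  "\<lbrakk>f \<in> Arr C; f' \<in> Arr C; g \<in> Arr C; g' \<in> Arr C; Cod C f = Dom C f'; Cod C g = Dom C g'\<rbrakk>
    \<Longrightarrow> (f' \<cdot> f) \<boxplus> (g' \<cdot> g) = (f' \<boxplus> g') \<cdot> (f \<boxplus> g)"
  by (rule plus_cmp) (auto simp: hom_iff)

lemma plus_cmp_ide_right:
  "\<lbrakk>f \<in> Arr C; f' \<in> Arr C; Cod C f = Dom C f'; x \<in> Obj C\<rbrakk>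
    \<Longrightarrow> (f' \<cdot> f) \<boxplus> Ide C x = (f' \<boxplus> Ide C x) \<cdot> (f \<boxplus> Ide C x)"
  using plus_cmp_arr [of f f' "Ide C x" "Ide C x"] by simp

lemma plus_cmp_ide_left:
  "\<lbrakk>f \<in> Arr C; f' \<in> Arr C; Cod C f = Dom C f'; x \<in> Obj C\<rbrakk>
    \<Longrightarrow> Ide C x \<boxplus> (f' \<cdot> f) = (Ide C x \<boxplus> f') \<cdot> (Ide C x \<boxplus> f)"
  using plus_cmp_arr [of "Ide C x" "Ide C x" f f'] by simp

lemma plus_merge:
  "\<lbrakk>f \<in> Arr C; f' \<in> Arr C; g \<in> Arr C; g' \<in> Arr C; Cod C f = Dom C f'; Cod C g = Dom C g'\<rbrakk>
    \<Longrightarrow> (f' \<boxplus> g') \<cdot> (f \<boxplus> g) = (f' \<cdot> f) \<boxplus> (g' \<cdot> g)"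
  by (simp add: plus_cmp_arr)



lemma beta_simps [simp]:
  assumes "x \<in> Obj C" "y \<in> Obj C"
  shows "Beta C x y \<in> Arr C" "Dom C (Beta C x y) = x \<oplus> y" "Cod C (Beta C x y) = y \<oplus> x"
  using beta_hom [OF assms] by (auto simp: hom_iff)

lemma beta_nat:
  "\<lbrakk>f \<in> Arr C; g \<in> Arr C\<rbrakk>
    \<Longrightarrow> Beta C (Cod C f) (Cod C g) \<cdot> (f \<boxplus> g) = (g \<boxplus> f) \<cdot> Beta C (Dom C f) (Dom C g)"
  by (rule beta_natural) (auto simp: hom_iff)

lemma inverse_arrs_beta:
  "\<lbrakk>x \<in> Obj C; y \<in> Obj C\<rbrakk> \<Longrightarrow> inverse_arrs C (Beta C x y) (Beta C y x)"
  by (simp add: inverse_arrs_def hom_iff beta_inv)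

lemma is_iso_beta: "\<lbrakk>x \<in> Obj C; y \<in> Obj C\<rbrakk> \<Longrightarrow> is_iso C (Beta C x y)"
  unfolding is_iso_def by (rule exI) (rule inverse_arrs_beta)

text \<open>With \<open>y = z = 0\<close> the hexagon makes this symmetry idempotent, and an
  invertible idempotent is an identity.\<close>

lemma beta_zero_right [simp]:
  assumes x: "x \<in> Obj C" shows "Beta C x (Zero C) = Ide C x"
proof -
  have "Beta C x (Zero C) \<cdot> Beta C x (Zero C) = Beta C x (Zero C)"
    using beta_plus [of x "Zero C" "Zero C"] x by simp
  then have "Beta C x (Zero C) \<cdot> Beta C x (Zero C) = Ide C x \<cdot> Beta C x (Zero C)"
    using x by simp
  then show ?thesis
    using x iso_cancel_right [OF is_iso_beta, of x "Zero C" "Beta C x (Zero C)" "Ide C x"] by simp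
qed

lemma beta_zero_left [simp]:
  assumes x: "x \<in> Obj C" shows "Beta C (Zero C) x = Ide C x"
  using beta_inv [of x "Zero C"] x by simp

lemma inverse_arrs_plus:
  assumes "inverse_arrs C f f'" "inverse_arrs C g g'"
  shows "inverse_arrs C (f \<boxplus> g) (f' \<boxplus> g')"
  using assms by (auto simp: inverse_arrs_def hom_iff plus_merge)



text \<open>The second hexagon is not an axiom. Both sides are inverse to
  \<open>Beta C z (x \<oplus> y)\<close>: the left one by \<open>beta_inv\<close>, the right one
  because it inverts the factors of \<open>beta_plus\<close> in reverse order.\<close>

lemma beta_plus_left:
  assumes "x \<in> Obj C" "y \<in> Obj C" "z \<in> Obj C"
  shows "Beta C (x \<oplus> y) z = (Beta C x z \<boxplus> Ide C y) \<cdot> (Ide C x \<boxplus> Beta C y z)"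
proof (rule inverse_arrs_unique)
  show "inverse_arrs C (Beta C z (x \<oplus> y)) (Beta C (x \<oplus> y) z)"
    using assms by (simp add: inverse_arrs_beta)
  show "inverse_arrs C (Beta C z (x \<oplus> y)) ((Beta C x z \<boxplus> Ide C y) \<cdot> (Ide C x \<boxplus> Beta C y z))"
    unfolding beta_plus [OF assms(3,1,2)] using assms
    by (intro inverse_arrs_cmp inverse_arrs_plus inverse_arrs_beta inverse_arrs_ide) simp_all
qed

end

section \<open>Symmetric monoidal functors, strict ones, and their composition\<close>

lemma smf_eqI:
  fixes F G :: "('o, 'm, 'p, 'n) smf"
  assumes "fob F = fob G" "far F = far G" "cst2 F = cst2 G" "cst0 F = cst0 G"
  shows "F = G"
  using assms by (intro smf.equality) auto

context sm_functor
begin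

lemma cst2_simps [simp]:
  assumes "x \<in> Obj A" "y \<in> Obj A"
  shows "cst2 F (x, y) \<in> Arr C" "Dom C (cst2 F (x, y)) = fob F x \<oplus>\<^bsub>C\<^esub> fob F y"
    "Cod C (cst2 F (x, y)) = fob F (x \<oplus>\<^bsub>A\<^esub> y)" "is_iso C (cst2 F (x, y))"
  using cst2_hom [OF assms] cst2_iso [OF assms] by (auto simp: hom_iff)

lemma cst0_simps [simp]:
  "cst0 F \<in> Arr C" "Dom C (cst0 F) = Zero C" "Cod C (cst0 F) = fob F (Zero A)" "is_iso C (cst0 F)"
  using cst0_hom cst0_iso by (auto simp: hom_iff)

lemma cst2_nat:
  "\<lbrakk>f \<in> Arr A; g \<in> Arr A\<rbrakk> \<Longrightarrow> far F (f \<boxplus>\<^bsub>A\<^esub> g) \<cdot>\<^bsub>C\<^esub> cst2 F (Dom A f, Dom A g) =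
    cst2 F (Cod A f, Cod A g) \<cdot>\<^bsub>C\<^esub> (far F f \<boxplus>\<^bsub>C\<^esub> far F g)"
  by (rule cst2_natural) (auto simp: hom_iff)

end

context strict_sm_functor
begin

text \<open>Strictness is given as the equation of \<open>cst2 F (x, y)\<close> with an identity;
  comparing the domains of these two arrows yields the equation on objects.\<close>

lemma fob_plus [simp]:
  assumes "x \<in> Obj A" "y \<in> Obj A" shows "fob F (x \<oplus>\<^bsub>A\<^esub> y) = fob F x \<oplus>\<^bsub>C\<^esub> fob F y"
proof -
  have "Dom C (cst2 F (x, y)) = Dom C (Ide C (fob F (x \<oplus>\<^bsub>A\<^esub> y)))"
    using assms cst2_strict by simp
  then show ?thesis using assms by simp
qed

lemma fob_zero [simp]: "fob F (Zero A) = Zero C"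
proof -
  have "Cod C (cst0 F) = Cod C (Ide C (Zero C))"
    using cst0_strict by simp
  then show ?thesis by simp
qed

declare cst2_strict [simp] cst0_strict [simp]

lemma far_plus [simp]:
  assumes "f \<in> Arr A" "g \<in> Arr A" shows "far F (f \<boxplus>\<^bsub>A\<^esub> g) = far F f \<boxplus>\<^bsub>C\<^esub> far F g"
  using cst2_nat [OF assms] assms by simp

lemma far_beta [simp]:
  assumes "x \<in> Obj A" "y \<in> Obj A" shows "far F (Beta A x y) = Beta C (fob F x) (fob F y)"
  using cst_symm [OF assms] assms by simp

end

text \<open>With identities as constraints the coherence axioms become trivial, and only
  preservation of zero, sums and the symmetry is left to check.\<close>

lemma strict_sm_functorI:
  fixes F :: "('o, 'm, 'p, 'n) smf"
  assumes "permutative A" "permutative C" "cat_functor A C F"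
    and "cst2 F \<in> extensional (Obj A \<times> Obj A)"
    and plus: "\<And>x y. \<lbrakk>x \<in> Obj A; y \<in> Obj A\<rbrakk> \<Longrightarrow> fob F (x \<oplus>\<^bsub>A\<^esub> y) = fob F x \<oplus>\<^bsub>C\<^esub> fob F y"
    and zero: "fob F (Zero A) = Zero C"
    and cst2: "\<And>x y. \<lbrakk>x \<in> Obj A; y \<in> Obj A\<rbrakk> \<Longrightarrow> cst2 F (x, y) = Ide C (fob F (x \<oplus>\<^bsub>A\<^esub> y))"
    and cst0: "cst0 F = Ide C (Zero C)"
    and far_plus: "\<And>f g. \<lbrakk>f \<in> Arr A; g \<in> Arr A\<rbrakk> \<Longrightarrow> far F (f \<boxplus>\<^bsub>A\<^esub> g) = far F f \<boxplus>\<^bsub>C\<^esub> far F g"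
    and far_beta: "\<And>x y. \<lbrakk>x \<in> Obj A; y \<in> Obj A\<rbrakk> \<Longrightarrow> far F (Beta A x y) = Beta C (fob F x) (fob F y)"
  shows "strict_sm_functor A C F"
proof -
  interpret A: permutative A by fact
  interpret C: permutative C by fact
  interpret cat_functor A C F by fact
  note [simp] = plus zero cst2 cst0 far_plus far_beta
  show ?thesis
    by unfold_locales (use assms(4) in \<open>auto simp: hom_iff\<close>)
qed

lemma smf_comp_simps [simp]:
  "x \<in> Obj A \<Longrightarrow> fob (smf_comp A C G F) x = fob G (fob F x)"
  "f \<in> Arr A \<Longrightarrow> far (smf_comp A C G F) f = far G (far F f)"
  "\<lbrakk>x \<in> Obj A; y \<in> Obj A\<rbrakk> \<Longrightarrow> cst2 (smf_comp A C G F) (x, y) =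
    far G (cst2 F (x, y)) \<cdot>\<^bsub>C\<^esub> cst2 G (fob F x, fob F y)"
  "cst0 (smf_comp A C G F) = far G (cst0 F) \<cdot>\<^bsub>C\<^esub> cst0 G"
  by (auto simp: smf_comp_def)

lemma sm_functor_comp:
  assumes "sm_functor A B F" "sm_functor B C G"
  shows "sm_functor A C (smf_comp A C G F)"
proof -
  interpret F: sm_functor A B F by fact
  interpret G: sm_functor B C G by fact
  interpret GF: cat_functor A C "smf_comp A C G F"
    by unfold_locales (auto simp: hom_iff smf_comp_def)
  note sq = G.cod.cmp_square_extend
  show ?thesis
  proof
    show "cst2 (smf_comp A C G F) \<in> extensional (Obj A \<times> Obj A)"
      by (auto simp: smf_comp_def)
  next
    fix x y assume [simp]: "x \<in> Obj A" "y \<in> Obj A"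
    show "cst2 (smf_comp A C G F) (x, y) \<in> hom C
        (fob (smf_comp A C G F) x \<oplus>\<^bsub>C\<^esub> fob (smf_comp A C G F) y) (fob (smf_comp A C G F) (x \<oplus>\<^bsub>A\<^esub> y))"
      by (simp add: hom_iff)
    show "is_iso C (cst2 (smf_comp A C G F) (x, y))"
      by (simp add: G.cod.is_iso_cmp G.far_iso)
    have e1: "far G (far F (Beta A x y)) \<cdot>\<^bsub>C\<^esub> far G (cst2 F (x, y)) =
        far G (cst2 F (y, x)) \<cdot>\<^bsub>C\<^esub> far G (Beta B (fob F x) (fob F y))"
      using arg_cong [OF F.cst_symm, of x y "far G"] by simp
    have e2: "far G (Beta B (fob F x) (fob F y)) \<cdot>\<^bsub>C\<^esub> cst2 G (fob F x, fob F y) =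
        cst2 G (fob F y, fob F x) \<cdot>\<^bsub>C\<^esub> Beta C (fob G (fob F x)) (fob G (fob F y))"
      by (rule G.cst_symm) simp_all
    show "far (smf_comp A C G F) (Beta A x y) \<cdot>\<^bsub>C\<^esub> cst2 (smf_comp A C G F) (x, y) =
        cst2 (smf_comp A C G F) (y, x) \<cdot>\<^bsub>C\<^esub> Beta C (fob (smf_comp A C G F) x) (fob (smf_comp A C G F) y)"
      by (simp add: e2 sq [OF e1])
  next
    fix f x x' g y y' assume "f \<in> hom A x x'" "g \<in> hom A y y'"
    then have [simp]: "f \<in> Arr A" "g \<in> Arr A" and eq: "x = Dom A f" "y = Dom A g" "x' = Cod A f" "y' = Cod A g"
      by (auto simp: hom_iff)
    have e1: "far G (far F (f \<boxplus>\<^bsub>A\<^esub> g)) \<cdot>\<^bsub>C\<^esub> far G (cst2 F (x, y)) =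
        far G (cst2 F (x', y')) \<cdot>\<^bsub>C\<^esub> far G (far F f \<boxplus>\<^bsub>B\<^esub> far F g)"
      using arg_cong [OF F.cst2_nat, of f g "far G"] by (simp add: eq)
    have e2: "far G (far F f \<boxplus>\<^bsub>B\<^esub> far F g) \<cdot>\<^bsub>C\<^esub> cst2 G (fob F x, fob F y) =
        cst2 G (fob F x', fob F y') \<cdot>\<^bsub>C\<^esub> (far G (far F f) \<boxplus>\<^bsub>C\<^esub> far G (far F g))"
      using G.cst2_nat [of "far F f" "far F g"] by (simp add: eq)
    show "far (smf_comp A C G F) (f \<boxplus>\<^bsub>A\<^esub> g) \<cdot>\<^bsub>C\<^esub> cst2 (smf_comp A C G F) (x, y) =
        cst2 (smf_comp A C G F) (x', y') \<cdot>\<^bsub>C\<^esub> (far (smf_comp A C G F) f \<boxplus>\<^bsub>C\<^esub> far (smf_comp A C G F) g)"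
      using e2 sq [OF e1] by (simp add: eq)
  next
    show "cst0 (smf_comp A C G F) \<in> hom C (Zero C) (fob (smf_comp A C G F) (Zero A))"
      by (simp add: hom_iff)
    show "is_iso C (cst0 (smf_comp A C G F))"
      by (simp add: G.cod.is_iso_cmp G.far_iso)
  next
    fix x y z assume [simp]: "x \<in> Obj A" "y \<in> Obj A" "z \<in> Obj A"
    \<comment> \<open>e1 and e4 slide a constraint of \<open>F\<close> through one of
      \<open>G\<close> by naturality; e2 is associativity for \<open>F\<close> mapped through
      \<open>G\<close>, and e3 is associativity for \<open>G\<close>. Pasted together they give the
      law for the composite.\<close>
    have e1: "cst2 G (fob F (x \<oplus>\<^bsub>A\<^esub> y), fob F z) \<cdot>\<^bsub>C\<^esub> (far G (cst2 F (x, y)) \<boxplus>\<^bsub>C\<^esub> Ide C (fob G (fob F z))) =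
        far G (cst2 F (x, y) \<boxplus>\<^bsub>B\<^esub> Ide B (fob F z)) \<cdot>\<^bsub>C\<^esub> cst2 G (fob F x \<oplus>\<^bsub>B\<^esub> fob F y, fob F z)"
      using G.cst2_nat [of "cst2 F (x, y)" "Ide B (fob F z)"] by simp
    have e2: "far G (cst2 F (x \<oplus>\<^bsub>A\<^esub> y, z)) \<cdot>\<^bsub>C\<^esub> far G (cst2 F (x, y) \<boxplus>\<^bsub>B\<^esub> Ide B (fob F z)) =
        far G (cst2 F (x, y \<oplus>\<^bsub>A\<^esub> z)) \<cdot>\<^bsub>C\<^esub> far G (Ide B (fob F x) \<boxplus>\<^bsub>B\<^esub> cst2 F (y, z))"
      using arg_cong [OF F.cst_assoc, of x y z "far G"] by simp
    have e3: "cst2 G (fob F x \<oplus>\<^bsub>B\<^esub> fob F y, fob F z) \<cdot>\<^bsub>C\<^esub> (cst2 G (fob F x, fob F y) \<boxplus>\<^bsub>C\<^esub> Ide C (fob G (fob F z))) =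
        cst2 G (fob F x, fob F y \<oplus>\<^bsub>B\<^esub> fob F z) \<cdot>\<^bsub>C\<^esub> (Ide C (fob G (fob F x)) \<boxplus>\<^bsub>C\<^esub> cst2 G (fob F y, fob F z))"
      using G.cst_assoc [of "fob F x" "fob F y" "fob F z"] by simp
    have e4: "far G (Ide B (fob F x) \<boxplus>\<^bsub>B\<^esub> cst2 F (y, z)) \<cdot>\<^bsub>C\<^esub> cst2 G (fob F x, fob F y \<oplus>\<^bsub>B\<^esub> fob F z) =
        cst2 G (fob F x, fob F (y \<oplus>\<^bsub>A\<^esub> z)) \<cdot>\<^bsub>C\<^esub> (Ide C (fob G (fob F x)) \<boxplus>\<^bsub>C\<^esub> far G (cst2 F (y, z)))"
      using G.cst2_nat [of "Ide B (fob F x)" "cst2 F (y, z)"] by simp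
    show "cst2 (smf_comp A C G F) (x \<oplus>\<^bsub>A\<^esub> y, z) \<cdot>\<^bsub>C\<^esub>
          (cst2 (smf_comp A C G F) (x, y) \<boxplus>\<^bsub>C\<^esub> Ide C (fob (smf_comp A C G F) z)) =
        cst2 (smf_comp A C G F) (x, y \<oplus>\<^bsub>A\<^esub> z) \<cdot>\<^bsub>C\<^esub>
          (Ide C (fob (smf_comp A C G F) x) \<boxplus>\<^bsub>C\<^esub> cst2 (smf_comp A C G F) (y, z))"
      by (simp add: G.cod.plus_cmp_ide_right G.cod.plus_cmp_ide_left sq [OF e1] sq [OF e2] e3 sq [OF e4])
  next
    fix x assume [simp]: "x \<in> Obj A"
    have e1: "cst2 G (fob F x, fob F (Zero A)) \<cdot>\<^bsub>C\<^esub> (Ide C (fob G (fob F x)) \<boxplus>\<^bsub>C\<^esub> far G (cst0 F)) =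
        far G (Ide B (fob F x) \<boxplus>\<^bsub>B\<^esub> cst0 F) \<cdot>\<^bsub>C\<^esub> cst2 G (fob F x, Zero B)"
      using G.cst2_nat [of "Ide B (fob F x)" "cst0 F"] by simp
    have "far G (cst2 F (x, Zero A) \<cdot>\<^bsub>B\<^esub> (Ide B (fob F x) \<boxplus>\<^bsub>B\<^esub> cst0 F)) = far G (Ide B (fob F x))"
      by (simp only: F.cst_unit_right \<open>x \<in> Obj A\<close>)
    \<comment> \<open>The unit law of \<open>F\<close> is written with a composite of two identities
      on the right, so that it has the shape of a square.\<close>
    then have e2: "far G (cst2 F (x, Zero A)) \<cdot>\<^bsub>C\<^esub> far G (Ide B (fob F x) \<boxplus>\<^bsub>B\<^esub> cst0 F) =
        Ide C (fob G (fob F x)) \<cdot>\<^bsub>C\<^esub> Ide C (fob G (fob F x))"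
      by simp
    show "cst2 (smf_comp A C G F) (x, Zero A) \<cdot>\<^bsub>C\<^esub>
        (Ide C (fob (smf_comp A C G F) x) \<boxplus>\<^bsub>C\<^esub> cst0 (smf_comp A C G F)) = Ide C (fob (smf_comp A C G F) x)"
      by (simp add: G.cod.plus_cmp_ide_left sq [OF e1] e2 G.cst_unit_right)
    have e1: "cst2 G (fob F (Zero A), fob F x) \<cdot>\<^bsub>C\<^esub> (far G (cst0 F) \<boxplus>\<^bsub>C\<^esub> Ide C (fob G (fob F x))) =
        far G (cst0 F \<boxplus>\<^bsub>B\<^esub> Ide B (fob F x)) \<cdot>\<^bsub>C\<^esub> cst2 G (Zero B, fob F x)"
      using G.cst2_nat [of "cst0 F" "Ide B (fob F x)"] by simp
    have e2: "far G (cst2 F (Zero A, x)) \<cdot>\<^bsub>C\<^esub> far G (cst0 F \<boxplus>\<^bsub>B\<^esub> Ide B (fob F x)) =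
        Ide C (fob G (fob F x)) \<cdot>\<^bsub>C\<^esub> Ide C (fob G (fob F x))"
      using arg_cong [OF F.cst_unit_left, of x "far G"] by simp
    show "cst2 (smf_comp A C G F) (Zero A, x) \<cdot>\<^bsub>C\<^esub>
        (cst0 (smf_comp A C G F) \<boxplus>\<^bsub>C\<^esub> Ide C (fob (smf_comp A C G F) x)) = Ide C (fob (smf_comp A C G F) x)"
      by (simp add: G.cod.plus_cmp_ide_right sq [OF e1] e2 G.cst_unit_left)
  qed
qed

lemma strict_sm_functor_comp:
  assumes "strict_sm_functor A B F" "strict_sm_functor B C G"
  shows "strict_sm_functor A C (smf_comp A C G F)"
proof -
  interpret F: strict_sm_functor A B F by fact
  interpret G: strict_sm_functor B C G by fact
  interpret sm_functor A C "smf_comp A C G F"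
    by (rule sm_functor_comp) unfold_locales
  show ?thesis
    by unfold_locales simp_all
qed

section \<open>Monoidal transformations: vertical composition and whiskering\<close>

lemma sm_transI:
  assumes "sm_functor A C F" "sm_functor A C G" "t \<in> extensional (Obj A)"
    and "\<And>x. x \<in> Obj A \<Longrightarrow> t x \<in> hom C (fob F x) (fob G x)"
    and "\<And>f. f \<in> Arr A \<Longrightarrow> far G f \<cdot>\<^bsub>C\<^esub> t (Dom A f) = t (Cod A f) \<cdot>\<^bsub>C\<^esub> far F f"
    and "\<And>x y. \<lbrakk>x \<in> Obj A; y \<in> Obj A\<rbrakk> \<Longrightarrow>
      t (x \<oplus>\<^bsub>A\<^esub> y) \<cdot>\<^bsub>C\<^esub> cst2 F (x, y) = cst2 G (x, y) \<cdot>\<^bsub>C\<^esub> (t x \<boxplus>\<^bsub>C\<^esub> t y)"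
    and "t (Zero A) \<cdot>\<^bsub>C\<^esub> cst0 F = cst0 G"
  shows "sm_trans A C F G t"
  using assms nat_transI [of A C F G t] by (auto simp: sm_trans_def sm_functor_def)

lemma sm_trans_nat_trans: "sm_trans A C F G t \<Longrightarrow> nat_trans A C F G t"
  by (simp add: sm_trans_def)

lemma sm_transD:
  assumes "sm_trans A C F G t"
  shows "sm_functor A C F" "sm_functor A C G" "t \<in> extensional (Obj A)"
    and "x \<in> Obj A \<Longrightarrow> t x \<in> Arr C" "x \<in> Obj A \<Longrightarrow> Dom C (t x) = fob F x"
    and "x \<in> Obj A \<Longrightarrow> Cod C (t x) = fob G x"
    and "f \<in> Arr A \<Longrightarrow> far G f \<cdot>\<^bsub>C\<^esub> t (Dom A f) = t (Cod A f) \<cdot>\<^bsub>C\<^esub> far F f"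
    and "\<lbrakk>x \<in> Obj A; y \<in> Obj A\<rbrakk> \<Longrightarrow>
      t (x \<oplus>\<^bsub>A\<^esub> y) \<cdot>\<^bsub>C\<^esub> cst2 F (x, y) = cst2 G (x, y) \<cdot>\<^bsub>C\<^esub> (t x \<boxplus>\<^bsub>C\<^esub> t y)"
    and "t (Zero A) \<cdot>\<^bsub>C\<^esub> cst0 F = cst0 G"
  using assms nat_transD [OF sm_trans_nat_trans [OF assms]] by (auto simp: sm_trans_def)

lemma sm_trans_ide:
  assumes "sm_functor A C F"
  shows "sm_trans A C F F (\<lambda>x\<in>Obj A. Ide C (fob F x))"
proof -
  interpret sm_functor A C F by fact
  show ?thesis
    by (rule sm_transI) (auto simp: hom_iff assms)
qed

lemma sm_trans_vcomp:
  assumes t: "sm_trans A C F G t" and s: "sm_trans A C G H s"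
  shows "sm_trans A C F H (\<lambda>x\<in>Obj A. s x \<cdot>\<^bsub>C\<^esub> t x)"
proof -
  interpret F: sm_functor A C F using t by (simp add: sm_trans_def)
  interpret G: sm_functor A C G using t by (simp add: sm_trans_def)
  interpret H: sm_functor A C H using s by (simp add: sm_trans_def)
  note [simp] = sm_transD(4-6) [OF t] sm_transD(4-6) [OF s]
  note sq = F.cod.cmp_square_extend
  note n = nat_trans_vcomp [OF sm_trans_nat_trans [OF t] sm_trans_nat_trans [OF s]]
  show ?thesis
    unfolding sm_trans_def
  proof (intro conjI ballI)
    fix x y assume [simp]: "x \<in> Obj A" "y \<in> Obj A"
    note e1 = sm_transD(8) [OF t, of x y] and e2 = sm_transD(8) [OF s, of x y]
    show "(\<lambda>x\<in>Obj A. s x \<cdot>\<^bsub>C\<^esub> t x) (x \<oplus>\<^bsub>A\<^esub> y) \<cdot>\<^bsub>C\<^esub> cst2 F (x, y) =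
        cst2 H (x, y) \<cdot>\<^bsub>C\<^esub> ((\<lambda>x\<in>Obj A. s x \<cdot>\<^bsub>C\<^esub> t x) x \<boxplus>\<^bsub>C\<^esub> (\<lambda>x\<in>Obj A. s x \<cdot>\<^bsub>C\<^esub> t x) y)"
      by (simp add: F.cod.plus_cmp_arr e1 sq [OF e2])
  qed (simp_all add: sm_transD(9) [OF t] sm_transD(9) [OF s] n F.sm_functor_axioms H.sm_functor_axioms)
qed

lemma nat_trans_whisker_left:
  assumes t: "nat_trans A B F G t" and R: "cat_functor B C R"
    and FR: "cat_functor A C FR" "\<And>x. x \<in> Obj A \<Longrightarrow> fob FR x = fob R (fob F x)"
      "\<And>f. f \<in> Arr A \<Longrightarrow> far FR f = far R (far F f)"
    and GR: "cat_functor A C GR" "\<And>x. x \<in> Obj A \<Longrightarrow> fob GR x = fob R (fob G x)"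
      "\<And>f. f \<in> Arr A \<Longrightarrow> far GR f = far R (far G f)"
  shows "nat_trans A C FR GR (\<lambda>x\<in>Obj A. far R (t x))"
proof -
  interpret F: cat_functor A B F using t by (simp add: nat_trans_def)
  interpret G: cat_functor A B G using t by (simp add: nat_trans_def)
  interpret R: cat_functor B C R by fact
  note [simp] = nat_transD(4-6) [OF t] FR(2,3) GR(2,3)
  show ?thesis
  proof (rule nat_transI)
    fix f assume [simp]: "f \<in> Arr A"
    show "far GR f \<cdot>\<^bsub>C\<^esub> (\<lambda>x\<in>Obj A. far R (t x)) (Dom A f) = (\<lambda>x\<in>Obj A. far R (t x)) (Cod A f) \<cdot>\<^bsub>C\<^esub> far FR f"
      using arg_cong [OF nat_transD(7) [OF t], of f "far R"] by simp
  qed (auto simp: hom_iff FR(1) GR(1))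
qed

text \<open>Monoidality of \<open>t\<close> is mapped through \<open>R\<close>; the remaining factor
  is naturality of \<open>cst2 R\<close> at the components of \<open>t\<close>.\<close>

lemma sm_trans_whisker_left:
  assumes t: "sm_trans A B F G t" and R: "sm_functor B C R"
  shows "sm_trans A C (smf_comp A C R F) (smf_comp A C R G) (\<lambda>x\<in>Obj A. far R (t x))"
proof -
  interpret F: sm_functor A B F using t by (simp add: sm_trans_def)
  interpret G: sm_functor A B G using t by (simp add: sm_trans_def)
  interpret R: sm_functor B C R by fact
  interpret RF: sm_functor A C "smf_comp A C R F" by (rule sm_functor_comp) unfold_locales
  interpret RG: sm_functor A C "smf_comp A C R G" by (rule sm_functor_comp) unfold_locales
  note [simp] = sm_transD(4-6) [OF t]
  note sq = R.cod.cmp_square_extend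
  show ?thesis
    unfolding sm_trans_def
  proof (intro conjI ballI)
    show "nat_trans A C (smf_comp A C R F) (smf_comp A C R G) (\<lambda>x\<in>Obj A. far R (t x))"
      by (rule nat_trans_whisker_left [OF sm_trans_nat_trans [OF t]])
        (simp_all add: R.cat_functor_axioms RF.cat_functor_axioms RG.cat_functor_axioms)
  next
    fix x y assume [simp]: "x \<in> Obj A" "y \<in> Obj A"
    have e1: "far R (t (x \<oplus>\<^bsub>A\<^esub> y)) \<cdot>\<^bsub>C\<^esub> far R (cst2 F (x, y)) = far R (cst2 G (x, y)) \<cdot>\<^bsub>C\<^esub> far R (t x \<boxplus>\<^bsub>B\<^esub> t y)"
      using arg_cong [OF sm_transD(8) [OF t], of x y "far R"] by simp
    have e2: "far R (t x \<boxplus>\<^bsub>B\<^esub> t y) \<cdot>\<^bsub>C\<^esub> cst2 R (fob F x, fob F y) =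
        cst2 R (fob G x, fob G y) \<cdot>\<^bsub>C\<^esub> (far R (t x) \<boxplus>\<^bsub>C\<^esub> far R (t y))"
      using R.cst2_nat [of "t x" "t y"] by simp
    show "(\<lambda>x\<in>Obj A. far R (t x)) (x \<oplus>\<^bsub>A\<^esub> y) \<cdot>\<^bsub>C\<^esub> cst2 (smf_comp A C R F) (x, y) =
        cst2 (smf_comp A C R G) (x, y) \<cdot>\<^bsub>C\<^esub> ((\<lambda>x\<in>Obj A. far R (t x)) x \<boxplus>\<^bsub>C\<^esub> (\<lambda>x\<in>Obj A. far R (t x)) y)"
      by (simp add: e2 sq [OF e1])
  next
    have "far R (t (Zero A)) \<cdot>\<^bsub>C\<^esub> far R (cst0 F) = far R (cst0 G)"
      using arg_cong [OF sm_transD(9) [OF t], of "far R"] by simp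
    then show "(\<lambda>x\<in>Obj A. far R (t x)) (Zero A) \<cdot>\<^bsub>C\<^esub> cst0 (smf_comp A C R F) = cst0 (smf_comp A C R G)"
      using R.cod.cmp_assoc_arr [of "cst0 R" "far R (cst0 F)" "far R (t (Zero A))"] by simp
  qed unfold_locales
qed

text \<open>The constraint \<open>cst2 P (x, y)\<close> is an arrow of \<open>B\<close>, so
  naturality of \<open>t\<close> at it moves \<open>t\<close> past this factor; the other factor is
  monoidality of \<open>t\<close> at the images under \<open>P\<close>.\<close>

lemma sm_trans_whisker_right:
  assumes t: "sm_trans B C F G t" and P: "sm_functor A B P"
  shows "sm_trans A C (smf_comp A C F P) (smf_comp A C G P) (\<lambda>x\<in>Obj A. t (fob P x))"
proof -
  interpret F: sm_functor B C F using t by (simp add: sm_trans_def)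
  interpret G: sm_functor B C G using t by (simp add: sm_trans_def)
  interpret P: sm_functor A B P by fact
  interpret FP: sm_functor A C "smf_comp A C F P" by (rule sm_functor_comp) unfold_locales
  interpret GP: sm_functor A C "smf_comp A C G P" by (rule sm_functor_comp) unfold_locales
  note [simp] = sm_transD(4-6) [OF t]
  note sq = F.cod.cmp_square_extend
  show ?thesis
  proof (rule sm_transI)
    fix f assume [simp]: "f \<in> Arr A"
    show "far (smf_comp A C G P) f \<cdot>\<^bsub>C\<^esub> (\<lambda>x\<in>Obj A. t (fob P x)) (Dom A f) =
        (\<lambda>x\<in>Obj A. t (fob P x)) (Cod A f) \<cdot>\<^bsub>C\<^esub> far (smf_comp A C F P) f"
      using sm_transD(7) [OF t, of "far P f"] by simp
  next
    fix x y assume [simp]: "x \<in> Obj A" "y \<in> Obj A"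
    have e1: "t (fob P (x \<oplus>\<^bsub>A\<^esub> y)) \<cdot>\<^bsub>C\<^esub> far F (cst2 P (x, y)) =
        far G (cst2 P (x, y)) \<cdot>\<^bsub>C\<^esub> t (fob P x \<oplus>\<^bsub>B\<^esub> fob P y)"
      using sm_transD(7) [OF t, of "cst2 P (x, y)"] by simp
    show "(\<lambda>x\<in>Obj A. t (fob P x)) (x \<oplus>\<^bsub>A\<^esub> y) \<cdot>\<^bsub>C\<^esub> cst2 (smf_comp A C F P) (x, y) =
        cst2 (smf_comp A C G P) (x, y) \<cdot>\<^bsub>C\<^esub> ((\<lambda>x\<in>Obj A. t (fob P x)) x \<boxplus>\<^bsub>C\<^esub> (\<lambda>x\<in>Obj A. t (fob P x)) y)"
      by (simp add: sq [OF e1] sm_transD(8) [OF t])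
  next
    have e1: "t (fob P (Zero A)) \<cdot>\<^bsub>C\<^esub> far F (cst0 P) = far G (cst0 P) \<cdot>\<^bsub>C\<^esub> t (Zero B)"
      using sm_transD(7) [OF t, of "cst0 P"] by simp
    show "(\<lambda>x\<in>Obj A. t (fob P x)) (Zero A) \<cdot>\<^bsub>C\<^esub> cst0 (smf_comp A C F P) = cst0 (smf_comp A C G P)"
      by (simp add: sq [OF e1] sm_transD(9) [OF t])
  qed (simp_all add: hom_iff FP.sm_functor_axioms GP.sm_functor_axioms)
qed

lemma trans_family_PermCat_s:
  assumes "permutative A" "permutative C"
  shows "trans_family A C {F. strict_sm_functor A C F} (sm_trans A C)"
proof -
  interpret A: permutative A by fact
  interpret C: permutative C by fact
  show ?thesis
  proof (intro trans_family.intro trans_family_axioms.intro)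
    fix F assume "F \<in> {F. strict_sm_functor A C F}"
    then interpret F: strict_sm_functor A C F by simp
    show "cat_functor A C F" by unfold_locales
    show "sm_trans A C F F (\<lambda>x\<in>Obj A. Ide C (fob F x))"
      by (rule sm_trans_ide) unfold_locales
  qed (auto intro: sm_trans_nat_trans sm_trans_vcomp A.category_axioms C.category_axioms)
qed

section \<open>Bilinear maps\<close>

lemma bil_eqI:
  fixes H J :: "('oa, 'ma, 'ob, 'mb, 'oc, 'mc) bil"
  assumes "fob H = fob J" "far H = far J" "bdl H = bdl J" "bdr H = bdr J" "bzl H = bzl J" "bzr H = bzr J"
  shows "H = J"
  using assms by (intro bil.equality) auto

lemma fix_left_simps [simp]:
  "b \<in> Obj B \<Longrightarrow> fob (fix_left A B H a) b = fob H (a, b)"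
  "g \<in> Arr B \<Longrightarrow> far (fix_left A B H a) g = far H (Ide A a, g)"
  "\<lbrakk>b \<in> Obj B; b' \<in> Obj B\<rbrakk> \<Longrightarrow> cst2 (fix_left A B H a) (b, b') = bdl H (a, b, b')"
  "cst0 (fix_left A B H a) = bzl H a"
  by (auto simp: fix_left_def)

lemma fix_right_simps [simp]:
  "a \<in> Obj A \<Longrightarrow> fob (fix_right A B H b) a = fob H (a, b)"
  "f \<in> Arr A \<Longrightarrow> far (fix_right A B H b) f = far H (f, Ide B b)"
  "\<lbrakk>a \<in> Obj A; a' \<in> Obj A\<rbrakk> \<Longrightarrow> cst2 (fix_right A B H b) (a, a') = bdr H (a, a', b)"
  "cst0 (fix_right A B H b) = bzr H b"
  by (auto simp: fix_right_def)

lemma bilinearI: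
  fixes H :: "('oa, 'ma, 'ob, 'mb, 'oc, 'mc) bil"
  assumes "permutative A" "permutative B" "permutative C" "cat_functor (prod_cat A B) C H"
    and "bdl H \<in> extensional (Obj A \<times> Obj B \<times> Obj B)"
    and "bdr H \<in> extensional (Obj A \<times> Obj A \<times> Obj B)"
    and "bzl H \<in> extensional (Obj A)" "bzr H \<in> extensional (Obj B)"
    and "\<And>a. a \<in> Obj A \<Longrightarrow> sm_functor B C (fix_left A B H a)"
    and "\<And>b. b \<in> Obj B \<Longrightarrow> sm_functor A C (fix_right A B H b)"
    and "\<And>f g g'. \<lbrakk>f \<in> Arr A; g \<in> Arr B; g' \<in> Arr B\<rbrakk>
      \<Longrightarrow> far H (f, g \<boxplus>\<^bsub>B\<^esub> g') \<cdot>\<^bsub>C\<^esub> bdl H (Dom A f, Dom B g, Dom B g') =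
          bdl H (Cod A f, Cod B g, Cod B g') \<cdot>\<^bsub>C\<^esub> (far H (f, g) \<boxplus>\<^bsub>C\<^esub> far H (f, g'))"
    and "\<And>f f' g. \<lbrakk>f \<in> Arr A; f' \<in> Arr A; g \<in> Arr B\<rbrakk>
      \<Longrightarrow> far H (f \<boxplus>\<^bsub>A\<^esub> f', g) \<cdot>\<^bsub>C\<^esub> bdr H (Dom A f, Dom A f', Dom B g) =
          bdr H (Cod A f, Cod A f', Cod B g) \<cdot>\<^bsub>C\<^esub> (far H (f, g) \<boxplus>\<^bsub>C\<^esub> far H (f', g))"
    and "\<And>f. f \<in> Arr A \<Longrightarrow> far H (f, Ide B (Zero B)) \<cdot>\<^bsub>C\<^esub> bzl H (Dom A f) = bzl H (Cod A f)"
    and "\<And>g. g \<in> Arr B \<Longrightarrow> far H (Ide A (Zero A), g) \<cdot>\<^bsub>C\<^esub> bzr H (Dom B g) = bzr H (Cod B g)"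
    and "\<And>a a' b b'. \<lbrakk>a \<in> Obj A; a' \<in> Obj A; b \<in> Obj B; b' \<in> Obj B\<rbrakk>
      \<Longrightarrow> bdr H (a, a', b \<oplus>\<^bsub>B\<^esub> b') \<cdot>\<^bsub>C\<^esub> (bdl H (a, b, b') \<boxplus>\<^bsub>C\<^esub> bdl H (a', b, b')) =
          bdl H (a \<oplus>\<^bsub>A\<^esub> a', b, b') \<cdot>\<^bsub>C\<^esub> (bdr H (a, a', b) \<boxplus>\<^bsub>C\<^esub> bdr H (a, a', b')) \<cdot>\<^bsub>C\<^esub>
            (Ide C (fob H (a, b)) \<boxplus>\<^bsub>C\<^esub> Beta C (fob H (a, b')) (fob H (a', b)) \<boxplus>\<^bsub>C\<^esub> Ide C (fob H (a', b')))"
    and "bzl H (Zero A) = bzr H (Zero B)"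
    and "\<And>a a'. \<lbrakk>a \<in> Obj A; a' \<in> Obj A\<rbrakk>
      \<Longrightarrow> bdr H (a, a', Zero B) \<cdot>\<^bsub>C\<^esub> (bzl H a \<boxplus>\<^bsub>C\<^esub> bzl H a') = bzl H (a \<oplus>\<^bsub>A\<^esub> a')"
    and "\<And>b b'. \<lbrakk>b \<in> Obj B; b' \<in> Obj B\<rbrakk>
      \<Longrightarrow> bdl H (Zero A, b, b') \<cdot>\<^bsub>C\<^esub> (bzr H b \<boxplus>\<^bsub>C\<^esub> bzr H b') = bzr H (b \<oplus>\<^bsub>B\<^esub> b')"
  shows "bilinear A B C H"
  using assms by (intro bilinear.intro bilinear_axioms.intro) (auto simp: hom_iff)

context bilinear
begin

lemma bdl_simps [simp]:
  assumes "a \<in> Obj A" "b \<in> Obj B" "b' \<in> Obj B"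
  shows "bdl H (a, b, b') \<in> Arr C" "Dom C (bdl H (a, b, b')) = fob H (a, b) \<oplus>\<^bsub>C\<^esub> fob H (a, b')"
    "Cod C (bdl H (a, b, b')) = fob H (a, b \<oplus>\<^bsub>B\<^esub> b')" "is_iso C (bdl H (a, b, b'))"
  using sm_functor.cst2_simps [OF fix_left_sm [OF assms(1)] assms(2,3)] assms by simp_all

lemma bdr_simps [simp]:
  assumes "a \<in> Obj A" "a' \<in> Obj A" "b \<in> Obj B"
  shows "bdr H (a, a', b) \<in> Arr C" "Dom C (bdr H (a, a', b)) = fob H (a, b) \<oplus>\<^bsub>C\<^esub> fob H (a', b)"
    "Cod C (bdr H (a, a', b)) = fob H (a \<oplus>\<^bsub>A\<^esub> a', b)" "is_iso C (bdr H (a, a', b))"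
  using sm_functor.cst2_simps [OF fix_right_sm [OF assms(3)] assms(1,2)] assms by simp_all

lemma bzl_simps [simp]:
  assumes "a \<in> Obj A"
  shows "bzl H a \<in> Arr C" "Dom C (bzl H a) = Zero C" "Cod C (bzl H a) = fob H (a, Zero B)"
    "is_iso C (bzl H a)"
  using sm_functor.cst0_simps [OF fix_left_sm [OF assms]] assms by simp_all

lemma bzr_simps [simp]:
  assumes "b \<in> Obj B"
  shows "bzr H b \<in> Arr C" "Dom C (bzr H b) = Zero C" "Cod C (bzr H b) = fob H (Zero A, b)"
    "is_iso C (bzr H b)"
  using sm_functor.cst0_simps [OF fix_right_sm [OF assms]] assms by simp_all

lemma far_ide_pair [simp]:
  "\<lbrakk>a \<in> Obj A; b \<in> Obj B\<rbrakk> \<Longrightarrow> far H (Ide A a, Ide B b) = Ide C (fob H (a, b))"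
  using far_ide [of "(a, b)"] by simp

lemma far_merge:
  "\<lbrakk>f \<in> Arr A; f' \<in> Arr A; g \<in> Arr B; g' \<in> Arr B; Cod A f = Dom A f'; Cod B g = Dom B g'\<rbrakk>
    \<Longrightarrow> far H (f', g') \<cdot>\<^bsub>C\<^esub> far H (f, g) = far H (f' \<cdot>\<^bsub>A\<^esub> f, g' \<cdot>\<^bsub>B\<^esub> g)"
  using far_cmp_arr [of "(f, g)" "(f', g')"] by simp

lemma far_merge_extend:
  "\<lbrakk>f \<in> Arr A; f' \<in> Arr A; g \<in> Arr B; g' \<in> Arr B; Cod A f = Dom A f'; Cod B g = Dom B g';
    r \<in> Arr C; Cod C r = fob H (Dom A f, Dom B g)\<rbrakk>
    \<Longrightarrow> far H (f', g') \<cdot>\<^bsub>C\<^esub> far H (f, g) \<cdot>\<^bsub>C\<^esub> r = far H (f' \<cdot>\<^bsub>A\<^esub> f, g' \<cdot>\<^bsub>B\<^esub> g) \<cdot>\<^bsub>C\<^esub> r"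
  by (simp add: far_merge [symmetric])

lemma bdl_nat:
  "\<lbrakk>f \<in> Arr A; g \<in> Arr B; g' \<in> Arr B\<rbrakk>
    \<Longrightarrow> far H (f, g \<boxplus>\<^bsub>B\<^esub> g') \<cdot>\<^bsub>C\<^esub> bdl H (Dom A f, Dom B g, Dom B g') =
        bdl H (Cod A f, Cod B g, Cod B g') \<cdot>\<^bsub>C\<^esub> (far H (f, g) \<boxplus>\<^bsub>C\<^esub> far H (f, g'))"
  by (rule bdl_natural) (auto simp: hom_iff)

lemma bdr_nat:
  "\<lbrakk>f \<in> Arr A; f' \<in> Arr A; g \<in> Arr B\<rbrakk>
    \<Longrightarrow> far H (f \<boxplus>\<^bsub>A\<^esub> f', g) \<cdot>\<^bsub>C\<^esub> bdr H (Dom A f, Dom A f', Dom B g) =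
        bdr H (Cod A f, Cod A f', Cod B g) \<cdot>\<^bsub>C\<^esub> (far H (f, g) \<boxplus>\<^bsub>C\<^esub> far H (f', g))"
  by (rule bdr_natural) (auto simp: hom_iff)

lemma bzl_nat: "f \<in> Arr A \<Longrightarrow> far H (f, Ide B (Zero B)) \<cdot>\<^bsub>C\<^esub> bzl H (Dom A f) = bzl H (Cod A f)"
  by (rule bzl_natural) (auto simp: hom_iff)

lemma bzr_nat: "g \<in> Arr B \<Longrightarrow> far H (Ide A (Zero A), g) \<cdot>\<^bsub>C\<^esub> bzr H (Dom B g) = bzr H (Cod B g)"
  by (rule bzr_natural) (auto simp: hom_iff)

end

section \<open>Composing bilinear maps with symmetric monoidal functors\<close>

lemma bil_pre_simps [simp]:
  "\<lbrakk>a \<in> Obj A'; b \<in> Obj B'\<rbrakk> \<Longrightarrow> fob (bil_pre A' B' A B C P Q H) (a, b) = fob H (fob P a, fob Q b)"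
  "\<lbrakk>f \<in> Arr A'; g \<in> Arr B'\<rbrakk> \<Longrightarrow> far (bil_pre A' B' A B C P Q H) (f, g) = far H (far P f, far Q g)"
  "\<lbrakk>a \<in> Obj A'; b \<in> Obj B'; b' \<in> Obj B'\<rbrakk> \<Longrightarrow> bdl (bil_pre A' B' A B C P Q H) (a, b, b') =
    far H (Ide A (fob P a), cst2 Q (b, b')) \<cdot>\<^bsub>C\<^esub> bdl H (fob P a, fob Q b, fob Q b')"
  "\<lbrakk>a \<in> Obj A'; a' \<in> Obj A'; b \<in> Obj B'\<rbrakk> \<Longrightarrow> bdr (bil_pre A' B' A B C P Q H) (a, a', b) =
    far H (cst2 P (a, a'), Ide B (fob Q b)) \<cdot>\<^bsub>C\<^esub> bdr H (fob P a, fob P a', fob Q b)"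
  "a \<in> Obj A' \<Longrightarrow> bzl (bil_pre A' B' A B C P Q H) a = far H (Ide A (fob P a), cst0 Q) \<cdot>\<^bsub>C\<^esub> bzl H (fob P a)"
  "b \<in> Obj B' \<Longrightarrow> bzr (bil_pre A' B' A B C P Q H) b = far H (cst0 P, Ide B (fob Q b)) \<cdot>\<^bsub>C\<^esub> bzr H (fob Q b)"
  by (simp_all add: bil_pre_def)

lemma bil_post_simps [simp]:
  "\<lbrakk>a \<in> Obj A; b \<in> Obj B\<rbrakk> \<Longrightarrow> fob (bil_post A B C' R H) (a, b) = fob R (fob H (a, b))"
  "\<lbrakk>f \<in> Arr A; g \<in> Arr B\<rbrakk> \<Longrightarrow> far (bil_post A B C' R H) (f, g) = far R (far H (f, g))"
  "\<lbrakk>a \<in> Obj A; b \<in> Obj B; b' \<in> Obj B\<rbrakk> \<Longrightarrow> bdl (bil_post A B C' R H) (a, b, b') =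
    far R (bdl H (a, b, b')) \<cdot>\<^bsub>C'\<^esub> cst2 R (fob H (a, b), fob H (a, b'))"
  "\<lbrakk>a \<in> Obj A; a' \<in> Obj A; b \<in> Obj B\<rbrakk> \<Longrightarrow> bdr (bil_post A B C' R H) (a, a', b) =
    far R (bdr H (a, a', b)) \<cdot>\<^bsub>C'\<^esub> cst2 R (fob H (a, b), fob H (a', b))"
  "a \<in> Obj A \<Longrightarrow> bzl (bil_post A B C' R H) a = far R (bzl H a) \<cdot>\<^bsub>C'\<^esub> cst0 R"
  "b \<in> Obj B \<Longrightarrow> bzr (bil_post A B C' R H) b = far R (bzr H b) \<cdot>\<^bsub>C'\<^esub> cst0 R"
  by (simp_all add: bil_post_def)

text \<open>With one variable fixed, \<open>H(P-, Q-)\<close> is a composite of symmetric monoidal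
  functors, which settles axiom (i). The mixed axioms follow from those of \<open>H\<close> at the
  images, once the constraint arrows of \<open>P\<close> and \<open>Q\<close> have been moved past
  the constraints of \<open>H\<close> by naturality.\<close>

lemma bilinear_pre:
  assumes "sm_functor A' A P" "sm_functor B' B Q" "bilinear A B C H"
  shows "bilinear A' B' C (bil_pre A' B' A B C P Q H)" (is "bilinear A' B' C ?K")
proof -
  interpret P: sm_functor A' A P by fact
  interpret Q: sm_functor B' B Q by fact
  interpret H: bilinear A B C H by fact
  interpret AB: category "prod_cat A' B'"
    by (rule category_prod_cat) unfold_locales
  have K: "cat_functor (prod_cat A' B') C ?K"
    by (intro cat_functor.intro cat_functor_axioms.intro AB.category_axioms H.cod.category_axioms)
      (auto simp: hom_iff H.far_merge bil_pre_def)
  note sq = H.cod.cmp_square_extend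
  show ?thesis
  proof (rule bilinearI [OF _ _ _ K])
    fix a assume [simp]: "a \<in> Obj A'"
    have "fix_left A' B' ?K a = smf_comp B' C (fix_left A B H (fob P a)) Q"
      by (rule smf_eqI) (auto simp: fun_eq_iff fix_left_def smf_comp_def)
    then show "sm_functor B' C (fix_left A' B' ?K a)"
      by (simp add: sm_functor_comp [OF Q.sm_functor_axioms] H.fix_left_sm)
  next
    fix b assume [simp]: "b \<in> Obj B'"
    have "fix_right A' B' ?K b = smf_comp A' C (fix_right A B H (fob Q b)) P"
      by (rule smf_eqI) (auto simp: fun_eq_iff fix_right_def smf_comp_def)
    then show "sm_functor A' C (fix_right A' B' ?K b)"
      by (simp add: sm_functor_comp [OF P.sm_functor_axioms] H.fix_right_sm)
  next
    fix f g g' assume [simp]: "f \<in> Arr A'" "g \<in> Arr B'" "g' \<in> Arr B'"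
    show "far ?K (f, g \<boxplus>\<^bsub>B'\<^esub> g') \<cdot>\<^bsub>C\<^esub> bdl ?K (Dom A' f, Dom B' g, Dom B' g') =
        bdl ?K (Cod A' f, Cod B' g, Cod B' g') \<cdot>\<^bsub>C\<^esub> (far ?K (f, g) \<boxplus>\<^bsub>C\<^esub> far ?K (f, g'))"
      using H.bdl_nat [of "far P f" "far Q g" "far Q g'", symmetric]
      by (simp add: H.far_merge_extend Q.cst2_nat)
  next
    fix f f' g assume [simp]: "f \<in> Arr A'" "f' \<in> Arr A'" "g \<in> Arr B'"
    show "far ?K (f \<boxplus>\<^bsub>A'\<^esub> f', g) \<cdot>\<^bsub>C\<^esub> bdr ?K (Dom A' f, Dom A' f', Dom B' g) =
        bdr ?K (Cod A' f, Cod A' f', Cod B' g) \<cdot>\<^bsub>C\<^esub> (far ?K (f, g) \<boxplus>\<^bsub>C\<^esub> far ?K (f', g))"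
      using H.bdr_nat [of "far P f" "far P f'" "far Q g", symmetric]
      by (simp add: H.far_merge_extend P.cst2_nat)
  next
    fix f assume [simp]: "f \<in> Arr A'"
    show "far ?K (f, Ide B' (Zero B')) \<cdot>\<^bsub>C\<^esub> bzl ?K (Dom A' f) = bzl ?K (Cod A' f)"
      using H.bzl_nat [of "far P f", symmetric] by (simp add: H.far_merge_extend)
  next
    fix g assume [simp]: "g \<in> Arr B'"
    show "far ?K (Ide A' (Zero A'), g) \<cdot>\<^bsub>C\<^esub> bzr ?K (Dom B' g) = bzr ?K (Cod B' g)"
      using H.bzr_nat [of "far Q g", symmetric] by (simp add: H.far_merge_extend)
  next
    fix a a' b b' assume [simp]: "a \<in> Obj A'" "a' \<in> Obj A'" "b \<in> Obj B'" "b' \<in> Obj B'"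
    \<comment> \<open>Here \<open>H(1, Q\<^sub>2)\<close> crosses \<open>bdr\<close>, and in e2
      \<open>H(P\<^sub>2, 1)\<close> crosses \<open>bdl\<close>; on each side the two then merge to
      \<open>H(P\<^sub>2, Q\<^sub>2)\<close> by bifunctoriality.\<close>
    have e1: "bdr H (fob P a, fob P a', fob Q (b \<oplus>\<^bsub>B'\<^esub> b')) \<cdot>\<^bsub>C\<^esub>
        (far H (Ide A (fob P a), cst2 Q (b, b')) \<boxplus>\<^bsub>C\<^esub> far H (Ide A (fob P a'), cst2 Q (b, b'))) =
        far H (Ide A (fob P a \<oplus>\<^bsub>A\<^esub> fob P a'), cst2 Q (b, b')) \<cdot>\<^bsub>C\<^esub>
        bdr H (fob P a, fob P a', fob Q b \<oplus>\<^bsub>B\<^esub> fob Q b')"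
      using H.bdr_nat [of "Ide A (fob P a)" "Ide A (fob P a')" "cst2 Q (b, b')"] by simp
    have e2: "bdl H (fob P (a \<oplus>\<^bsub>A'\<^esub> a'), fob Q b, fob Q b') \<cdot>\<^bsub>C\<^esub>
        (far H (cst2 P (a, a'), Ide B (fob Q b)) \<boxplus>\<^bsub>C\<^esub> far H (cst2 P (a, a'), Ide B (fob Q b'))) =
        far H (cst2 P (a, a'), Ide B (fob Q b \<oplus>\<^bsub>B\<^esub> fob Q b')) \<cdot>\<^bsub>C\<^esub>
        bdl H (fob P a \<oplus>\<^bsub>A\<^esub> fob P a', fob Q b, fob Q b')"
      using H.bdl_nat [of "cst2 P (a, a')" "Ide B (fob Q b)" "Ide B (fob Q b')"] by simp
    show "bdr ?K (a, a', b \<oplus>\<^bsub>B'\<^esub> b') \<cdot>\<^bsub>C\<^esub> (bdl ?K (a, b, b') \<boxplus>\<^bsub>C\<^esub> bdl ?K (a', b, b')) =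
          bdl ?K (a \<oplus>\<^bsub>A'\<^esub> a', b, b') \<cdot>\<^bsub>C\<^esub> (bdr ?K (a, a', b) \<boxplus>\<^bsub>C\<^esub> bdr ?K (a, a', b')) \<cdot>\<^bsub>C\<^esub>
            (Ide C (fob ?K (a, b)) \<boxplus>\<^bsub>C\<^esub> Beta C (fob ?K (a, b')) (fob ?K (a', b)) \<boxplus>\<^bsub>C\<^esub> Ide C (fob ?K (a', b')))"
      using H.interchange [of "fob P a" "fob P a'" "fob Q b" "fob Q b'"]
      by (simp add: H.cod.plus_cmp_arr sq [OF e1] sq [OF e2] H.far_merge_extend)
  next
    \<comment> \<open>Both composites are \<open>H(P\<^sub>0, Q\<^sub>0)\<close>. By naturality of
      \<open>bzl\<close> and \<open>bzr\<close>, the two sides of the goal are these composites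
      following the common value of \<open>bzl H\<close> and \<open>bzr H\<close> at zero.\<close>
    have "far H (Ide A (fob P (Zero A')), cst0 Q) \<cdot>\<^bsub>C\<^esub> far H (cst0 P, Ide B (Zero B)) =
        far H (cst0 P, Ide B (fob Q (Zero B'))) \<cdot>\<^bsub>C\<^esub> far H (Ide A (Zero A), cst0 Q)"
      by (simp add: H.far_merge)
    from sq [OF this, of "bzl H (Zero A)"]
    show "bzl ?K (Zero A') = bzr ?K (Zero B')"
      using H.bzl_nat [of "cst0 P"] H.bzr_nat [of "cst0 Q"] by (simp add: H.zero_zero)
  next
    fix a a' assume [simp]: "a \<in> Obj A'" "a' \<in> Obj A'"
    have e1: "bdr H (fob P a, fob P a', fob Q (Zero B')) \<cdot>\<^bsub>C\<^esub>
        (far H (Ide A (fob P a), cst0 Q) \<boxplus>\<^bsub>C\<^esub> far H (Ide A (fob P a'), cst0 Q)) =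
        far H (Ide A (fob P a \<oplus>\<^bsub>A\<^esub> fob P a'), cst0 Q) \<cdot>\<^bsub>C\<^esub> bdr H (fob P a, fob P a', Zero B)"
      using H.bdr_nat [of "Ide A (fob P a)" "Ide A (fob P a')" "cst0 Q"] by simp
    have e2: "far H (cst2 P (a, a'), Ide B (Zero B)) \<cdot>\<^bsub>C\<^esub> bzl H (fob P a \<oplus>\<^bsub>A\<^esub> fob P a') =
        bzl H (fob P (a \<oplus>\<^bsub>A'\<^esub> a'))"
      using H.bzl_nat [of "cst2 P (a, a')"] by simp
    show "bdr ?K (a, a', Zero B') \<cdot>\<^bsub>C\<^esub> (bzl ?K a \<boxplus>\<^bsub>C\<^esub> bzl ?K a') = bzl ?K (a \<oplus>\<^bsub>A'\<^esub> a')"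
      using H.bdr_zero [of "fob P a" "fob P a'"]
      by (simp add: H.cod.plus_cmp_arr sq [OF e1] e2 [symmetric] H.far_merge_extend)
  next
    fix b b' assume [simp]: "b \<in> Obj B'" "b' \<in> Obj B'"
    have e1: "bdl H (fob P (Zero A'), fob Q b, fob Q b') \<cdot>\<^bsub>C\<^esub>
        (far H (cst0 P, Ide B (fob Q b)) \<boxplus>\<^bsub>C\<^esub> far H (cst0 P, Ide B (fob Q b'))) =
        far H (cst0 P, Ide B (fob Q b \<oplus>\<^bsub>B\<^esub> fob Q b')) \<cdot>\<^bsub>C\<^esub> bdl H (Zero A, fob Q b, fob Q b')"
      using H.bdl_nat [of "cst0 P" "Ide B (fob Q b)" "Ide B (fob Q b')"] by simp
    have e2: "far H (Ide A (Zero A), cst2 Q (b, b')) \<cdot>\<^bsub>C\<^esub> bzr H (fob Q b \<oplus>\<^bsub>B\<^esub> fob Q b') =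
        bzr H (fob Q (b \<oplus>\<^bsub>B'\<^esub> b'))"
      using H.bzr_nat [of "cst2 Q (b, b')"] by simp
    show "bdl ?K (Zero A', b, b') \<cdot>\<^bsub>C\<^esub> (bzr ?K b \<boxplus>\<^bsub>C\<^esub> bzr ?K b') = bzr ?K (b \<oplus>\<^bsub>B'\<^esub> b')"
      using H.bdl_zero [of "fob Q b" "fob Q b'"]
      by (simp add: H.cod.plus_cmp_arr sq [OF e1] e2 [symmetric] H.far_merge_extend)
  qed (simp_all add: bil_pre_def P.dom.permutative_axioms Q.dom.permutative_axioms H.cod.permutative_axioms)
qed

text \<open>The constraints of \<open>R\<close> are identities and vanish under simplification, so
  each mixed axiom is the image under \<open>R\<close> of the same axiom for
  \<open>H\<close>.\<close>

lemma bilinear_post: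
  assumes "strict_sm_functor C C' R" "bilinear A B C H"
  shows "bilinear A B C' (bil_post A B C' R H)" (is "bilinear A B C' ?K")
proof -
  interpret R: strict_sm_functor C C' R by fact
  interpret H: bilinear A B C H by fact
  have K: "cat_functor (prod_cat A B) C' ?K"
    by (intro cat_functor.intro cat_functor_axioms.intro H.dom.category_axioms R.cod.category_axioms)
      (auto simp: hom_iff H.far_merge [symmetric] bil_post_def)
  have far_sum: "far R f \<cdot>\<^bsub>C'\<^esub> (far R g \<boxplus>\<^bsub>C'\<^esub> far R h) = far R (f \<cdot>\<^bsub>C\<^esub> (g \<boxplus>\<^bsub>C\<^esub> h))"
    if "f \<in> Arr C" "g \<in> Arr C" "h \<in> Arr C" "Dom C f = Cod C g \<oplus>\<^bsub>C\<^esub> Cod C h" for f g h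
    using that by simp
  show ?thesis
  proof (rule bilinearI [OF _ _ _ K])
    fix a assume [simp]: "a \<in> Obj A"
    have "fix_left A B ?K a = smf_comp B C' R (fix_left A B H a)"
      by (rule smf_eqI) (auto simp: fun_eq_iff fix_left_def smf_comp_def)
    then show "sm_functor B C' (fix_left A B ?K a)"
      by (simp add: sm_functor_comp [OF _ R.sm_functor_axioms] H.fix_left_sm)
  next
    fix b assume [simp]: "b \<in> Obj B"
    have "fix_right A B ?K b = smf_comp A C' R (fix_right A B H b)"
      by (rule smf_eqI) (auto simp: fun_eq_iff fix_right_def smf_comp_def)
    then show "sm_functor A C' (fix_right A B ?K b)"
      by (simp add: sm_functor_comp [OF _ R.sm_functor_axioms] H.fix_right_sm)
  next
    fix f g g' assume [simp]: "f \<in> Arr A" "g \<in> Arr B" "g' \<in> Arr B"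
    show "far ?K (f, g \<boxplus>\<^bsub>B\<^esub> g') \<cdot>\<^bsub>C'\<^esub> bdl ?K (Dom A f, Dom B g, Dom B g') =
        bdl ?K (Cod A f, Cod B g, Cod B g') \<cdot>\<^bsub>C'\<^esub> (far ?K (f, g) \<boxplus>\<^bsub>C'\<^esub> far ?K (f, g'))"
      using arg_cong [OF H.bdl_nat [of f g g'], of "far R"] by simp
  next
    fix f f' g assume [simp]: "f \<in> Arr A" "f' \<in> Arr A" "g \<in> Arr B"
    show "far ?K (f \<boxplus>\<^bsub>A\<^esub> f', g) \<cdot>\<^bsub>C'\<^esub> bdr ?K (Dom A f, Dom A f', Dom B g) =
        bdr ?K (Cod A f, Cod A f', Cod B g) \<cdot>\<^bsub>C'\<^esub> (far ?K (f, g) \<boxplus>\<^bsub>C'\<^esub> far ?K (f', g))"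
      using arg_cong [OF H.bdr_nat [of f f' g], of "far R"] by simp
  next
    fix f assume [simp]: "f \<in> Arr A"
    show "far ?K (f, Ide B (Zero B)) \<cdot>\<^bsub>C'\<^esub> bzl ?K (Dom A f) = bzl ?K (Cod A f)"
      using arg_cong [OF H.bzl_nat [of f], of "far R"] by simp
  next
    fix g assume [simp]: "g \<in> Arr B"
    show "far ?K (Ide A (Zero A), g) \<cdot>\<^bsub>C'\<^esub> bzr ?K (Dom B g) = bzr ?K (Cod B g)"
      using arg_cong [OF H.bzr_nat [of g], of "far R"] by simp
  next
    fix a a' b b' assume [simp]: "a \<in> Obj A" "a' \<in> Obj A" "b \<in> Obj B" "b' \<in> Obj B"
    show "bdr ?K (a, a', b \<oplus>\<^bsub>B\<^esub> b') \<cdot>\<^bsub>C'\<^esub> (bdl ?K (a, b, b') \<boxplus>\<^bsub>C'\<^esub> bdl ?K (a', b, b')) =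
          bdl ?K (a \<oplus>\<^bsub>A\<^esub> a', b, b') \<cdot>\<^bsub>C'\<^esub> (bdr ?K (a, a', b) \<boxplus>\<^bsub>C'\<^esub> bdr ?K (a, a', b')) \<cdot>\<^bsub>C'\<^esub>
            (Ide C' (fob ?K (a, b)) \<boxplus>\<^bsub>C'\<^esub> Beta C' (fob ?K (a, b')) (fob ?K (a', b)) \<boxplus>\<^bsub>C'\<^esub> Ide C' (fob ?K (a', b')))"
      using arg_cong [OF H.interchange [of a a' b b'], of "far R"] by simp
  next
    show "bzl ?K (Zero A) = bzr ?K (Zero B)"
      using H.zero_zero by simp
  next
    fix a a' assume [simp]: "a \<in> Obj A" "a' \<in> Obj A"
    show "bdr ?K (a, a', Zero B) \<cdot>\<^bsub>C'\<^esub> (bzl ?K a \<boxplus>\<^bsub>C'\<^esub> bzl ?K a') = bzl ?K (a \<oplus>\<^bsub>A\<^esub> a')"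
      using arg_cong [OF H.bdr_zero [of a a'], of "far R"] by simp
  next
    fix b b' assume [simp]: "b \<in> Obj B" "b' \<in> Obj B"
    show "bdl ?K (Zero A, b, b') \<cdot>\<^bsub>C'\<^esub> (bzr ?K b \<boxplus>\<^bsub>C'\<^esub> bzr ?K b') = bzr ?K (b \<oplus>\<^bsub>B\<^esub> b')"
      using arg_cong [OF H.bdl_zero [of b b'], of "far R"] by simp
  qed (simp_all add: bil_post_def H.fst.permutative_axioms H.snd.permutative_axioms R.cod.permutative_axioms)
qed

section \<open>Bilinear transformations\<close>

lemma bil_transI:
  assumes H: "bilinear A B C H" and J: "bilinear A B C J" and t: "t \<in> extensional (Obj A \<times> Obj B)"
    and hom: "\<And>a b. \<lbrakk>a \<in> Obj A; b \<in> Obj B\<rbrakk> \<Longrightarrow> t (a, b) \<in> hom C (fob H (a, b)) (fob J (a, b))"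
    and nat: "\<And>f g. \<lbrakk>f \<in> Arr A; g \<in> Arr B\<rbrakk> \<Longrightarrow>
      far J (f, g) \<cdot>\<^bsub>C\<^esub> t (Dom A f, Dom B g) = t (Cod A f, Cod B g) \<cdot>\<^bsub>C\<^esub> far H (f, g)"
    and bdl: "\<And>a b b'. \<lbrakk>a \<in> Obj A; b \<in> Obj B; b' \<in> Obj B\<rbrakk> \<Longrightarrow>
      t (a, b \<oplus>\<^bsub>B\<^esub> b') \<cdot>\<^bsub>C\<^esub> bdl H (a, b, b') = bdl J (a, b, b') \<cdot>\<^bsub>C\<^esub> (t (a, b) \<boxplus>\<^bsub>C\<^esub> t (a, b'))"
    and bdr: "\<And>a a' b. \<lbrakk>a \<in> Obj A; a' \<in> Obj A; b \<in> Obj B\<rbrakk> \<Longrightarrow>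
      t (a \<oplus>\<^bsub>A\<^esub> a', b) \<cdot>\<^bsub>C\<^esub> bdr H (a, a', b) = bdr J (a, a', b) \<cdot>\<^bsub>C\<^esub> (t (a, b) \<boxplus>\<^bsub>C\<^esub> t (a', b))"
    and bzl: "\<And>a. a \<in> Obj A \<Longrightarrow> t (a, Zero B) \<cdot>\<^bsub>C\<^esub> bzl H a = bzl J a"
    and bzr: "\<And>b. b \<in> Obj B \<Longrightarrow> t (Zero A, b) \<cdot>\<^bsub>C\<^esub> bzr H b = bzr J b"
  shows "bil_trans A B C H J t"
  unfolding bil_trans_def
proof (intro conjI ballI)
  interpret H: bilinear A B C H by fact
  interpret J: bilinear A B C J by fact
  have [simp]: "t (a, b) \<in> Arr C" "Dom C (t (a, b)) = fob H (a, b)" "Cod C (t (a, b)) = fob J (a, b)"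
    if "a \<in> Obj A" "b \<in> Obj B" for a b
    using hom [OF that] by (auto simp: hom_iff)
  show "nat_trans (prod_cat A B) C H J t"
    by (rule nat_transI) (auto simp: H.cat_functor_axioms J.cat_functor_axioms hom_iff t nat)
  fix a assume [simp]: "a \<in> Obj A"
  show "sm_trans B C (fix_left A B H a) (fix_left A B J a) (\<lambda>b\<in>Obj B. t (a, b))"
    \<comment> \<open>Naturality in the second variable alone is joint naturality with an identity
      in the first.\<close>
    using nat [of "Ide A a"]
    by (intro sm_transI) (auto simp: H.fix_left_sm J.fix_left_sm hom_iff bdl bzl)
next
  interpret H: bilinear A B C H by fact
  interpret J: bilinear A B C J by fact
  have [simp]: "t (a, b) \<in> Arr C" "Dom C (t (a, b)) = fob H (a, b)" "Cod C (t (a, b)) = fob J (a, b)"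
    if "a \<in> Obj A" "b \<in> Obj B" for a b
    using hom [OF that] by (auto simp: hom_iff)
  fix b assume [simp]: "b \<in> Obj B"
  show "sm_trans A C (fix_right A B H b) (fix_right A B J b) (\<lambda>a\<in>Obj A. t (a, b))"
    using nat [of _ "Ide B b"]
    by (intro sm_transI) (auto simp: H.fix_right_sm J.fix_right_sm hom_iff bdr bzr)
qed fact+

lemma bil_trans_nat_trans: "bil_trans A B C H J t \<Longrightarrow> nat_trans (prod_cat A B) C H J t"
  by (simp add: bil_trans_def)

lemma bil_transD:
  assumes t: "bil_trans A B C H J t"
  shows "bilinear A B C H" "bilinear A B C J" "t \<in> extensional (Obj A \<times> Obj B)"
    and "\<lbrakk>a \<in> Obj A; b \<in> Obj B\<rbrakk> \<Longrightarrow> t (a, b) \<in> Arr C"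
    and "\<lbrakk>a \<in> Obj A; b \<in> Obj B\<rbrakk> \<Longrightarrow> Dom C (t (a, b)) = fob H (a, b)"
    and "\<lbrakk>a \<in> Obj A; b \<in> Obj B\<rbrakk> \<Longrightarrow> Cod C (t (a, b)) = fob J (a, b)"
    and "\<lbrakk>f \<in> Arr A; g \<in> Arr B\<rbrakk> \<Longrightarrow>
      far J (f, g) \<cdot>\<^bsub>C\<^esub> t (Dom A f, Dom B g) = t (Cod A f, Cod B g) \<cdot>\<^bsub>C\<^esub> far H (f, g)"
    and "\<lbrakk>a \<in> Obj A; b \<in> Obj B; b' \<in> Obj B\<rbrakk> \<Longrightarrow>
      t (a, b \<oplus>\<^bsub>B\<^esub> b') \<cdot>\<^bsub>C\<^esub> bdl H (a, b, b') = bdl J (a, b, b') \<cdot>\<^bsub>C\<^esub> (t (a, b) \<boxplus>\<^bsub>C\<^esub> t (a, b'))"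
    and "\<lbrakk>a \<in> Obj A; a' \<in> Obj A; b \<in> Obj B\<rbrakk> \<Longrightarrow>
      t (a \<oplus>\<^bsub>A\<^esub> a', b) \<cdot>\<^bsub>C\<^esub> bdr H (a, a', b) = bdr J (a, a', b) \<cdot>\<^bsub>C\<^esub> (t (a, b) \<boxplus>\<^bsub>C\<^esub> t (a', b))"
    and "a \<in> Obj A \<Longrightarrow> t (a, Zero B) \<cdot>\<^bsub>C\<^esub> bzl H a = bzl J a"
    and "b \<in> Obj B \<Longrightarrow> t (Zero A, b) \<cdot>\<^bsub>C\<^esub> bzr H b = bzr J b"
proof -
  show H: "bilinear A B C H" and "bilinear A B C J"
    using t by (simp_all add: bil_trans_def)
  interpret H: bilinear A B C H by fact
  note n = nat_transD [OF bil_trans_nat_trans [OF t]]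
  show "t \<in> extensional (Obj A \<times> Obj B)" using n(3) by simp
  show "\<lbrakk>a \<in> Obj A; b \<in> Obj B\<rbrakk> \<Longrightarrow> t (a, b) \<in> Arr C"
    "\<lbrakk>a \<in> Obj A; b \<in> Obj B\<rbrakk> \<Longrightarrow> Dom C (t (a, b)) = fob H (a, b)"
    "\<lbrakk>a \<in> Obj A; b \<in> Obj B\<rbrakk> \<Longrightarrow> Cod C (t (a, b)) = fob J (a, b)"
    using n(4-6) [of "(a, b)"] by simp_all
  show "\<lbrakk>f \<in> Arr A; g \<in> Arr B\<rbrakk> \<Longrightarrow>
      far J (f, g) \<cdot>\<^bsub>C\<^esub> t (Dom A f, Dom B g) = t (Cod A f, Cod B g) \<cdot>\<^bsub>C\<^esub> far H (f, g)"
    using n(7) [of "(f, g)"] by simp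
  have l: "sm_trans B C (fix_left A B H a) (fix_left A B J a) (\<lambda>b\<in>Obj B. t (a, b))" if "a \<in> Obj A" for a
    using t that by (simp add: bil_trans_def)
  have r: "sm_trans A C (fix_right A B H b) (fix_right A B J b) (\<lambda>a\<in>Obj A. t (a, b))" if "b \<in> Obj B" for b
    using t that by (simp add: bil_trans_def)
  show "\<lbrakk>a \<in> Obj A; b \<in> Obj B; b' \<in> Obj B\<rbrakk> \<Longrightarrow>
      t (a, b \<oplus>\<^bsub>B\<^esub> b') \<cdot>\<^bsub>C\<^esub> bdl H (a, b, b') = bdl J (a, b, b') \<cdot>\<^bsub>C\<^esub> (t (a, b) \<boxplus>\<^bsub>C\<^esub> t (a, b'))"
    using sm_transD(8) [OF l, of a b b'] by simp
  show "\<lbrakk>a \<in> Obj A; a' \<in> Obj A; b \<in> Obj B\<rbrakk> \<Longrightarrow>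
      t (a \<oplus>\<^bsub>A\<^esub> a', b) \<cdot>\<^bsub>C\<^esub> bdr H (a, a', b) = bdr J (a, a', b) \<cdot>\<^bsub>C\<^esub> (t (a, b) \<boxplus>\<^bsub>C\<^esub> t (a', b))"
    using sm_transD(8) [OF r, of b a a'] by simp
  show "a \<in> Obj A \<Longrightarrow> t (a, Zero B) \<cdot>\<^bsub>C\<^esub> bzl H a = bzl J a"
    using sm_transD(9) [OF l, of a] by simp
  show "b \<in> Obj B \<Longrightarrow> t (Zero A, b) \<cdot>\<^bsub>C\<^esub> bzr H b = bzr J b"
    using sm_transD(9) [OF r, of b] by simp
qed

lemma bil_trans_ide:
  assumes "bilinear A B C H"
  shows "bil_trans A B C H H (\<lambda>x\<in>Obj A \<times> Obj B. Ide C (fob H x))"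
proof -
  interpret bilinear A B C H by fact
  show ?thesis
    by (rule bil_transI) (auto simp: hom_iff bilinear_axioms)
qed

lemma bil_trans_vcomp:
  assumes t: "bil_trans A B C H J t" and s: "bil_trans A B C J K s"
  shows "bil_trans A B C H K (\<lambda>x\<in>Obj A \<times> Obj B. s x \<cdot>\<^bsub>C\<^esub> t x)"
proof -
  interpret H: bilinear A B C H by (rule bil_transD(1) [OF t])
  interpret J: bilinear A B C J by (rule bil_transD(1) [OF s])
  interpret K: bilinear A B C K by (rule bil_transD(2) [OF s])
  note [simp] = bil_transD(4-6) [OF t] bil_transD(4-6) [OF s]
  note sq = H.cod.cmp_square_extend
  show ?thesis
  proof (rule bil_transI)
    fix f g assume [simp]: "f \<in> Arr A" "g \<in> Arr B"
    note e1 = bil_transD(7) [OF t, of f g] and e2 = bil_transD(7) [OF s, of f g]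
    show "far K (f, g) \<cdot>\<^bsub>C\<^esub> (\<lambda>x\<in>Obj A \<times> Obj B. s x \<cdot>\<^bsub>C\<^esub> t x) (Dom A f, Dom B g) =
        (\<lambda>x\<in>Obj A \<times> Obj B. s x \<cdot>\<^bsub>C\<^esub> t x) (Cod A f, Cod B g) \<cdot>\<^bsub>C\<^esub> far H (f, g)"
      by (simp add: e1 sq [OF e2])
  next
    fix a b b' assume [simp]: "a \<in> Obj A" "b \<in> Obj B" "b' \<in> Obj B"
    note e1 = bil_transD(8) [OF t, of a b b'] and e2 = bil_transD(8) [OF s, of a b b']
    show "(\<lambda>x\<in>Obj A \<times> Obj B. s x \<cdot>\<^bsub>C\<^esub> t x) (a, b \<oplus>\<^bsub>B\<^esub> b') \<cdot>\<^bsub>C\<^esub> bdl H (a, b, b') = bdl K (a, b, b') \<cdot>\<^bsub>C\<^esub>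
        ((\<lambda>x\<in>Obj A \<times> Obj B. s x \<cdot>\<^bsub>C\<^esub> t x) (a, b) \<boxplus>\<^bsub>C\<^esub> (\<lambda>x\<in>Obj A \<times> Obj B. s x \<cdot>\<^bsub>C\<^esub> t x) (a, b'))"
      by (simp add: H.cod.plus_cmp_arr e1 sq [OF e2])
  next
    fix a a' b assume [simp]: "a \<in> Obj A" "a' \<in> Obj A" "b \<in> Obj B"
    note e1 = bil_transD(9) [OF t, of a a' b] and e2 = bil_transD(9) [OF s, of a a' b]
    show "(\<lambda>x\<in>Obj A \<times> Obj B. s x \<cdot>\<^bsub>C\<^esub> t x) (a \<oplus>\<^bsub>A\<^esub> a', b) \<cdot>\<^bsub>C\<^esub> bdr H (a, a', b) = bdr K (a, a', b) \<cdot>\<^bsub>C\<^esub>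
        ((\<lambda>x\<in>Obj A \<times> Obj B. s x \<cdot>\<^bsub>C\<^esub> t x) (a, b) \<boxplus>\<^bsub>C\<^esub> (\<lambda>x\<in>Obj A \<times> Obj B. s x \<cdot>\<^bsub>C\<^esub> t x) (a', b))"
      by (simp add: H.cod.plus_cmp_arr e1 sq [OF e2])
  qed (auto simp: hom_iff bil_transD(10,11) [OF t] bil_transD(10,11) [OF s] H.bilinear_axioms K.bilinear_axioms)
qed

text \<open>A constraint of \<open>H(P-, Q-)\<close> consists of a constraint of \<open>H\<close>
  followed by an image under \<open>H\<close>: \<open>t\<close> crosses the image by naturality and
  the constraint of \<open>H\<close> by its own compatibility.\<close>

lemma bil_trans_pre:
  assumes P: "sm_functor A' A P" and Q: "sm_functor B' B Q" and t: "bil_trans A B C H J t"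
  shows "bil_trans A' B' C (bil_pre A' B' A B C P Q H) (bil_pre A' B' A B C P Q J)
    (\<lambda>(a, b)\<in>Obj A' \<times> Obj B'. t (fob P a, fob Q b))" (is "bil_trans A' B' C ?H ?J ?t")
proof -
  interpret P: sm_functor A' A P by fact
  interpret Q: sm_functor B' B Q by fact
  interpret H: bilinear A B C H by (rule bil_transD(1) [OF t])
  interpret J: bilinear A B C J by (rule bil_transD(2) [OF t])
  note [simp] = bil_transD(4-6) [OF t]
  note sq = H.cod.cmp_square_extend
  show ?thesis
  proof (rule bil_transI)
    fix f g assume [simp]: "f \<in> Arr A'" "g \<in> Arr B'"
    show "far ?J (f, g) \<cdot>\<^bsub>C\<^esub> ?t (Dom A' f, Dom B' g) = ?t (Cod A' f, Cod B' g) \<cdot>\<^bsub>C\<^esub> far ?H (f, g)"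
      using bil_transD(7) [OF t, of "far P f" "far Q g"] by simp
  next
    fix a b b' assume [simp]: "a \<in> Obj A'" "b \<in> Obj B'" "b' \<in> Obj B'"
    have e: "t (fob P a, fob Q (b \<oplus>\<^bsub>B'\<^esub> b')) \<cdot>\<^bsub>C\<^esub> far H (Ide A (fob P a), cst2 Q (b, b')) =
        far J (Ide A (fob P a), cst2 Q (b, b')) \<cdot>\<^bsub>C\<^esub> t (fob P a, fob Q b \<oplus>\<^bsub>B\<^esub> fob Q b')"
      using bil_transD(7) [OF t, of "Ide A (fob P a)" "cst2 Q (b, b')"] by simp
    show "?t (a, b \<oplus>\<^bsub>B'\<^esub> b') \<cdot>\<^bsub>C\<^esub> bdl ?H (a, b, b') = bdl ?J (a, b, b') \<cdot>\<^bsub>C\<^esub> (?t (a, b) \<boxplus>\<^bsub>C\<^esub> ?t (a, b'))"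
      by (simp add: sq [OF e] bil_transD(8) [OF t])
  next
    fix a a' b assume [simp]: "a \<in> Obj A'" "a' \<in> Obj A'" "b \<in> Obj B'"
    have e: "t (fob P (a \<oplus>\<^bsub>A'\<^esub> a'), fob Q b) \<cdot>\<^bsub>C\<^esub> far H (cst2 P (a, a'), Ide B (fob Q b)) =
        far J (cst2 P (a, a'), Ide B (fob Q b)) \<cdot>\<^bsub>C\<^esub> t (fob P a \<oplus>\<^bsub>A\<^esub> fob P a', fob Q b)"
      using bil_transD(7) [OF t, of "cst2 P (a, a')" "Ide B (fob Q b)"] by simp
    show "?t (a \<oplus>\<^bsub>A'\<^esub> a', b) \<cdot>\<^bsub>C\<^esub> bdr ?H (a, a', b) = bdr ?J (a, a', b) \<cdot>\<^bsub>C\<^esub> (?t (a, b) \<boxplus>\<^bsub>C\<^esub> ?t (a', b))"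
      by (simp add: sq [OF e] bil_transD(9) [OF t])
  next
    fix a assume [simp]: "a \<in> Obj A'"
    have e: "t (fob P a, fob Q (Zero B')) \<cdot>\<^bsub>C\<^esub> far H (Ide A (fob P a), cst0 Q) =
        far J (Ide A (fob P a), cst0 Q) \<cdot>\<^bsub>C\<^esub> t (fob P a, Zero B)"
      using bil_transD(7) [OF t, of "Ide A (fob P a)" "cst0 Q"] by simp
    show "?t (a, Zero B') \<cdot>\<^bsub>C\<^esub> bzl ?H a = bzl ?J a"
      by (simp add: sq [OF e] bil_transD(10) [OF t])
  next
    fix b assume [simp]: "b \<in> Obj B'"
    have e: "t (fob P (Zero A'), fob Q b) \<cdot>\<^bsub>C\<^esub> far H (cst0 P, Ide B (fob Q b)) =
        far J (cst0 P, Ide B (fob Q b)) \<cdot>\<^bsub>C\<^esub> t (Zero A, fob Q b)"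
      using bil_transD(7) [OF t, of "cst0 P" "Ide B (fob Q b)"] by simp
    show "?t (Zero A', b) \<cdot>\<^bsub>C\<^esub> bzr ?H b = bzr ?J b"
      by (simp add: sq [OF e] bil_transD(11) [OF t])
  qed (auto simp: hom_iff intro: bilinear_pre P Q H.bilinear_axioms J.bilinear_axioms)
qed

lemma bil_trans_post:
  assumes R: "strict_sm_functor C C' R" and t: "bil_trans A B C H J t"
  shows "bil_trans A B C' (bil_post A B C' R H) (bil_post A B C' R J)
    (\<lambda>(a, b)\<in>Obj A \<times> Obj B. far R (t (a, b)))" (is "bil_trans A B C' ?H ?J ?t")
proof -
  interpret R: strict_sm_functor C C' R by fact
  interpret H: bilinear A B C H by (rule bil_transD(1) [OF t])
  interpret J: bilinear A B C J by (rule bil_transD(2) [OF t])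
  note [simp] = bil_transD(4-6) [OF t]
  show ?thesis
  proof (rule bil_transI)
    fix f g assume [simp]: "f \<in> Arr A" "g \<in> Arr B"
    show "far ?J (f, g) \<cdot>\<^bsub>C'\<^esub> ?t (Dom A f, Dom B g) = ?t (Cod A f, Cod B g) \<cdot>\<^bsub>C'\<^esub> far ?H (f, g)"
      using arg_cong [OF bil_transD(7) [OF t, of f g], of "far R"] by simp
  next
    fix a b b' assume [simp]: "a \<in> Obj A" "b \<in> Obj B" "b' \<in> Obj B"
    show "?t (a, b \<oplus>\<^bsub>B\<^esub> b') \<cdot>\<^bsub>C'\<^esub> bdl ?H (a, b, b') = bdl ?J (a, b, b') \<cdot>\<^bsub>C'\<^esub> (?t (a, b) \<boxplus>\<^bsub>C'\<^esub> ?t (a, b'))"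
      using arg_cong [OF bil_transD(8) [OF t, of a b b'], of "far R"] by simp
  next
    fix a a' b assume [simp]: "a \<in> Obj A" "a' \<in> Obj A" "b \<in> Obj B"
    show "?t (a \<oplus>\<^bsub>A\<^esub> a', b) \<cdot>\<^bsub>C'\<^esub> bdr ?H (a, a', b) = bdr ?J (a, a', b) \<cdot>\<^bsub>C'\<^esub> (?t (a, b) \<boxplus>\<^bsub>C'\<^esub> ?t (a', b))"
      using arg_cong [OF bil_transD(9) [OF t, of a a' b], of "far R"] by simp
  next
    fix a assume [simp]: "a \<in> Obj A"
    show "?t (a, Zero B) \<cdot>\<^bsub>C'\<^esub> bzl ?H a = bzl ?J a"
      using arg_cong [OF bil_transD(10) [OF t, of a], of "far R"] by simp
  next
    fix b assume [simp]: "b \<in> Obj B"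
    show "?t (Zero A, b) \<cdot>\<^bsub>C'\<^esub> bzr ?H b = bzr ?J b"
      using arg_cong [OF bil_transD(11) [OF t, of b], of "far R"] by simp
  qed (auto simp: hom_iff intro: bilinear_post R H.bilinear_axioms J.bilinear_axioms)
qed

text \<open>Naturality of the constraints of \<open>H\<close> at the arrows \<open>p a\<close> and
  \<open>q b\<close> reduces each condition to monoidality of \<open>p\<close> or \<open>q\<close>
  inside one variable of \<open>H\<close>.\<close>

lemma bil_trans_pre_trans:
  assumes p: "sm_trans A' A P P' p" and q: "sm_trans B' B Q Q' q" and "bilinear A B C H"
  shows "bil_trans A' B' C (bil_pre A' B' A B C P Q H) (bil_pre A' B' A B C P' Q' H)
    (\<lambda>(a, b)\<in>Obj A' \<times> Obj B'. far H (p a, q b))" (is "bil_trans A' B' C ?H ?J ?t")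
proof -
  interpret P: sm_functor A' A P by (rule sm_transD(1) [OF p])
  interpret P': sm_functor A' A P' by (rule sm_transD(2) [OF p])
  interpret Q: sm_functor B' B Q by (rule sm_transD(1) [OF q])
  interpret Q': sm_functor B' B Q' by (rule sm_transD(2) [OF q])
  interpret H: bilinear A B C H by fact
  note [simp] = sm_transD(4-6) [OF p] sm_transD(4-6) [OF q]
  show ?thesis
  proof (rule bil_transI)
    fix f g assume [simp]: "f \<in> Arr A'" "g \<in> Arr B'"
    show "far ?J (f, g) \<cdot>\<^bsub>C\<^esub> ?t (Dom A' f, Dom B' g) = ?t (Cod A' f, Cod B' g) \<cdot>\<^bsub>C\<^esub> far ?H (f, g)"
      by (simp add: H.far_merge sm_transD(7) [OF p] sm_transD(7) [OF q])
  next
    fix a b b' assume [simp]: "a \<in> Obj A'" "b \<in> Obj B'" "b' \<in> Obj B'"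
    show "?t (a, b \<oplus>\<^bsub>B'\<^esub> b') \<cdot>\<^bsub>C\<^esub> bdl ?H (a, b, b') = bdl ?J (a, b, b') \<cdot>\<^bsub>C\<^esub> (?t (a, b) \<boxplus>\<^bsub>C\<^esub> ?t (a, b'))"
      using H.bdl_nat [of "p a" "q b" "q b'", symmetric]
      by (simp add: H.far_merge_extend sm_transD(8) [OF q])
  next
    fix a a' b assume [simp]: "a \<in> Obj A'" "a' \<in> Obj A'" "b \<in> Obj B'"
    show "?t (a \<oplus>\<^bsub>A'\<^esub> a', b) \<cdot>\<^bsub>C\<^esub> bdr ?H (a, a', b) = bdr ?J (a, a', b) \<cdot>\<^bsub>C\<^esub> (?t (a, b) \<boxplus>\<^bsub>C\<^esub> ?t (a', b))"
      using H.bdr_nat [of "p a" "p a'" "q b", symmetric]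
      by (simp add: H.far_merge_extend sm_transD(8) [OF p])
  next
    fix a assume [simp]: "a \<in> Obj A'"
    show "?t (a, Zero B') \<cdot>\<^bsub>C\<^esub> bzl ?H a = bzl ?J a"
      using H.bzl_nat [of "p a", symmetric]
      by (simp add: H.far_merge_extend sm_transD(9) [OF q])
  next
    fix b assume [simp]: "b \<in> Obj B'"
    show "?t (Zero A', b) \<cdot>\<^bsub>C\<^esub> bzr ?H b = bzr ?J b"
      using H.bzr_nat [of "q b", symmetric]
      by (simp add: H.far_merge_extend sm_transD(9) [OF p])
  qed (auto simp: hom_iff intro: bilinear_pre sm_transD(1,2) [OF p] sm_transD(1,2) [OF q] H.bilinear_axioms)
qed

text \<open>Between strict functors \<open>r\<close> is additive and is the identity at zero. Hence
  compatibility with a constraint of \<open>H\<close> is naturality of \<open>r\<close> at that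
  constraint.\<close>

lemma bil_trans_post_trans:
  assumes "strict_sm_functor C C' R" "strict_sm_functor C C' R'" and r: "sm_trans C C' R R' r"
    and "bilinear A B C H"
  shows "bil_trans A B C' (bil_post A B C' R H) (bil_post A B C' R' H)
    (\<lambda>(a, b)\<in>Obj A \<times> Obj B. r (fob H (a, b)))" (is "bil_trans A B C' ?H ?J ?t")
proof -
  interpret R: strict_sm_functor C C' R by fact
  interpret R': strict_sm_functor C C' R' by fact
  interpret H: bilinear A B C H by fact
  note [simp] = sm_transD(4-6) [OF r]
  have zero [simp]: "r (Zero C) = Ide C' (Zero C')"
    using sm_transD(9) [OF r] by simp
  have plus [simp]: "r (x \<oplus>\<^bsub>C\<^esub> y) = r x \<boxplus>\<^bsub>C'\<^esub> r y" if "x \<in> Obj C" "y \<in> Obj C" for x y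
    using sm_transD(8) [OF r, of x y] that by simp
  show ?thesis
  proof (rule bil_transI)
    fix f g assume [simp]: "f \<in> Arr A" "g \<in> Arr B"
    show "far ?J (f, g) \<cdot>\<^bsub>C'\<^esub> ?t (Dom A f, Dom B g) = ?t (Cod A f, Cod B g) \<cdot>\<^bsub>C'\<^esub> far ?H (f, g)"
      using sm_transD(7) [OF r, of "far H (f, g)"] by simp
  next
    fix a b b' assume [simp]: "a \<in> Obj A" "b \<in> Obj B" "b' \<in> Obj B"
    show "?t (a, b \<oplus>\<^bsub>B\<^esub> b') \<cdot>\<^bsub>C'\<^esub> bdl ?H (a, b, b') = bdl ?J (a, b, b') \<cdot>\<^bsub>C'\<^esub> (?t (a, b) \<boxplus>\<^bsub>C'\<^esub> ?t (a, b'))"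
      using sm_transD(7) [OF r, of "bdl H (a, b, b')"] by simp
  next
    fix a a' b assume [simp]: "a \<in> Obj A" "a' \<in> Obj A" "b \<in> Obj B"
    show "?t (a \<oplus>\<^bsub>A\<^esub> a', b) \<cdot>\<^bsub>C'\<^esub> bdr ?H (a, a', b) = bdr ?J (a, a', b) \<cdot>\<^bsub>C'\<^esub> (?t (a, b) \<boxplus>\<^bsub>C'\<^esub> ?t (a', b))"
      using sm_transD(7) [OF r, of "bdr H (a, a', b)"] by simp
  next
    fix a assume [simp]: "a \<in> Obj A"
    show "?t (a, Zero B) \<cdot>\<^bsub>C'\<^esub> bzl ?H a = bzl ?J a"
      using sm_transD(7) [OF r, of "bzl H a"] by simp
  next
    fix b assume [simp]: "b \<in> Obj B"
    show "?t (Zero A, b) \<cdot>\<^bsub>C'\<^esub> bzr ?H b = bzr ?J b"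
      using sm_transD(7) [OF r, of "bzr H b"] by simp
  qed (auto simp: hom_iff intro: bilinear_post R.strict_sm_functor_axioms R'.strict_sm_functor_axioms
      H.bilinear_axioms)
qed

lemma trans_family_Bilin:
  assumes "permutative A" "permutative B" "permutative C"
  shows "trans_family (prod_cat A B) C {H. bilinear A B C H} (bil_trans A B C)"
proof -
  interpret A: permutative A by fact
  interpret B: permutative B by fact
  interpret C: permutative C by fact
  show ?thesis
    by (intro trans_family.intro trans_family_axioms.intro category_prod_cat
        A.category_axioms B.category_axioms C.category_axioms)
      (auto intro: bil_trans_nat_trans bil_trans_ide bil_trans_vcomp simp: bilinear_def)
qed

section \<open>The universal bilinear map\<close>

lemma tbeta1_typing [simp]:
  "tsrc A B (tbeta1 p ys) = p # ys"
  "ttgt A B (tbeta1 p ys) = ys @ [p]"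
  "\<lbrakk>p \<in> Obj A \<times> Obj B; ys \<in> lists (Obj A \<times> Obj B)\<rbrakk> \<Longrightarrow> twf A B (tbeta1 p ys)"
  by (induction ys) auto

lemma tbeta_typing [simp]:
  "tsrc A B (tbeta xs ys) = xs @ ys"
  "ttgt A B (tbeta xs ys) = ys @ xs"
  "\<lbrakk>xs \<in> lists (Obj A \<times> Obj B); ys \<in> lists (Obj A \<times> Obj B)\<rbrakk> \<Longrightarrow> twf A B (tbeta xs ys)"
  by (induction xs) auto

section \<open>The permutative category of formal expressions\<close>

locale tensor_factors = A: permutative A + B: permutative B
  for A :: "('oa, 'ma) perm" and B :: "('ob, 'mb) perm"
begin

abbreviation wf where "wf \<equiv> twf A B"
abbreviation src where "src \<equiv> tsrc A B"
abbreviation tgt where "tgt \<equiv> ttgt A B"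
abbreviation cls where "cls \<equiv> tcls A B"
abbreviation T where "T \<equiv> A \<otimes> B"

lemma gen_typing [simp]:
  "gwf A B e \<Longrightarrow> gsrc e \<in> lists (Obj A \<times> Obj B)"
  "gwf A B e \<Longrightarrow> gtgt A B e \<in> lists (Obj A \<times> Obj B)"
  by (cases e; auto)+

lemma src_tgt_obj:
  "wf t \<Longrightarrow> src t \<in> lists (Obj A \<times> Obj B) \<and> tgt t \<in> lists (Obj A \<times> Obj B)"
  by (induction t) auto

text \<open>Makes source and target depend on the class only, and guarantees that a chosen
  representative can stand wherever the original term could.\<close>

lemma teq_typing: "teq A B t s \<Longrightarrow> wf t \<and> wf s \<and> src t = src s \<and> tgt t = tgt s"
  by (induction rule: teq.induct) (auto simp: thom_def hom_iff src_tgt_obj)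

lemma equiv_teq: "equiv {t. wf t} (teq_rel A B)"
  by (rule equivI)
    (auto simp: teq_rel_def refl_on_def sym_def trans_def dest: teq_typing
      intro: teq.refl teq.sym teq.trans)

lemma tcls_eqI: "teq A B t s \<Longrightarrow> cls t = cls s"
  unfolding tcls_def by (rule equiv_class_eq [OF equiv_teq]) (simp add: teq_rel_def)

lemma trep_teq: "wf t \<Longrightarrow> teq A B t (trep (cls t))"
proof -
  assume "wf t"
  then have "t \<in> cls t"
    by (auto simp: tcls_def teq_rel_def intro: teq.refl)
  then have "trep (cls t) \<in> cls t"
    unfolding trep_def by (rule someI)
  then show ?thesis
    by (simp add: tcls_def teq_rel_def)
qed

lemma trep_typing [simp]:
  assumes "wf t"
  shows "wf (trep (cls t))" "src (trep (cls t)) = src t" "tgt (trep (cls t)) = tgt t"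
  using teq_typing [OF trep_teq [OF assms]] by simp_all

lemma tensor_fields:
  "Obj T = lists (Obj A \<times> Obj B)"
  "Zero T = []"
  "Plus T = (@)"
  "Ide T xs = cls (TId xs)"
  "Beta T xs ys = cls (tbeta xs ys)"
  by (simp_all add: tensor_def)

lemma arr_tensor: "X \<in> Arr T \<longleftrightarrow> (\<exists>t. wf t \<and> X = cls t)"
  by (auto simp: tensor_def quotient_def tcls_def)

lemma tcls_simps [simp]:
  assumes "wf t"
  shows "cls t \<in> Arr T" "Dom T (cls t) = src t" "Cod T (cls t) = tgt t"
  using assms by (auto simp: arr_tensor) (simp_all add: tensor_def)

text \<open>The operations of \<open>A \<otimes> B\<close> act on representatives picked by
  \<open>trep\<close>. The congruence rules of \<open>teq\<close> make that choice irrelevant, so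
  \<open>tcls\<close> respects the operations.\<close>

lemma tcls_comp:
  assumes "wf t" "wf s" "tgt s = src t"
  shows "cls (t \<circ>\<^sub>t s) = cls t \<cdot>\<^bsub>T\<^esub> cls s"
proof -
  have "cls t \<cdot>\<^bsub>T\<^esub> cls s = cls (trep (cls t) \<circ>\<^sub>t trep (cls s))"
    by (simp add: tensor_def)
  also have "\<dots> = cls (t \<circ>\<^sub>t s)"
    using assms by (intro tcls_eqI teq.comp_cong teq.sym [OF trep_teq]) auto
  finally show ?thesis ..
qed

lemma tcls_plus:
  assumes "wf t" "wf s"
  shows "cls (t +\<^sub>t s) = cls t \<boxplus>\<^bsub>T\<^esub> cls s"
proof -
  have "cls t \<boxplus>\<^bsub>T\<^esub> cls s = cls (trep (cls t) +\<^sub>t trep (cls s))"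
    by (simp add: tensor_def)
  also have "\<dots> = cls (t +\<^sub>t s)"
    using assms by (intro tcls_eqI teq.plus_cong teq.sym [OF trep_teq]) auto
  finally show ?thesis ..
qed

lemma hom_tensor: "X \<in> hom T xs ys \<longleftrightarrow> (\<exists>t \<in> thom A B xs ys. X = cls t)"
  by (auto simp: hom_iff arr_tensor thom_def)

text \<open>Each axiom that is not mere typing is one rule of \<open>teq\<close>, read on
  classes.\<close>

lemma permutative_tensor: "permutative T"
proof -
  \<comment> \<open>Oriented so that a composite or sum of classes is gathered into the class of one
    term, to which a rule of \<open>teq\<close> applies.\<close>
  note rules = tcls_comp [symmetric] tcls_plus [symmetric] tensor_fields
  show ?thesis
  proof
    fix f assume "f \<in> Arr T"
    then obtain t where "wf t" "f = cls t" by (auto simp: arr_tensor)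
    then show "Dom T f \<in> Obj T" "Cod T f \<in> Obj T"
      using src_tgt_obj [of t] by (simp_all add: tensor_fields)
  next
    fix x assume "x \<in> Obj T" then show "Ide T x \<in> hom T x x"
      by (auto simp: hom_iff tensor_fields)
  next
    fix f g x y z assume "f \<in> hom T x y" "g \<in> hom T y z"
    then obtain t s where "t \<in> thom A B x y" "f = cls t" "s \<in> thom A B y z" "g = cls s"
      by (auto simp: hom_tensor)
    then show "g \<cdot>\<^bsub>T\<^esub> f \<in> hom T x z"
      by (auto simp: hom_iff thom_def rules)
  next
    fix f x y assume "f \<in> hom T x y"
    then obtain t where t: "t \<in> thom A B x y" "f = cls t" by (auto simp: hom_tensor)
    show "f \<cdot>\<^bsub>T\<^esub> Ide T x = f"
      using t tcls_eqI [OF teq.id_right [OF t(1)]] src_tgt_obj [of t] by (auto simp: rules thom_def)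
    show "Ide T y \<cdot>\<^bsub>T\<^esub> f = f"
      using t tcls_eqI [OF teq.id_left [OF t(1)]] src_tgt_obj [of t] by (auto simp: rules thom_def)
  next
    fix f g h w x y z assume "f \<in> hom T w x" "g \<in> hom T x y" "h \<in> hom T y z"
    then obtain t s r where t: "t \<in> thom A B w x" "f = cls t" "s \<in> thom A B x y" "g = cls s"
      "r \<in> thom A B y z" "h = cls r" by (auto simp: hom_tensor)
    show "(h \<cdot>\<^bsub>T\<^esub> g) \<cdot>\<^bsub>T\<^esub> f = h \<cdot>\<^bsub>T\<^esub> (g \<cdot>\<^bsub>T\<^esub> f)"
      using t tcls_eqI [OF teq.comp_assoc [OF t(1,3,5)]] by (auto simp: rules thom_def)
  next
    fix f g x y z w assume "f \<in> hom T x y" "g \<in> hom T z w"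
    then obtain t s where "t \<in> thom A B x y" "f = cls t" "s \<in> thom A B z w" "g = cls s"
      by (auto simp: hom_tensor)
    then show "f \<boxplus>\<^bsub>T\<^esub> g \<in> hom T (x \<oplus>\<^bsub>T\<^esub> z) (y \<oplus>\<^bsub>T\<^esub> w)"
      by (auto simp: hom_iff thom_def rules)
  next
    fix x y assume xy: "x \<in> Obj T" "y \<in> Obj T"
    then have xy': "x \<in> lists (Obj A \<times> Obj B)" "y \<in> lists (Obj A \<times> Obj B)"
      by (simp_all add: tensor_fields)
    show "Ide T x \<boxplus>\<^bsub>T\<^esub> Ide T y = Ide T (x \<oplus>\<^bsub>T\<^esub> y)"
      using xy' tcls_eqI [OF teq.plus_id [OF xy']] by (auto simp: rules)
    show "Beta T x y \<in> hom T (x \<oplus>\<^bsub>T\<^esub> y) (y \<oplus>\<^bsub>T\<^esub> x)"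
      using xy' by (auto simp: rules hom_iff)
    show "Beta T y x \<cdot>\<^bsub>T\<^esub> Beta T x y = Ide T (x \<oplus>\<^bsub>T\<^esub> y)"
      using xy' tcls_eqI [OF teq.beta_inv [OF xy']] by (simp add: rules)
  next
    fix f f' g g' x y z u v w
    assume "f \<in> hom T x y" "f' \<in> hom T y z" "g \<in> hom T u v" "g' \<in> hom T v w"
    then obtain t t' s s' where t: "t \<in> thom A B x y" "f = cls t" "t' \<in> thom A B y z" "f' = cls t'"
      "s \<in> thom A B u v" "g = cls s" "s' \<in> thom A B v w" "g' = cls s'" by (auto simp: hom_tensor)
    show "(f' \<cdot>\<^bsub>T\<^esub> f) \<boxplus>\<^bsub>T\<^esub> (g' \<cdot>\<^bsub>T\<^esub> g) = (f' \<boxplus>\<^bsub>T\<^esub> g') \<cdot>\<^bsub>T\<^esub> (f \<boxplus>\<^bsub>T\<^esub> g)"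
      using t tcls_eqI [OF teq.plus_comp [OF t(1,3,5,7)]] by (auto simp: rules thom_def)
  next
    fix f g h assume "f \<in> Arr T" "g \<in> Arr T" "h \<in> Arr T"
    then obtain t s r where t: "wf t" "f = cls t" "wf s" "g = cls s" "wf r" "h = cls r"
      by (auto simp: arr_tensor)
    show "(f \<boxplus>\<^bsub>T\<^esub> g) \<boxplus>\<^bsub>T\<^esub> h = f \<boxplus>\<^bsub>T\<^esub> (g \<boxplus>\<^bsub>T\<^esub> h)"
      using t tcls_eqI [OF teq.plus_assoc [OF t(1,3,5)]] by (auto simp: rules)
  next
    fix f assume "f \<in> Arr T"
    then obtain t where t: "wf t" "f = cls t"
      by (auto simp: arr_tensor)
    show "Ide T (Zero T) \<boxplus>\<^bsub>T\<^esub> f = f"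
      using t tcls_eqI [OF teq.zero_left [OF t(1)]] by (auto simp: rules)
    show "f \<boxplus>\<^bsub>T\<^esub> Ide T (Zero T) = f"
      using t tcls_eqI [OF teq.zero_right [OF t(1)]] by (auto simp: rules)
  next
    fix f g x x' y y' assume "f \<in> hom T x x'" "g \<in> hom T y y'"
    then obtain t s where t: "t \<in> thom A B x x'" "f = cls t" "s \<in> thom A B y y'" "g = cls s"
      by (auto simp: hom_tensor)
    show "Beta T x' y' \<cdot>\<^bsub>T\<^esub> (f \<boxplus>\<^bsub>T\<^esub> g) = (g \<boxplus>\<^bsub>T\<^esub> f) \<cdot>\<^bsub>T\<^esub> Beta T x y"
      using t tcls_eqI [OF teq.beta_natural [OF t(1,3)]] src_tgt_obj [of t] src_tgt_obj [of s]
      by (auto simp: rules thom_def)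
  next
    fix x y z assume "x \<in> Obj T" "y \<in> Obj T" "z \<in> Obj T"
    then have xyz: "x \<in> lists (Obj A \<times> Obj B)" "y \<in> lists (Obj A \<times> Obj B)" "z \<in> lists (Obj A \<times> Obj B)"
      by (simp_all add: tensor_fields)
    show "Beta T x (y \<oplus>\<^bsub>T\<^esub> z) = (Ide T y \<boxplus>\<^bsub>T\<^esub> Beta T x z) \<cdot>\<^bsub>T\<^esub> (Beta T x y \<boxplus>\<^bsub>T\<^esub> Ide T z)"
      using xyz tcls_eqI [OF teq.beta_plus [OF xyz]] by (simp add: rules)
  qed (auto simp: tensor_fields)
qed

sublocale T: permutative T
  by (rule permutative_tensor)

text \<open>The orientation is now the reverse of the one used to build the structure: the class of
  a term is split into operations of \<open>A \<otimes> B\<close>, so that further calculations take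
  place in a permutative category.\<close>

lemma tensor_simps [simp]:
  "Obj T = lists (Obj A \<times> Obj B)"
  "Zero T = []"
  "Plus T = (@)"
  "cls (TId xs) = Ide T xs"
  "wf (t \<circ>\<^sub>t s) \<Longrightarrow> cls (t \<circ>\<^sub>t s) = cls t \<cdot>\<^bsub>T\<^esub> cls s"
  "wf (t +\<^sub>t s) \<Longrightarrow> cls (t +\<^sub>t s) = cls t \<boxplus>\<^bsub>T\<^esub> cls s"
  by (simp_all add: tensor_fields tcls_comp tcls_plus)

lemma inverse_arrs_gen: "gwf A B e \<Longrightarrow> inverse_arrs T (cls (TGen e)) (cls (TInv e))"
  using tcls_eqI [OF teq.inv_left, of e] tcls_eqI [OF teq.inv_right, of e]
  by (simp add: inverse_arrs_def hom_iff)

lemma is_iso_gen [simp]: "gwf A B e \<Longrightarrow> is_iso T (cls (TGen e))"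
  unfolding is_iso_def by (rule exI) (rule inverse_arrs_gen)

lemma tcls_inv: "gwf A B e \<Longrightarrow> cls (TInv e) = inv_arr T (cls (TGen e))"
  using T.inv_arr_eqI [OF inverse_arrs_gen] by simp

lemma dot_ide [simp]: "\<lbrakk>a \<in> Obj A; b \<in> Obj B\<rbrakk> \<Longrightarrow> cls (TDot (Ide A a) (Ide B b)) = Ide T [(a, b)]"
  using tcls_eqI [OF teq.dot_id] by simp

lemma dot_merge:
  "\<lbrakk>f \<in> Arr A; f' \<in> Arr A; g \<in> Arr B; g' \<in> Arr B; Cod A f = Dom A f'; Cod B g = Dom B g'\<rbrakk>
    \<Longrightarrow> cls (TDot f' g') \<cdot>\<^bsub>T\<^esub> cls (TDot f g) = cls (TDot (f' \<cdot>\<^bsub>A\<^esub> f) (g' \<cdot>\<^bsub>B\<^esub> g))"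
  using tcls_eqI [OF teq.dot_comp, of f "Dom A f" "Cod A f" f' "Cod A f'" g "Dom B g" "Cod B g" g' "Cod B g'"]
  by (simp add: hom_iff)

text \<open>On two singletons \<open>tbeta\<close> is the generator padded by identities and empty
  sums; strictness removes the padding.\<close>

lemma beta_single [simp]:
  assumes "p \<in> Obj A \<times> Obj B" "q \<in> Obj A \<times> Obj B"
  shows "Beta T [p] [q] = cls (TGen (Braid p q))"
proof -
  have "Beta T [p] [q] = cls (tbeta [p] [q])"
    by (simp only: tensor_fields)
  then show ?thesis
    using assms T.zero_right_arr [of "cls (TGen (Braid p q))"] T.plus_ide [of "[q]" "[p]"] T.plus_ide [of "[p]" "[q]"]
      T.zero_right_arr [of "Ide T [q,p]"] by simp
qed

section \<open>The universal bilinear map\<close>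

abbreviation u where "u \<equiv> tensor_univ A B"

lemma univ_simps [simp]:
  "\<lbrakk>a \<in> Obj A; b \<in> Obj B\<rbrakk> \<Longrightarrow> fob u (a, b) = [(a, b)]"
  "\<lbrakk>f \<in> Arr A; g \<in> Arr B\<rbrakk> \<Longrightarrow> far u (f, g) = cls (TDot f g)"
  "\<lbrakk>a \<in> Obj A; b \<in> Obj B; b' \<in> Obj B\<rbrakk> \<Longrightarrow> bdl u (a, b, b') = cls (TGen (DeltaL a b b'))"
  "\<lbrakk>a \<in> Obj A; a' \<in> Obj A; b \<in> Obj B\<rbrakk> \<Longrightarrow> bdr u (a, a', b) = cls (TGen (DeltaR a a' b))"
  "a \<in> Obj A \<Longrightarrow> bzl u a = cls (TGen (ZetaL a))"
  "b \<in> Obj B \<Longrightarrow> bzr u b = cls (TGen (ZetaR b))"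
  by (simp_all add: tensor_univ_def)

text \<open>The coherence conditions are the relations imposed on the generators
  \<open>DeltaL\<close> and \<open>ZetaL\<close>; only the symmetry has to be identified with a
  \<open>Braid\<close>, by \<open>beta_single\<close>.\<close>

lemma sm_functor_fix_left_univ:
  assumes [simp]: "a \<in> Obj A"
  shows "sm_functor B T (fix_left A B u a)"
proof
  fix f x y g z assume "f \<in> hom B x y" "g \<in> hom B y z"
  then show "far (fix_left A B u a) (g \<cdot>\<^bsub>B\<^esub> f) = far (fix_left A B u a) g \<cdot>\<^bsub>T\<^esub> far (fix_left A B u a) f"
    by (auto simp: hom_iff dot_merge)
next
  fix f x x' g y y' assume "f \<in> hom B x x'" "g \<in> hom B y y'"
  then show "far (fix_left A B u a) (f \<boxplus>\<^bsub>B\<^esub> g) \<cdot>\<^bsub>T\<^esub> cst2 (fix_left A B u a) (x, y) =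
      cst2 (fix_left A B u a) (x', y') \<cdot>\<^bsub>T\<^esub> (far (fix_left A B u a) f \<boxplus>\<^bsub>T\<^esub> far (fix_left A B u a) g)"
    using tcls_eqI [OF teq.deltaL_natural, of "Ide A a" a a f x x' g y y'] by (auto simp: hom_iff)
next
  fix x y z assume [simp]: "x \<in> Obj B" "y \<in> Obj B" "z \<in> Obj B"
  show "cst2 (fix_left A B u a) (x \<oplus>\<^bsub>B\<^esub> y, z) \<cdot>\<^bsub>T\<^esub> (cst2 (fix_left A B u a) (x, y) \<boxplus>\<^bsub>T\<^esub> Ide T (fob (fix_left A B u a) z)) =
      cst2 (fix_left A B u a) (x, y \<oplus>\<^bsub>B\<^esub> z) \<cdot>\<^bsub>T\<^esub> (Ide T (fob (fix_left A B u a) x) \<boxplus>\<^bsub>T\<^esub> cst2 (fix_left A B u a) (y, z))"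
    using tcls_eqI [OF teq.deltaL_assoc, of a x y z] by simp
next
  fix x assume [simp]: "x \<in> Obj B"
  show "cst2 (fix_left A B u a) (x, Zero B) \<cdot>\<^bsub>T\<^esub> (Ide T (fob (fix_left A B u a) x) \<boxplus>\<^bsub>T\<^esub> cst0 (fix_left A B u a)) =
      Ide T (fob (fix_left A B u a) x)"
    using tcls_eqI [OF teq.deltaL_unit_right, of a x] by simp
  show "cst2 (fix_left A B u a) (Zero B, x) \<cdot>\<^bsub>T\<^esub> (cst0 (fix_left A B u a) \<boxplus>\<^bsub>T\<^esub> Ide T (fob (fix_left A B u a) x)) =
      Ide T (fob (fix_left A B u a) x)"
    using tcls_eqI [OF teq.deltaL_unit_left, of a x] by simp
next
  fix x y assume [simp]: "x \<in> Obj B" "y \<in> Obj B"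
  show "far (fix_left A B u a) (Beta B x y) \<cdot>\<^bsub>T\<^esub> cst2 (fix_left A B u a) (x, y) =
      cst2 (fix_left A B u a) (y, x) \<cdot>\<^bsub>T\<^esub> Beta T (fob (fix_left A B u a) x) (fob (fix_left A B u a) y)"
    using tcls_eqI [OF teq.deltaL_symm, of a x y] by simp
qed (auto simp: fix_left_def hom_iff)

lemma sm_functor_fix_right_univ:
  assumes [simp]: "b \<in> Obj B"
  shows "sm_functor A T (fix_right A B u b)"
proof
  fix f x y g z assume "f \<in> hom A x y" "g \<in> hom A y z"
  then show "far (fix_right A B u b) (g \<cdot>\<^bsub>A\<^esub> f) = far (fix_right A B u b) g \<cdot>\<^bsub>T\<^esub> far (fix_right A B u b) f"
    by (auto simp: hom_iff dot_merge)
next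
  fix f x x' g y y' assume "f \<in> hom A x x'" "g \<in> hom A y y'"
  then show "far (fix_right A B u b) (f \<boxplus>\<^bsub>A\<^esub> g) \<cdot>\<^bsub>T\<^esub> cst2 (fix_right A B u b) (x, y) =
      cst2 (fix_right A B u b) (x', y') \<cdot>\<^bsub>T\<^esub> (far (fix_right A B u b) f \<boxplus>\<^bsub>T\<^esub> far (fix_right A B u b) g)"
    using tcls_eqI [OF teq.deltaR_natural, of f x x' g y y' "Ide B b" b b] by (auto simp: hom_iff)
next
  fix x y z assume [simp]: "x \<in> Obj A" "y \<in> Obj A" "z \<in> Obj A"
  show "cst2 (fix_right A B u b) (x \<oplus>\<^bsub>A\<^esub> y, z) \<cdot>\<^bsub>T\<^esub> (cst2 (fix_right A B u b) (x, y) \<boxplus>\<^bsub>T\<^esub> Ide T (fob (fix_right A B u b) z)) =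
      cst2 (fix_right A B u b) (x, y \<oplus>\<^bsub>A\<^esub> z) \<cdot>\<^bsub>T\<^esub> (Ide T (fob (fix_right A B u b) x) \<boxplus>\<^bsub>T\<^esub> cst2 (fix_right A B u b) (y, z))"
    using tcls_eqI [OF teq.deltaR_assoc, of x y z b] by simp
next
  fix x assume [simp]: "x \<in> Obj A"
  show "cst2 (fix_right A B u b) (x, Zero A) \<cdot>\<^bsub>T\<^esub> (Ide T (fob (fix_right A B u b) x) \<boxplus>\<^bsub>T\<^esub> cst0 (fix_right A B u b)) =
      Ide T (fob (fix_right A B u b) x)"
    using tcls_eqI [OF teq.deltaR_unit_right, of x b] by simp
  show "cst2 (fix_right A B u b) (Zero A, x) \<cdot>\<^bsub>T\<^esub> (cst0 (fix_right A B u b) \<boxplus>\<^bsub>T\<^esub> Ide T (fob (fix_right A B u b) x)) =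
      Ide T (fob (fix_right A B u b) x)"
    using tcls_eqI [OF teq.deltaR_unit_left, of x b] by simp
next
  fix x y assume [simp]: "x \<in> Obj A" "y \<in> Obj A"
  show "far (fix_right A B u b) (Beta A x y) \<cdot>\<^bsub>T\<^esub> cst2 (fix_right A B u b) (x, y) =
      cst2 (fix_right A B u b) (y, x) \<cdot>\<^bsub>T\<^esub> Beta T (fob (fix_right A B u b) x) (fob (fix_right A B u b) y)"
    using tcls_eqI [OF teq.deltaR_symm, of x y b] by simp
qed (auto simp: fix_right_def hom_iff)

lemma bilinear_univ: "bilinear A B T u"
proof (rule bilinearI)
  have AB: "category (prod_cat A B)"
    by (rule category_prod_cat) unfold_locales
  show "cat_functor (prod_cat A B) T u"
    by (intro cat_functor.intro cat_functor_axioms.intro AB T.category_axioms)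
      (auto simp: hom_iff dot_merge [symmetric], auto simp: tensor_univ_def split: if_splits)
next
  fix f g g' assume [simp]: "f \<in> Arr A" "g \<in> Arr B" "g' \<in> Arr B"
  show "far u (f, g \<boxplus>\<^bsub>B\<^esub> g') \<cdot>\<^bsub>T\<^esub> bdl u (Dom A f, Dom B g, Dom B g') =
      bdl u (Cod A f, Cod B g, Cod B g') \<cdot>\<^bsub>T\<^esub> (far u (f, g) \<boxplus>\<^bsub>T\<^esub> far u (f, g'))"
    using tcls_eqI [OF teq.deltaL_natural, of f "Dom A f" "Cod A f" g "Dom B g" "Cod B g" g' "Dom B g'" "Cod B g'"]
    by (simp add: hom_iff)
next
  fix f f' g assume [simp]: "f \<in> Arr A" "f' \<in> Arr A" "g \<in> Arr B"
  show "far u (f \<boxplus>\<^bsub>A\<^esub> f', g) \<cdot>\<^bsub>T\<^esub> bdr u (Dom A f, Dom A f', Dom B g) =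
      bdr u (Cod A f, Cod A f', Cod B g) \<cdot>\<^bsub>T\<^esub> (far u (f, g) \<boxplus>\<^bsub>T\<^esub> far u (f', g))"
    using tcls_eqI [OF teq.deltaR_natural, of f "Dom A f" "Cod A f" f' "Dom A f'" "Cod A f'" g "Dom B g" "Cod B g"]
    by (simp add: hom_iff)
next
  fix f assume [simp]: "f \<in> Arr A"
  show "far u (f, Ide B (Zero B)) \<cdot>\<^bsub>T\<^esub> bzl u (Dom A f) = bzl u (Cod A f)"
    using tcls_eqI [OF teq.zetaL_natural, of f "Dom A f" "Cod A f"] by (simp add: hom_iff)
next
  fix g assume [simp]: "g \<in> Arr B"
  show "far u (Ide A (Zero A), g) \<cdot>\<^bsub>T\<^esub> bzr u (Dom B g) = bzr u (Cod B g)"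
    using tcls_eqI [OF teq.zetaR_natural, of g "Dom B g" "Cod B g"] by (simp add: hom_iff)
next
  fix a a' b b' assume [simp]: "a \<in> Obj A" "a' \<in> Obj A" "b \<in> Obj B" "b' \<in> Obj B"
  let ?L = "cls (TGen (DeltaL a b b')) \<boxplus>\<^bsub>T\<^esub> cls (TGen (DeltaL a' b b'))"
  let ?R = "cls (TGen (DeltaR a a' b)) \<boxplus>\<^bsub>T\<^esub> cls (TGen (DeltaR a a' b'))"
  let ?\<beta> = "Ide T [(a, b)] \<boxplus>\<^bsub>T\<^esub> cls (TGen (Braid (a', b) (a, b'))) \<boxplus>\<^bsub>T\<^esub> Ide T [(a', b')]"
  let ?\<beta>' = "Ide T [(a, b)] \<boxplus>\<^bsub>T\<^esub> cls (TGen (Braid (a, b') (a', b))) \<boxplus>\<^bsub>T\<^esub> Ide T [(a', b')]"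
  \<comment> \<open>The relation has the middle symmetry on the \<open>DeltaL\<close> summands,
    while axiom (ii) has the inverse symmetry on the other side. Composing with
    \<open>?\<beta>'\<close> and cancelling \<open>?\<beta> \<cdot> ?\<beta>'\<close> turns one into
    the other.\<close>
  have e: "cls (TGen (DeltaL (a \<oplus>\<^bsub>A\<^esub> a') b b')) \<cdot>\<^bsub>T\<^esub> ?R =
      (cls (TGen (DeltaR a a' (b \<oplus>\<^bsub>B\<^esub> b'))) \<cdot>\<^bsub>T\<^esub> ?L) \<cdot>\<^bsub>T\<^esub> ?\<beta>"
    using tcls_eqI [OF teq.delta_delta, of a a' b b'] by simp
  have "cls (TGen (Braid (a', b) (a, b'))) \<cdot>\<^bsub>T\<^esub> cls (TGen (Braid (a, b') (a', b))) = Ide T [(a, b'), (a', b)]"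
    using T.beta_inv [of "[(a, b')]" "[(a', b)]"] by simp
  then have "?\<beta> \<cdot>\<^bsub>T\<^esub> ?\<beta>' = Ide T [(a, b)] \<boxplus>\<^bsub>T\<^esub> (Ide T [(a, b'), (a', b)] \<boxplus>\<^bsub>T\<^esub> Ide T [(a', b')])"
    by (simp add: T.plus_merge del: T.plus_ide)
  also have "\<dots> = Ide T [(a, b), (a, b'), (a', b), (a', b')]"
    by simp
  finally have \<beta>: "?\<beta> \<cdot>\<^bsub>T\<^esub> ?\<beta>' = Ide T [(a, b), (a, b'), (a', b), (a', b')]" .
  have "cls (TGen (DeltaL (a \<oplus>\<^bsub>A\<^esub> a') b b')) \<cdot>\<^bsub>T\<^esub> (?R \<cdot>\<^bsub>T\<^esub> ?\<beta>') =
      (cls (TGen (DeltaR a a' (b \<oplus>\<^bsub>B\<^esub> b'))) \<cdot>\<^bsub>T\<^esub> ?L) \<cdot>\<^bsub>T\<^esub> (?\<beta> \<cdot>\<^bsub>T\<^esub> ?\<beta>')"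
    by (rule T.cmp_square_extend [OF e]) simp_all
  also have "\<dots> = cls (TGen (DeltaR a a' (b \<oplus>\<^bsub>B\<^esub> b'))) \<cdot>\<^bsub>T\<^esub> ?L"
    unfolding \<beta> by simp
  finally show "bdr u (a, a', b \<oplus>\<^bsub>B\<^esub> b') \<cdot>\<^bsub>T\<^esub> (bdl u (a, b, b') \<boxplus>\<^bsub>T\<^esub> bdl u (a', b, b')) =
      bdl u (a \<oplus>\<^bsub>A\<^esub> a', b, b') \<cdot>\<^bsub>T\<^esub> (bdr u (a, a', b) \<boxplus>\<^bsub>T\<^esub> bdr u (a, a', b')) \<cdot>\<^bsub>T\<^esub>
        (Ide T (fob u (a, b)) \<boxplus>\<^bsub>T\<^esub> Beta T (fob u (a, b')) (fob u (a', b)) \<boxplus>\<^bsub>T\<^esub> Ide T (fob u (a', b')))"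
    by simp
next
  show "bzl u (Zero A) = bzr u (Zero B)"
    using tcls_eqI [OF teq.zeta_zeta] by simp
next
  fix a a' assume [simp]: "a \<in> Obj A" "a' \<in> Obj A"
  show "bdr u (a, a', Zero B) \<cdot>\<^bsub>T\<^esub> (bzl u a \<boxplus>\<^bsub>T\<^esub> bzl u a') = bzl u (a \<oplus>\<^bsub>A\<^esub> a')"
    using tcls_eqI [OF teq.deltaR_zeta, of a a'] by simp
next
  fix b b' assume [simp]: "b \<in> Obj B" "b' \<in> Obj B"
  show "bdl u (Zero A, b, b') \<cdot>\<^bsub>T\<^esub> (bzr u b \<boxplus>\<^bsub>T\<^esub> bzr u b') = bzr u (b \<oplus>\<^bsub>B\<^esub> b')"
    using tcls_eqI [OF teq.deltaL_zeta, of b b'] by simp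
qed (auto intro: sm_functor_fix_left_univ sm_functor_fix_right_univ A.permutative_axioms B.permutative_axioms
    permutative_tensor, auto simp: tensor_univ_def)

end

section \<open>The strict functor induced by a bilinear map\<close>

context bilinear
begin

text \<open>This and the facts up to \<open>bdr_symm\<close> unfold axiom (i) into equations on
  \<open>bdl\<close>, \<open>bdr\<close>, \<open>bzl\<close> and \<open>bzr\<close>, in the shape of
  the relations on generators that evaluation has to respect.\<close>

lemma bdl_assoc:
  "\<lbrakk>a \<in> Obj A; b \<in> Obj B; b' \<in> Obj B; b'' \<in> Obj B\<rbrakk> \<Longrightarrow>
    bdl H (a, b \<oplus>\<^bsub>B\<^esub> b', b'') \<cdot>\<^bsub>C\<^esub> (bdl H (a, b, b') \<boxplus>\<^bsub>C\<^esub> Ide C (fob H (a, b''))) =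
    bdl H (a, b, b' \<oplus>\<^bsub>B\<^esub> b'') \<cdot>\<^bsub>C\<^esub> (Ide C (fob H (a, b)) \<boxplus>\<^bsub>C\<^esub> bdl H (a, b', b''))"
  using sm_functor.cst_assoc [OF fix_left_sm, of a b b' b''] by simp

lemma bdl_unit:
  assumes "a \<in> Obj A" "b \<in> Obj B"
  shows "bdl H (a, b, Zero B) \<cdot>\<^bsub>C\<^esub> (Ide C (fob H (a, b)) \<boxplus>\<^bsub>C\<^esub> bzl H a) = Ide C (fob H (a, b))"
    "bdl H (a, Zero B, b) \<cdot>\<^bsub>C\<^esub> (bzl H a \<boxplus>\<^bsub>C\<^esub> Ide C (fob H (a, b))) = Ide C (fob H (a, b))"
  using sm_functor.cst_unit_right [OF fix_left_sm, of a b] sm_functor.cst_unit_left [OF fix_left_sm, of a b]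
    assms by simp_all

lemma bdl_symm:
  "\<lbrakk>a \<in> Obj A; b \<in> Obj B; b' \<in> Obj B\<rbrakk> \<Longrightarrow>
    far H (Ide A a, Beta B b b') \<cdot>\<^bsub>C\<^esub> bdl H (a, b, b') =
    bdl H (a, b', b) \<cdot>\<^bsub>C\<^esub> Beta C (fob H (a, b)) (fob H (a, b'))"
  using sm_functor.cst_symm [OF fix_left_sm, of a b b'] by simp

lemma bdr_assoc:
  "\<lbrakk>a \<in> Obj A; a' \<in> Obj A; a'' \<in> Obj A; b \<in> Obj B\<rbrakk> \<Longrightarrow>
    bdr H (a \<oplus>\<^bsub>A\<^esub> a', a'', b) \<cdot>\<^bsub>C\<^esub> (bdr H (a, a', b) \<boxplus>\<^bsub>C\<^esub> Ide C (fob H (a'', b))) =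
    bdr H (a, a' \<oplus>\<^bsub>A\<^esub> a'', b) \<cdot>\<^bsub>C\<^esub> (Ide C (fob H (a, b)) \<boxplus>\<^bsub>C\<^esub> bdr H (a', a'', b))"
  using sm_functor.cst_assoc [OF fix_right_sm, of b a a' a''] by simp

lemma bdr_unit:
  assumes "a \<in> Obj A" "b \<in> Obj B"
  shows "bdr H (a, Zero A, b) \<cdot>\<^bsub>C\<^esub> (Ide C (fob H (a, b)) \<boxplus>\<^bsub>C\<^esub> bzr H b) = Ide C (fob H (a, b))"
    "bdr H (Zero A, a, b) \<cdot>\<^bsub>C\<^esub> (bzr H b \<boxplus>\<^bsub>C\<^esub> Ide C (fob H (a, b))) = Ide C (fob H (a, b))"
  using sm_functor.cst_unit_right [OF fix_right_sm, of b a] sm_functor.cst_unit_left [OF fix_right_sm, of b a]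
    assms by simp_all

lemma bdr_symm:
  "\<lbrakk>a \<in> Obj A; a' \<in> Obj A; b \<in> Obj B\<rbrakk> \<Longrightarrow>
    far H (Beta A a a', Ide B b) \<cdot>\<^bsub>C\<^esub> bdr H (a, a', b) =
    bdr H (a', a, b) \<cdot>\<^bsub>C\<^esub> Beta C (fob H (a, b)) (fob H (a', b))"
  using sm_functor.cst_symm [OF fix_right_sm, of b a a'] by simp

text \<open>
  In \<open>A \<otimes> B\<close> relation (4) is stated on \<open>a.b + a'.b + a.b' + a'.b'\<close>, while axiom (ii) of bilinear maps
  starts from \<open>H(a,b) + H(a,b') + H(a',b) + H(a',b')\<close>; cancelling the symmetry in the middle
  passes from one to the other.
\<close>

lemma interchange_inverse:
  assumes [simp]: "a \<in> Obj A" "a' \<in> Obj A" "b \<in> Obj B" "b' \<in> Obj B"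
  shows "bdl H (a \<oplus>\<^bsub>A\<^esub> a', b, b') \<cdot>\<^bsub>C\<^esub> (bdr H (a, a', b) \<boxplus>\<^bsub>C\<^esub> bdr H (a, a', b')) =
    bdr H (a, a', b \<oplus>\<^bsub>B\<^esub> b') \<cdot>\<^bsub>C\<^esub> (bdl H (a, b, b') \<boxplus>\<^bsub>C\<^esub> bdl H (a', b, b')) \<cdot>\<^bsub>C\<^esub>
      (Ide C (fob H (a, b)) \<boxplus>\<^bsub>C\<^esub> Beta C (fob H (a', b)) (fob H (a, b')) \<boxplus>\<^bsub>C\<^esub> Ide C (fob H (a', b')))"
proof -
  let ?R = "bdr H (a, a', b) \<boxplus>\<^bsub>C\<^esub> bdr H (a, a', b')"
  let ?L = "bdl H (a, b, b') \<boxplus>\<^bsub>C\<^esub> bdl H (a', b, b')"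
  let ?i = "Ide C (fob H (a, b))" and ?j = "Ide C (fob H (a', b'))"
  let ?\<beta> = "?i \<boxplus>\<^bsub>C\<^esub> (Beta C (fob H (a', b)) (fob H (a, b')) \<boxplus>\<^bsub>C\<^esub> ?j)"
  let ?\<beta>' = "?i \<boxplus>\<^bsub>C\<^esub> (Beta C (fob H (a, b')) (fob H (a', b)) \<boxplus>\<^bsub>C\<^esub> ?j)"
  have e: "bdr H (a, a', b \<oplus>\<^bsub>B\<^esub> b') \<cdot>\<^bsub>C\<^esub> ?L = bdl H (a \<oplus>\<^bsub>A\<^esub> a', b, b') \<cdot>\<^bsub>C\<^esub> (?R \<cdot>\<^bsub>C\<^esub> ?\<beta>')"
    using interchange [of a a' b b'] by simp
  have \<beta>: "?\<beta>' \<cdot>\<^bsub>C\<^esub> ?\<beta> = Ide C (fob H (a, b) \<oplus>\<^bsub>C\<^esub> (fob H (a', b) \<oplus>\<^bsub>C\<^esub> (fob H (a, b') \<oplus>\<^bsub>C\<^esub> fob H (a', b'))))"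
    by (simp add: cod.plus_merge cod.beta_inv)
  have "bdr H (a, a', b \<oplus>\<^bsub>B\<^esub> b') \<cdot>\<^bsub>C\<^esub> (?L \<cdot>\<^bsub>C\<^esub> ?\<beta>) = bdl H (a \<oplus>\<^bsub>A\<^esub> a', b, b') \<cdot>\<^bsub>C\<^esub> ((?R \<cdot>\<^bsub>C\<^esub> ?\<beta>') \<cdot>\<^bsub>C\<^esub> ?\<beta>)"
    by (rule cod.cmp_square_extend [OF e]) simp_all
  also have "\<dots> = bdl H (a \<oplus>\<^bsub>A\<^esub> a', b, b') \<cdot>\<^bsub>C\<^esub> (?R \<cdot>\<^bsub>C\<^esub> (?\<beta>' \<cdot>\<^bsub>C\<^esub> ?\<beta>))"
    by simp
  also have "\<dots> = bdl H (a \<oplus>\<^bsub>A\<^esub> a', b, b') \<cdot>\<^bsub>C\<^esub> ?R"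
    unfolding \<beta> by simp
  finally show ?thesis
    by simp
qed

end

section \<open>Evaluation of formal expressions in the target category\<close>

primrec osum :: "('p, 'n) perm \<Rightarrow> ('x \<Rightarrow> 'p) \<Rightarrow> 'x list \<Rightarrow> 'p" where
  "osum C h [] = Zero C"
| "osum C h (p # xs) = h p \<oplus>\<^bsub>C\<^esub> osum C h xs"

primrec asum :: "('p, 'n) perm \<Rightarrow> ('x \<Rightarrow> 'n) \<Rightarrow> 'x list \<Rightarrow> 'n" where
  "asum C t [] = Ide C (Zero C)"
| "asum C t (p # xs) = t p \<boxplus>\<^bsub>C\<^esub> asum C t xs"

fun gen_eval :: "('oc, 'mc) perm \<Rightarrow> ('oa, 'ma, 'ob, 'mb, 'oc, 'mc) bil \<Rightarrow> ('oa, 'ob) gen \<Rightarrow> 'mc" where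
  "gen_eval C H (DeltaL a b b') = bdl H (a, b, b')"
| "gen_eval C H (DeltaR a a' b) = bdr H (a, a', b)"
| "gen_eval C H (Braid p q) = Beta C (fob H p) (fob H q)"
| "gen_eval C H (ZetaL a) = bzl H a"
| "gen_eval C H (ZetaR b) = bzr H b"

primrec tm_eval ::
    "('oc, 'mc) perm \<Rightarrow> ('oa, 'ma, 'ob, 'mb, 'oc, 'mc) bil \<Rightarrow> ('oa, 'ma, 'ob, 'mb) tm \<Rightarrow> 'mc" where
  "tm_eval C H (TId xs) = Ide C (osum C (fob H) xs)"
| "tm_eval C H (TDot f g) = far H (f, g)"
| "tm_eval C H (TGen e) = gen_eval C H e"
| "tm_eval C H (TInv e) = inv_arr C (gen_eval C H e)"
| "tm_eval C H (t \<circ>\<^sub>t s) = tm_eval C H t \<cdot>\<^bsub>C\<^esub> tm_eval C H s"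
| "tm_eval C H (t +\<^sub>t s) = tm_eval C H t \<boxplus>\<^bsub>C\<^esub> tm_eval C H s"

text \<open>An arrow is evaluated at the representative chosen by \<open>trep\<close>;
  \<open>ev_teq\<close> shows that any other gives the same value. The constraints are identities
  because the functor is to be strict.\<close>

definition bil_lift ::
    "('oa, 'ma) perm \<Rightarrow> ('ob, 'mb) perm \<Rightarrow> ('oc, 'mc) perm \<Rightarrow> ('oa, 'ma, 'ob, 'mb, 'oc, 'mc) bil \<Rightarrow>
     (('oa \<times> 'ob) list, ('oa, 'ma, 'ob, 'mb) tarr, 'oc, 'mc) smf" where
  "bil_lift A B C H =
    \<lparr>fob = (\<lambda>xs\<in>Obj (A \<otimes> B). osum C (fob H) xs),
     far = (\<lambda>X\<in>Arr (A \<otimes> B). tm_eval C H (trep X)),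
     cst2 = (\<lambda>(xs, ys)\<in>Obj (A \<otimes> B) \<times> Obj (A \<otimes> B). Ide C (osum C (fob H) (xs @ ys))),
     cst0 = Ide C (Zero C)\<rparr>"

context permutative
begin

lemma osum_obj [simp]: "(\<And>p. p \<in> set xs \<Longrightarrow> h p \<in> Obj C) \<Longrightarrow> osum C h xs \<in> Obj C"
  by (induction xs) auto

lemma osum_append [simp]:
  "(\<And>p. p \<in> set xs \<union> set ys \<Longrightarrow> h p \<in> Obj C) \<Longrightarrow> osum C h (xs @ ys) = osum C h xs \<oplus> osum C h ys"
  by (induction xs) auto

end

locale bilinear_lift = tensor_factors A B + bilinear A B C H
  for A :: "('oa, 'ma) perm" and B :: "('ob, 'mb) perm" and C :: "('oc, 'mc) perm"
    and H :: "('oa, 'ma, 'ob, 'mb, 'oc, 'mc) bil"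
begin

abbreviation os where "os \<equiv> osum C (fob H)"
abbreviation ev where "ev \<equiv> tm_eval C H"

lemma gen_eval_simps [simp]:
  assumes "gwf A B e"
  shows "gen_eval C H e \<in> Arr C" "Dom C (gen_eval C H e) = os (gsrc e)"
    "Cod C (gen_eval C H e) = os (gtgt A B e)" "is_iso C (gen_eval C H e)"
  using assms by (cases e; auto simp: cod.is_iso_beta)+

lemma os_obj [simp]: "xs \<in> lists (Obj A \<times> Obj B) \<Longrightarrow> os xs \<in> Obj C"
  by (rule cod.osum_obj) auto

lemma os_append [simp]:
  "\<lbrakk>xs \<in> lists (Obj A \<times> Obj B); ys \<in> lists (Obj A \<times> Obj B)\<rbrakk> \<Longrightarrow> os (xs @ ys) = os xs \<oplus>\<^bsub>C\<^esub> os ys"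
  by (rule cod.osum_append) auto

lemma wf_obj [simp]:
  "wf t \<Longrightarrow> src t \<in> lists (Obj A \<times> Obj B)" "wf t \<Longrightarrow> tgt t \<in> lists (Obj A \<times> Obj B)"
  using src_tgt_obj by auto

lemma ev_typing: "wf t \<Longrightarrow> ev t \<in> Arr C \<and> Dom C (ev t) = os (src t) \<and> Cod C (ev t) = os (tgt t)"
proof (induction t)
  case (TPlus t s)
  then have "src t \<in> lists (Obj A \<times> Obj B)" "src s \<in> lists (Obj A \<times> Obj B)"
    "tgt t \<in> lists (Obj A \<times> Obj B)" "tgt s \<in> lists (Obj A \<times> Obj B)"
    by (simp_all del: in_lists_conv_set)
  then show ?case
    using TPlus by (simp del: in_lists_conv_set)
qed (auto simp del: in_lists_conv_set)

lemma ev_simps [simp]: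
  assumes "wf t"
  shows "ev t \<in> Arr C" "Dom C (ev t) = os (src t)" "Cod C (ev t) = os (tgt t)"
  using ev_typing [OF assms] by simp_all

text \<open>The recursion of \<open>tbeta1\<close> is the hexagon for a sum in the second argument,
  and that of \<open>tbeta\<close> is the hexagon for a sum in the first; so both evaluate to a
  single symmetry of \<open>C\<close>.\<close>

lemma ev_tbeta1:
  "\<lbrakk>p \<in> Obj A \<times> Obj B; ys \<in> lists (Obj A \<times> Obj B)\<rbrakk> \<Longrightarrow> ev (tbeta1 p ys) = Beta C (fob H p) (os ys)"
proof (induction ys)
  case (Cons q ys)
  then have "p \<in> Obj A \<times> Obj B" "q \<in> Obj A \<times> Obj B" "os ys \<in> Obj C"
    by auto
  then show ?case
    using Cons by (auto simp: cod.beta_plus)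
qed auto

lemma ev_tbeta:
  "\<lbrakk>xs \<in> lists (Obj A \<times> Obj B); ys \<in> lists (Obj A \<times> Obj B)\<rbrakk> \<Longrightarrow> ev (tbeta xs ys) = Beta C (os xs) (os ys)"
proof (induction xs)
  case (Cons p xs)
  then have "p \<in> Obj A \<times> Obj B" "os xs \<in> Obj C" "os ys \<in> Obj C"
    by auto
  then show ?case
    using Cons by (auto simp: cod.beta_plus_left ev_tbeta1)
next
  case Nil
  then show ?case by (simp del: in_lists_conv_set)
qed

text \<open>The rules for the symmetry speak of whole lists and are brought to \<open>C\<close> by
  \<open>ev_tbeta\<close>. The rules for formal inverses hold because each generator is sent to an
  isomorphism. For the remaining rules the matching fact about \<open>H\<close> or \<open>C\<close>
  is supplied.\<close>

lemma ev_teq: "teq A B t s \<Longrightarrow> ev t = ev s"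
proof (induction rule: teq.induct)
  case (comp_assoc t ws xs s ys r zs)
  then show ?case by (auto simp: thom_def)
next
  case (plus_comp t xs ys t' zs s us vs s' ws)
  then show ?case by (auto simp: thom_def cod.plus_cmp_arr)
next
  case (dot_comp f a a1 f' a2 g b b1 g' b2)
  then show ?case by (auto simp: hom_iff far_merge)
next
  case (deltaL_natural f a a1 g b b1 g' b' b1')
  then show ?case using bdl_nat [of f g g'] by (auto simp: hom_iff)
next
  case (deltaR_natural f a a1 f' a' a1' g b b1)
  then show ?case using bdr_nat [of f f' g] by (auto simp: hom_iff)
next
  case (zetaL_natural f a a1)
  then show ?case using bzl_nat [of f] by (auto simp: hom_iff)
next
  case (zetaR_natural g b b1)
  then show ?case using bzr_nat [of g] by (auto simp: hom_iff)
next
  case (beta_natural t xs xs' s ys ys')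
  then have "wf t" "wf s" "xs = src t" "xs' = tgt t" "ys = src s" "ys' = tgt s"
    by (auto simp: thom_def)
  then show ?case
    using cod.beta_nat [of "ev t" "ev s"] by (simp add: ev_tbeta del: in_lists_conv_set)
next
  case (beta_inv xs ys)
  then show ?case by (simp add: ev_tbeta cod.beta_inv del: in_lists_conv_set)
next
  case (beta_plus xs ys zs)
  then have "ys @ zs \<in> lists (Obj A \<times> Obj B)" by simp
  then show ?case using beta_plus by (simp add: ev_tbeta cod.beta_plus del: in_lists_conv_set append_in_lists_conv)
next
  case (deltaL_assoc a b b' b'')
  then show ?case using bdl_assoc by simp
next
  case (deltaR_assoc a a' a'' b)
  then show ?case using bdr_assoc by simp
next
  case (delta_delta a a' b b')
  then show ?case using interchange_inverse [of a a' b b'] by simp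
qed (auto simp: thom_def bdl_unit bdr_unit bdl_symm bdr_symm zero_zero bdr_zero bdl_zero simp del: in_lists_conv_set
    dest: teq_typing)

abbreviation L where "L \<equiv> bil_lift A B C H"

lemma ev_trep [simp]: "wf t \<Longrightarrow> ev (trep (cls t)) = ev t"
  using ev_teq [OF trep_teq] by simp

lemma lift_simps [simp]:
  "xs \<in> lists (Obj A \<times> Obj B) \<Longrightarrow> fob L xs = os xs"
  "wf t \<Longrightarrow> far L (cls t) = ev t"
  "\<lbrakk>xs \<in> lists (Obj A \<times> Obj B); ys \<in> lists (Obj A \<times> Obj B)\<rbrakk> \<Longrightarrow> cst2 L (xs, ys) = Ide C (os (xs @ ys))"
  "cst0 L = Ide C (Zero C)"
  by (simp_all add: bil_lift_def)

text \<open>Composites and sums of arrows are evaluated on terms representing them, where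
  \<open>tm_eval\<close> preserves both operations by definition.\<close>

lemma strict_lift: "strict_sm_functor T C L"
proof (rule strict_sm_functorI)
  show "cat_functor T C L"
  proof (intro cat_functor.intro cat_functor_axioms.intro T.category_axioms cod.category_axioms)
    fix f x y assume "f \<in> hom T x y"
    then obtain t where t: "wf t" "f = cls t" "x = src t" "y = tgt t" by (auto simp: hom_tensor thom_def)
    then show "far L f \<in> hom C (fob L x) (fob L y)"
      by (simp add: hom_iff del: in_lists_conv_set)
    fix g z assume "g \<in> hom T y z"
    then obtain s where s: "wf s" "g = cls s" "y = src s" "z = tgt s" by (auto simp: hom_tensor thom_def)
    then show "far L (g \<cdot>\<^bsub>T\<^esub> f) = far L g \<cdot>\<^bsub>C\<^esub> far L f"
      using t by (simp add: tcls_comp [symmetric] del: tensor_simps(5))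
  next
    fix xs assume "xs \<in> Obj T"
    then show "far L (Ide T xs) = Ide C (fob L xs)"
      using lift_simps(2) [of "TId xs"] by (simp del: lift_simps(2) in_lists_conv_set)
  qed (auto simp: bil_lift_def)
next
  fix f g assume "f \<in> Arr T" "g \<in> Arr T"
  then obtain t s where "wf t" "f = cls t" "wf s" "g = cls s" by (auto simp: arr_tensor)
  then show "far L (f \<boxplus>\<^bsub>T\<^esub> g) = far L f \<boxplus>\<^bsub>C\<^esub> far L g"
    by (simp add: tcls_plus [symmetric] del: tensor_simps(6))
next
  fix xs ys assume "xs \<in> Obj T" "ys \<in> Obj T"
  then show "far L (Beta T xs ys) = Beta C (fob L xs) (fob L ys)"
    by (simp add: tensor_fields(5) ev_tbeta del: in_lists_conv_set)
qed (auto simp: permutative_tensor cod.permutative_axioms bil_lift_def)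

text \<open>On singletons and generators the lift returns the data of \<open>H\<close>, the trailing
  zero of \<open>osum\<close> being absorbed; off their domains the fields of both sides are
  \<open>undefined\<close>, so the records coincide.\<close>

lemma lift_univ: "bil_post A B C L u = H"
proof (rule bil_eqI)
  interpret U: bilinear A B T u by (rule bilinear_univ)
  show "fob (bil_post A B C L u) = fob H"
    using fob_type by (auto simp: fun_eq_iff bil_post_def PiE_iff extensional_def)
  show "far (bil_post A B C L u) = far H"
    using far_ext by (auto simp: fun_eq_iff bil_post_def extensional_def)
  show "bdl (bil_post A B C L u) = bdl H"
    using bdl_ext by (auto simp: fun_eq_iff bil_post_def extensional_def)
  show "bdr (bil_post A B C L u) = bdr H"
    using bdr_ext by (auto simp: fun_eq_iff bil_post_def extensional_def)
  show "bzl (bil_post A B C L u) = bzl H"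
    using bzl_ext by (auto simp: fun_eq_iff bil_post_def extensional_def)
  show "bzr (bil_post A B C L u) = bzr H"
    using bzr_ext by (auto simp: fun_eq_iff bil_post_def extensional_def)
qed

end

text \<open>List membership is kept folded from here on, since the rules for sums over lists have it
  as a premise.\<close>

declare in_lists_conv_set [simp del]

text \<open>Evaluation and \<open>S\<close> are compared by induction on terms. A strict functor is
  fixed on objects by its values on singletons, and on formal inverses because functors preserve
  inverses.\<close>

lemma (in tensor_factors) lift_unique:
  assumes "strict_sm_functor T C S"
  shows "bil_lift A B C (bil_post A B C S u) = S"
proof -
  interpret S: strict_sm_functor T C S by fact
  interpret U: bilinear A B T u by (rule bilinear_univ)
  interpret bilinear_lift A B C "bil_post A B C S u"
    by (intro bilinear_lift.intro bilinear_post assms bilinear_univ) unfold_locales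
  let ?H = "bil_post A B C S u"
  have nil: "fob S [] = Zero C"
    using S.fob_zero by simp
  have fob: "os xs = fob S xs" if "xs \<in> lists (Obj A \<times> Obj B)" for xs
    using that
  proof (induction xs)
    case Nil
    then show ?case by (simp add: nil)
  next
    case (Cons p xs)
    then show ?case using S.fob_plus [of "[p]" xs] by auto
  qed
  \<comment> \<open>The constraints of \<open>bil_post\<close> contain a factor
    \<open>cst2 S\<close> or \<open>cst0 S\<close>; strictness makes it an identity, so the plain
    value of \<open>S\<close> on the generator remains. For \<open>Braid\<close>, \<open>S\<close>
    preserves the symmetry.\<close>
  have gen: "gen_eval C ?H e = far S (cls (TGen e))" if "gwf A B e" for e
  proof (cases e)
    case (Braid p q)
    then show ?thesis
      using that S.far_beta [of "[p]" "[q]"] by (auto simp del: S.far_beta)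
  qed (use that S.cst2_strict [of "[_]" "[_]"] in \<open>auto simp: nil simp del: S.fob_plus S.fob_zero\<close>)
  have far: "ev t = far S (cls t)" if "wf t" for t
    using that
  proof (induction t)
    case (TInv e)
    then show ?case
      using S.far_inv_arr [of "cls (TGen e)"] by (simp add: gen tcls_inv)
  qed (auto simp: fob gen)
  show ?thesis
  proof (rule smf_eqI)
    show "fob L = fob S"
      using fob S.fob_undefined by (auto simp: fun_eq_iff bil_lift_def)
    show "far L = far S"
    proof
      fix X show "far L X = far S X"
      proof (cases "X \<in> Arr T")
        case True
        then show ?thesis by (auto simp: arr_tensor far)
      next
        case False
        then show ?thesis using S.far_ext by (auto simp: bil_lift_def extensional_def)
      qed
    qed
    show "cst2 L = cst2 S"
    proof
      fix X show "cst2 L X = cst2 S X"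
      proof (cases "X \<in> Obj T \<times> Obj T")
        case True
        then obtain xs ys where X: "X = (xs, ys)" "xs \<in> Obj T" "ys \<in> Obj T" by auto
        then show ?thesis using S.cst2_strict [of xs ys] by (simp add: fob)
      next
        case False
        then show ?thesis using S.cst2_ext by (cases X) (auto simp: bil_lift_def extensional_def)
      qed
    qed
  qed simp
qed

section \<open>Additive extension of bilinear transformations\<close>

locale bil_trans_lift = H: bilinear_lift A B C H + J: bilinear_lift A B C J
  for A :: "('oa, 'ma) perm" and B :: "('ob, 'mb) perm" and C :: "('oc, 'mc) perm"
    and H :: "('oa, 'ma, 'ob, 'mb, 'oc, 'mc) bil" and J :: "('oa, 'ma, 'ob, 'mb, 'oc, 'mc) bil" +
  fixes t
  assumes trans: "bil_trans A B C H J t"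
begin

lemmas trans_simps [simp] = bil_transD(4-6) [OF trans]

lemma asum_simps [simp]:
  assumes "xs \<in> lists (Obj A \<times> Obj B)"
  shows "asum C t xs \<in> Arr C" "Dom C (asum C t xs) = H.os xs" "Cod C (asum C t xs) = J.os xs"
proof -
  have "asum C t xs \<in> Arr C \<and> Dom C (asum C t xs) = H.os xs \<and> Cod C (asum C t xs) = J.os xs"
    using assms by induction auto
  then show "asum C t xs \<in> Arr C" "Dom C (asum C t xs) = H.os xs" "Cod C (asum C t xs) = J.os xs"
    by auto
qed

lemma asum_append [simp]:
  assumes "xs \<in> lists (Obj A \<times> Obj B)" "ys \<in> lists (Obj A \<times> Obj B)"
  shows "asum C t (xs @ ys) = asum C t xs \<boxplus>\<^bsub>C\<^esub> asum C t ys"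
  using assms(1)
proof induction
  case (Cons p xs)
  then show ?case
    using assms(2) by (cases p) simp
qed (simp add: assms(2))

text \<open>For \<open>Braid\<close> this is naturality of the symmetry of \<open>C\<close>; for
  every other generator it is one of the four compatibility conditions of a bilinear
  transformation.\<close>

lemma gen_eval_natural:
  assumes "gwf A B e"
  shows "asum C t (gtgt A B e) \<cdot>\<^bsub>C\<^esub> gen_eval C H e = gen_eval C J e \<cdot>\<^bsub>C\<^esub> asum C t (gsrc e)"
proof (cases e)
  case (Braid p q)
  then show ?thesis
    using assms H.cod.beta_nat [of "t p" "t q"] by auto
qed (use assms bil_transD(8-11) [OF trans] in auto)

lemma ev_natural:
  "H.wf s \<Longrightarrow> J.ev s \<cdot>\<^bsub>C\<^esub> asum C t (H.src s) = asum C t (H.tgt s) \<cdot>\<^bsub>C\<^esub> H.ev s"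
proof (induction s)
  case (TDot f g)
  then show ?case
    using bil_transD(7) [OF trans, of f g] by simp
next
  case (TGen e)
  then show ?case
    using gen_eval_natural by simp
next
  case (TInv e)
  then show ?case
    \<comment> \<open>Evaluation sends a formal inverse to an inverse, so the square of the
      generator is turned around.\<close>
    using H.cod.inv_arr_square [OF _ _ _ _ _ _ gen_eval_natural, of e] by simp
next
  case (TComp r s)
  \<comment> \<open>The squares of \<open>r\<close> and \<open>s\<close> are pasted along the
    component at their common object \<open>H.src r\<close>.\<close>
  have "J.ev r \<cdot>\<^bsub>C\<^esub> (asum C t (H.src r) \<cdot>\<^bsub>C\<^esub> H.ev s) = asum C t (H.tgt r) \<cdot>\<^bsub>C\<^esub> (H.ev r \<cdot>\<^bsub>C\<^esub> H.ev s)"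
    by (rule H.cod.cmp_square_extend) (use TComp in simp_all)
  then show ?case
    using TComp by simp
next
  case (TPlus r s)
  then show ?case
    by (simp add: H.cod.plus_merge)
qed auto

text \<open>The constraints of both lifts are identities, so monoidality is
  \<open>asum_append\<close>; naturality is \<open>ev_natural\<close> on a representing
  term.\<close>

lemma sm_trans_lift: "sm_trans H.T C H.L J.L (\<lambda>xs\<in>Obj H.T. asum C t xs)"
proof (rule sm_transI)
  fix f assume "f \<in> Arr H.T"
  then obtain s where "H.wf s" "f = H.cls s" by (auto simp: H.arr_tensor)
  then show "far J.L f \<cdot>\<^bsub>C\<^esub> (\<lambda>xs\<in>Obj H.T. asum C t xs) (Dom H.T f) =
      (\<lambda>xs\<in>Obj H.T. asum C t xs) (Cod H.T f) \<cdot>\<^bsub>C\<^esub> far H.L f"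
    by (simp add: ev_natural)
qed (auto simp: hom_iff strict_sm_functor.axioms(1) [OF H.strict_lift] strict_sm_functor.axioms(1) [OF J.strict_lift])

end

lemma (in permutative) asum_ide:
  "(\<And>p. p \<in> set xs \<Longrightarrow> h p \<in> Obj C) \<Longrightarrow> asum C (\<lambda>p. Ide C (h p)) xs = Ide C (osum C h xs)"
  by (induction xs) auto

lemma asum_cong: "(\<And>p. p \<in> set xs \<Longrightarrow> s p = t p) \<Longrightarrow> asum C s xs = asum C t xs"
  by (induction xs) auto

context tensor_factors
begin

text \<open>Monoidality between strict functors says that \<open>t\<close> is additive and is an
  identity at the empty list, so its values on singletons determine it.\<close>

lemma asum_unique:
  assumes "strict_sm_functor T C S" "strict_sm_functor T C S'" and t: "sm_trans T C S S' t"
    and "xs \<in> Obj T"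
  shows "asum C (\<lambda>(a, b)\<in>Obj A \<times> Obj B. t (fob u (a, b))) xs = t xs"
proof -
  interpret S: strict_sm_functor T C S by fact
  interpret S': strict_sm_functor T C S' by fact
  note [simp] = sm_transD(4-6) [OF t]
  have plus: "t (xs @ ys) = t xs \<boxplus>\<^bsub>C\<^esub> t ys"
    if "xs \<in> lists (Obj A \<times> Obj B)" "ys \<in> lists (Obj A \<times> Obj B)" for xs ys
    using sm_transD(8) [OF t, of xs ys] that S.cst2_strict [of xs ys] S'.cst2_strict [of xs ys]
      S.fob_plus [of xs ys] S'.fob_plus [of xs ys] by simp
  have zero: "t [] = Ide C (Zero C)"
    using sm_transD(9) [OF t] S.fob_zero by simp
  from assms(4) have "xs \<in> lists (Obj A \<times> Obj B)" by simp
  then show ?thesis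
  proof induction
    case (Cons p xs)
    then show ?case using plus [of "[p]" xs] by auto
  qed (simp add: zero)
qed

lemma inverse_arrs_dot:
  "\<lbrakk>inverse_arrs A f f'; inverse_arrs B g g'\<rbrakk> \<Longrightarrow> inverse_arrs T (cls (TDot f g)) (cls (TDot f' g'))"
  by (auto simp: inverse_arrs_def hom_iff dot_merge)

text \<open>In \<open>tens_inv\<close> the inverse of a constraint is taken in a factor category;
  this identifies it with the inverse taken in \<open>A \<otimes> B\<close>.\<close>

lemma inv_arr_dot_ide_left:
  assumes "is_iso B g" "a \<in> Obj A"
  shows "inv_arr T (cls (TDot (Ide A a) g)) = cls (TDot (Ide A a) (inv_arr B g))"
  by (intro T.inv_arr_eqI inverse_arrs_dot A.inverse_arrs_ide B.inverse_arrs_inv_arr assms)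

lemma inv_arr_dot_ide_right:
  assumes "is_iso A f" "b \<in> Obj B"
  shows "inv_arr T (cls (TDot f (Ide B b))) = cls (TDot (inv_arr A f) (Ide B b))"
  by (intro T.inv_arr_eqI inverse_arrs_dot B.inverse_arrs_ide A.inverse_arrs_inv_arr assms)

lemma is_iso_dot: "\<lbrakk>is_iso A f; is_iso B g\<rbrakk> \<Longrightarrow> is_iso T (cls (TDot f g))"
  unfolding is_iso_def using inverse_arrs_dot by blast

end

lemma (in category) inv_arr_cmp:
  "\<lbrakk>is_iso C f; is_iso C g; Cod C f = Dom C g\<rbrakk> \<Longrightarrow> inv_arr C (g \<cdot> f) = inv_arr C f \<cdot> inv_arr C g"
  by (intro inv_arr_eqI inverse_arrs_cmp inverse_arrs_inv_arr)

section \<open>The tensor product of functors and of transformations\<close>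

locale tensor_functors = T: tensor_factors A B + T': tensor_factors A' B' +
    P: sm_functor A' A P + Q: sm_functor B' B Q
  for A :: "('oa, 'ma) perm" and B :: "('ob, 'mb) perm" and A' :: "('oa', 'ma') perm" and B' :: "('ob', 'mb') perm"
    and P :: "('oa', 'ma', 'oa, 'ma) smf" and Q :: "('ob', 'mb', 'ob, 'mb) smf"
begin

abbreviation pre_univ where "pre_univ \<equiv> bil_pre A' B' A B T.T P Q T.u"

sublocale pre: bilinear_lift A' B' T.T pre_univ
  by (intro bilinear_lift.intro bilinear_pre T.bilinear_univ) unfold_locales

abbreviation mp where "mp \<equiv> map (map_prod (fob P) (fob Q))"

lemma mp_obj: "xs \<in> lists (Obj A' \<times> Obj B') \<Longrightarrow> mp xs \<in> lists (Obj A \<times> Obj B)"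
  by (auto simp: in_lists_conv_set)

text \<open>Sums in \<open>A \<otimes> B\<close> are concatenations, so summing the singletons
  \<open>[(P a, Q b)]\<close> gives the mapped list.\<close>

lemma os_pre: "xs \<in> lists (Obj A' \<times> Obj B') \<Longrightarrow> pre.os xs = mp xs"
  by (induction xs rule: lists.induct) auto

lemma tens_tm_typing:
  "T'.wf t \<Longrightarrow> T.wf (tens_tm A B P Q t) \<and> T.src (tens_tm A B P Q t) = mp (T'.src t) \<and>
    T.tgt (tens_tm A B P Q t) = mp (T'.tgt t)"
proof (induction t)
  case (TGen e)
  then show ?case by (cases e) auto
next
  case (TInv e)
  then show ?case by (cases e) auto
qed (auto simp: mp_obj)

text \<open>Identifies the syntactic translation with evaluation along \<open>u(P-, Q-)\<close>. Its
  compatibility with \<open>teq\<close> is thereby inherited from \<open>ev_teq\<close>.\<close>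

lemma tens_tm_ev: "T'.wf t \<Longrightarrow> T.cls (tens_tm A B P Q t) = pre.ev t"
proof (induction t)
  case (TGen e)
  then show ?case by (cases e) auto
next
  case (TInv e)
  then show ?case
    \<comment> \<open>The inverse of a composite reverses its factors: the formal inverse is applied
      after the inverted constraint of \<open>P\<close> or \<open>Q\<close>, as in
      \<open>tens_inv\<close>.\<close>
    by (cases e) (auto simp: T.inv_arr_dot_ide_left T.inv_arr_dot_ide_right T.is_iso_dot T.T.inv_arr_cmp T.tcls_inv)
next
  case (TComp t s)
  then show ?case using tens_tm_typing [of t] tens_tm_typing [of s] by simp
next
  case (TPlus t s)
  then show ?case using tens_tm_typing [of t] tens_tm_typing [of s] by simp
qed (auto simp: os_pre)

text \<open>Both definitions use the same representative \<open>trep X\<close>, so the comparison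
  takes place between terms.\<close>

lemma tensor_fct_eq: "tensor_fct A' B' A B P Q = bil_lift A' B' T.T pre_univ"
proof (rule smf_eqI)
  show "fob (tensor_fct A' B' A B P Q) = fob pre.L"
    by (auto simp: fun_eq_iff tensor_fct_def bil_lift_def os_pre)
  have "T.cls (tens_tm A B P Q (trep X)) = pre.ev (trep X)" if "X \<in> Arr T'.T" for X
    using that by (auto simp: T'.arr_tensor intro!: tens_tm_ev)
  then show "far (tensor_fct A' B' A B P Q) = far pre.L"
    by (auto simp: fun_eq_iff tensor_fct_def bil_lift_def)
  show "cst2 (tensor_fct A' B' A B P Q) = cst2 pre.L"
    by (auto simp: fun_eq_iff tensor_fct_def bil_lift_def os_pre)
qed (simp add: tensor_fct_def)

lemma strict_tensor_fct: "strict_sm_functor T'.T T.T (tensor_fct A' B' A B P Q)"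
  unfolding tensor_fct_eq by (rule pre.strict_lift)

lemma tensor_fct_univ: "bil_post A' B' T.T (tensor_fct A' B' A B P Q) T'.u = pre_univ"
  unfolding tensor_fct_eq by (rule pre.lift_univ)

end

lemma sm_trans_tensor_trans:
  assumes p: "sm_trans A' A P P' p" and q: "sm_trans B' B Q Q' q"
  shows "sm_trans (A' \<otimes> B') (A \<otimes> B) (tensor_fct A' B' A B P Q) (tensor_fct A' B' A B P' Q')
    (tensor_trans A' B' A B p q)"
proof -
  interpret P: sm_functor A' A P by (rule sm_transD(1) [OF p])
  interpret P': sm_functor A' A P' by (rule sm_transD(2) [OF p])
  interpret Q: sm_functor B' B Q by (rule sm_transD(1) [OF q])
  interpret Q': sm_functor B' B Q' by (rule sm_transD(2) [OF q])
  interpret F: tensor_functors A B A' B' P Q by unfold_locales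
  interpret F': tensor_functors A B A' B' P' Q' by unfold_locales
  note [simp] = sm_transD(4-6) [OF p] sm_transD(4-6) [OF q]
  \<comment> \<open>The bilinear transformation \<open>u(p, q)\<close> from \<open>u(P-, Q-)\<close>
    to \<open>u(P'-, Q'-)\<close>; its additive extension is then recognised in
    \<open>tens_sum\<close>.\<close>
  let ?t = "\<lambda>(a, b)\<in>Obj A' \<times> Obj B'. far (tensor_univ A B) (p a, q b)"
  interpret bil_trans_lift A' B' "A \<otimes> B" F.pre_univ F'.pre_univ ?t
    by (intro bil_trans_lift.intro bil_trans_lift_axioms.intro F.pre.bilinear_lift_axioms
        F'.pre.bilinear_lift_axioms bil_trans_pre_trans p q F.T.bilinear_univ)
  have "twf A B (tens_sum p q xs) \<and> tcls A B (tens_sum p q xs) = asum (A \<otimes> B) ?t xs"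
    if "xs \<in> lists (Obj A' \<times> Obj B')" for xs
    using that by induction auto
  then have "tensor_trans A' B' A B p q = (\<lambda>xs\<in>Obj (A' \<otimes> B'). asum (A \<otimes> B) ?t xs)"
    by (auto simp: fun_eq_iff tensor_trans_def)
  then show ?thesis
    using sm_trans_lift by (simp add: F.tensor_fct_eq F'.tensor_fct_eq)
qed

section \<open>The comparison functor\<close>

lemma fct_eqI:
  fixes F G :: "('o, 'm, 'p, 'n) fct"
  assumes "fob F = fob G" "far F = far G"
  shows "F = G"
  using assms by (intro fct.equality) auto

context tensor_factors
begin

lemma functor_comp_univ:
  assumes "permutative C"
  shows "cat_functor (PermCat_s T C) (Bilin A B C) (comp_univ A B C)"
proof -
  have "cat_functor (PermCat_s T C) (Bilin A B C)
    \<lparr>fob = (\<lambda>S\<in>{F. strict_sm_functor T C F}. bil_post A B C S u),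
     far = (\<lambda>(S, t, S')\<in>Arr (PermCat_s T C). (bil_post A B C S u,
       (\<lambda>(a, b)\<in>Obj A \<times> Obj B. t (fob u (a, b))), bil_post A B C S' u))\<rparr>"
    unfolding PermCat_s_def Bilin_def
  proof (rule trans_cat_functor)
    fix S S' t assume "S \<in> {F. strict_sm_functor T C F}" "S' \<in> {F. strict_sm_functor T C F}"
      "sm_trans T C S S' t"
    then show "bil_trans A B C (bil_post A B C S u) (bil_post A B C S' u)
        (\<lambda>(a, b)\<in>Obj A \<times> Obj B. t (fob u (a, b)))"
      using bil_trans_post_trans [OF _ _ _ bilinear_univ] by blast
  qed (auto intro: bilinear_post bilinear_univ trans_family_PermCat_s trans_family_Bilin
      permutative_tensor A.permutative_axioms B.permutative_axioms assms)
  then show ?thesis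
    by (simp add: comp_univ_def Let_def PermCat_s_def)
qed

lemma isomorphism_comp_univ:
  assumes C: "permutative C"
  shows "cat_isomorphism (PermCat_s T C) (Bilin A B C) (comp_univ A B C)"
proof -
  interpret C: permutative C by fact
  let ?X = "PermCat_s T C" and ?Y = "Bilin A B C"
  \<comment> \<open>The inverse functor: bilinear maps are lifted by evaluation, their
    transformations by \<open>asum\<close>.\<close>
  let ?G = "\<lparr>fob = (\<lambda>H\<in>{H. bilinear A B C H}. bil_lift A B C H),
     far = (\<lambda>(H, t, J)\<in>Arr ?Y.
       (bil_lift A B C H, (\<lambda>xs\<in>Obj T. asum C t xs), bil_lift A B C J))\<rparr>"
  have lift: "bilinear_lift A B C H" if "bilinear A B C H" for H
    by (rule bilinear_lift.intro [OF tensor_factors_axioms that])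
  have tlift: "bil_trans_lift A B C H J t" if "bil_trans A B C H J t" for H J t
    using that by (intro bil_trans_lift.intro bil_trans_lift_axioms.intro lift) (auto dest: bil_transD(1,2))
  have F: "cat_functor ?X ?Y (comp_univ A B C)"
    by (rule functor_comp_univ) fact
  have G: "cat_functor ?Y ?X ?G"
    unfolding PermCat_s_def Bilin_def
  proof (rule trans_cat_functor)
    fix H xs assume "H \<in> {H. bilinear A B C H}" and xs: "xs \<in> Obj T"
    then interpret bilinear_lift A B C H by (simp add: lift)
    have "asum C (\<lambda>x\<in>Obj (prod_cat A B). Ide C (fob H x)) xs = asum C (\<lambda>x. Ide C (fob H x)) xs"
      using xs by (intro asum_cong) (auto simp: in_lists_conv_set)
    also have "\<dots> = Ide C (os xs)"
      using xs by (intro C.asum_ide) (auto simp: in_lists_conv_set)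
    finally show "(\<lambda>xs\<in>Obj T. asum C (\<lambda>x\<in>Obj (prod_cat A B). Ide C (fob H x)) xs) xs = Ide C (fob L xs)"
      using xs by simp
  next
    fix H J K t s xs assume "bil_trans A B C H J t" "bil_trans A B C J K s" and xs: "xs \<in> Obj T"
    then interpret t: bil_trans_lift A B C H J t + s: bil_trans_lift A B C J K s
      by (simp_all add: tlift)
    \<comment> \<open>Additive extension respects vertical composition because sums and composites
      interchange in \<open>C\<close>.\<close>
    have "asum C (\<lambda>x\<in>Obj (prod_cat A B). s x \<cdot>\<^bsub>C\<^esub> t x) xs = asum C s xs \<cdot>\<^bsub>C\<^esub> asum C t xs"
      using xs [simplified]
    proof induction
      case (Cons p xs)
      then show ?case by (cases p) (simp add: C.plus_merge)
    qed simp
    then show "(\<lambda>xs\<in>Obj T. asum C (\<lambda>x\<in>Obj (prod_cat A B). s x \<cdot>\<^bsub>C\<^esub> t x) xs) xs =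
        (\<lambda>xs\<in>Obj T. asum C s xs) xs \<cdot>\<^bsub>C\<^esub> (\<lambda>xs\<in>Obj T. asum C t xs) xs"
      using xs by simp
  qed (auto intro: trans_family_PermCat_s trans_family_Bilin permutative_tensor A.permutative_axioms
      B.permutative_axioms C bilinear_lift.strict_lift [OF lift] bil_trans_lift.sm_trans_lift [OF tlift, simplified])
  have "comp_fct ?X ?G (comp_univ A B C) = id_fct ?X"
  proof (rule fct_eqI)
    show "fob (comp_fct ?X ?G (comp_univ A B C)) = fob (id_fct ?X)"
      by (auto simp: fun_eq_iff comp_fct_def id_fct_def comp_univ_def Let_def PermCat_s_def
          lift_unique bilinear_post bilinear_univ)
    show "far (comp_fct ?X ?G (comp_univ A B C)) = far (id_fct ?X)"
    proof
      fix f show "far (comp_fct ?X ?G (comp_univ A B C)) f = far (id_fct ?X) f"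
      proof (cases "f \<in> Arr ?X")
        case True
        then obtain S t S' where f: "f = (S, t, S')" and S: "strict_sm_functor T C S"
          "strict_sm_functor T C S'" and t: "sm_trans T C S S' t"
          by (auto simp: PermCat_s_def arr_trans_cat)
        have *: "far (comp_univ A B C) f = (bil_post A B C S u, (\<lambda>(a, b)\<in>Obj A \<times> Obj B. t (fob u (a, b))),
            bil_post A B C S' u)"
          using True by (simp add: f comp_univ_def Let_def)
        have m: "far (comp_univ A B C) f \<in> Arr ?Y"
          using cat_functor.far_simps(1) [OF F True] .
        \<comment> \<open>On objects of \<open>T\<close> this is \<open>asum_unique\<close>;
          elsewhere both sides are \<open>undefined\<close>, as \<open>t\<close> is
          extensional.\<close>
        have "(\<lambda>xs\<in>Obj T. asum C (\<lambda>(a, b)\<in>Obj A \<times> Obj B. t (fob u (a, b))) xs) = t"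
          using asum_unique [OF S t] sm_transD(3) [OF t] by (auto simp: fun_eq_iff extensional_def)
        then have "far ?G (far (comp_univ A B C) f) = f"
          using m unfolding * by (simp add: lift_unique S f)
        then show ?thesis
          using True by (simp add: comp_fct_def id_fct_def)
      qed (simp add: comp_fct_def id_fct_def)
    qed
  qed
  moreover have "comp_fct ?Y (comp_univ A B C) ?G = id_fct ?Y"
  proof (rule fct_eqI)
    show "fob (comp_fct ?Y (comp_univ A B C) ?G) = fob (id_fct ?Y)"
      by (auto simp: fun_eq_iff comp_fct_def id_fct_def comp_univ_def Let_def PermCat_s_def Bilin_def
          bilinear_lift.lift_univ [OF lift] bilinear_lift.strict_lift [OF lift])
    show "far (comp_fct ?Y (comp_univ A B C) ?G) = far (id_fct ?Y)"
    proof
      fix f show "far (comp_fct ?Y (comp_univ A B C) ?G) f = far (id_fct ?Y) f"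
      proof (cases "f \<in> Arr ?Y")
        case True
        then obtain H t J where f: "f = (H, t, J)" and t: "bil_trans A B C H J t"
          by (auto simp: Bilin_def arr_trans_cat)
        interpret t: bil_trans_lift A B C H J t by (rule tlift [OF t])
        have *: "far ?G f = (bil_lift A B C H, (\<lambda>xs\<in>Obj T. asum C t xs), bil_lift A B C J)"
          using True by (simp add: f)
        have m: "far ?G f \<in> Arr ?X"
          using cat_functor.far_simps(1) [OF G True] .
        \<comment> \<open>On a singleton \<open>asum\<close> is one component plus the identity of
          zero, hence the component itself.\<close>
        have "(\<lambda>(a, b)\<in>Obj A \<times> Obj B. (\<lambda>xs\<in>Obj T. asum C t xs) (fob u (a, b))) = t"
          using bil_transD(3) [OF t] by (auto simp: fun_eq_iff extensional_def)
        then have "far (comp_univ A B C) (far ?G f) = f"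
          using m unfolding * by (simp add: comp_univ_def Let_def f t.H.lift_univ t.J.lift_univ)
        then show ?thesis
          using True by (simp add: comp_fct_def id_fct_def)
      qed (simp add: comp_fct_def id_fct_def)
    qed
  qed
  ultimately show ?thesis
    unfolding cat_isomorphism_def using F G by blast
qed

end

section \<open>The actions of one-cells, and naturality of the comparison at objects\<close>

lemma functor_Bilin_map:
  assumes P: "sm_functor A' A P" and Q: "sm_functor B' B Q" and R: "strict_sm_functor C C' R"
  shows "cat_functor (Bilin A B C) (Bilin A' B' C') (Bilin_map A B C A' B' C' P Q R)"
proof -
  interpret P: sm_functor A' A P by fact
  interpret Q: sm_functor B' B Q by fact
  interpret R: strict_sm_functor C C' R by fact
  let ?act = "\<lambda>H. bil_post A' B' C' R (bil_pre A' B' A B C P Q H)"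
  let ?tr = "\<lambda>t. \<lambda>(a, b)\<in>Obj A' \<times> Obj B'. far R (t (fob P a, fob Q b))"
  have "cat_functor (Bilin A B C) (Bilin A' B' C')
    \<lparr>fob = (\<lambda>H\<in>{H. bilinear A B C H}. ?act H),
     far = (\<lambda>(H, t, J)\<in>Arr (Bilin A B C). (?act H, ?tr t, ?act J))\<rparr>"
    unfolding Bilin_def
  proof (rule trans_cat_functor)
    fix H J t assume t: "bil_trans A B C H J t"
    \<comment> \<open>The two whiskering lemmas produce nested restricted functions; they agree with
      the single restriction in \<open>Bilin_map\<close>.\<close>
    have "?tr t = (\<lambda>(a, b)\<in>Obj A' \<times> Obj B'. far R ((\<lambda>(a, b)\<in>Obj A' \<times> Obj B'. t (fob P a, fob Q b)) (a, b)))"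
      by (auto simp: fun_eq_iff)
    then show "bil_trans A' B' C' (?act H) (?act J) (?tr t)"
      using bil_trans_post [OF R bil_trans_pre [OF P Q t]] by simp
  next
    fix H x assume "H \<in> {H. bilinear A B C H}" "x \<in> Obj (prod_cat A' B')"
    then interpret H: bilinear A B C H by simp
    show "?tr (\<lambda>x\<in>Obj (prod_cat A B). Ide C (fob H x)) x = Ide C' (fob (?act H) x)"
      using \<open>x \<in> Obj (prod_cat A' B')\<close> by auto
  next
    fix H J K t s x assume t: "bil_trans A B C H J t" and s: "bil_trans A B C J K s"
      and "x \<in> Obj (prod_cat A' B')"
    then show "?tr (\<lambda>x\<in>Obj (prod_cat A B). s x \<cdot>\<^bsub>C\<^esub> t x) x = ?tr s x \<cdot>\<^bsub>C'\<^esub> ?tr t x"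
      by (auto simp: bil_transD(4-6) [OF t] bil_transD(4-6) [OF s])
  qed (auto intro: bilinear_post bilinear_pre P Q R trans_family_Bilin P.dom.permutative_axioms
      P.cod.permutative_axioms Q.dom.permutative_axioms Q.cod.permutative_axioms
      R.dom.permutative_axioms R.cod.permutative_axioms)
  then show ?thesis
    by (simp add: Bilin_map_def Let_def Bilin_def)
qed

lemma functor_PermCat_s_map:
  assumes P: "sm_functor A' A P" and Q: "sm_functor B' B Q" and R: "strict_sm_functor C C' R"
  shows "cat_functor (PermCat_s (A \<otimes> B) C) (PermCat_s (A' \<otimes> B') C') (PermCat_s_map A B C A' B' C' P Q R)"
proof -
  interpret P: sm_functor A' A P by fact
  interpret Q: sm_functor B' B Q by fact
  interpret R: strict_sm_functor C C' R by fact
  interpret tensor_functors A B A' B' P Q by unfold_locales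
  interpret PQ: strict_sm_functor "A' \<otimes> B'" "A \<otimes> B" "tensor_fct A' B' A B P Q"
    by (rule strict_tensor_fct)
  let ?PQ = "tensor_fct A' B' A B P Q"
  let ?act = "\<lambda>S. smf_comp (A' \<otimes> B') C' R (smf_comp (A' \<otimes> B') C S ?PQ)"
  let ?tr = "\<lambda>t. \<lambda>x\<in>Obj (A' \<otimes> B'). far R (t (fob ?PQ x))"
  have "cat_functor (PermCat_s (A \<otimes> B) C) (PermCat_s (A' \<otimes> B') C')
    \<lparr>fob = (\<lambda>S\<in>{F. strict_sm_functor (A \<otimes> B) C F}. ?act S),
     far = (\<lambda>(S, t, S')\<in>Arr (PermCat_s (A \<otimes> B) C). (?act S, ?tr t, ?act S'))\<rparr>"
    unfolding PermCat_s_def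
  proof (rule trans_cat_functor)
    fix S S' t assume t: "sm_trans (A \<otimes> B) C S S' t"
    have "?tr t = (\<lambda>x\<in>Obj (A' \<otimes> B'). far R ((\<lambda>x\<in>Obj (A' \<otimes> B'). t (fob ?PQ x)) x))"
      by (auto simp: fun_eq_iff)
    then show "sm_trans (A' \<otimes> B') C' (?act S) (?act S') (?tr t)"
      using sm_trans_whisker_left [OF sm_trans_whisker_right [OF t PQ.sm_functor_axioms] R.sm_functor_axioms]
      by simp
  next
    fix S x assume "S \<in> {F. strict_sm_functor (A \<otimes> B) C F}" "x \<in> Obj (A' \<otimes> B')"
    then interpret S: strict_sm_functor "A \<otimes> B" C S by simp
    show "?tr (\<lambda>x\<in>Obj (A \<otimes> B). Ide C (fob S x)) x = Ide C' (fob (?act S) x)"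
      using \<open>x \<in> Obj (A' \<otimes> B')\<close> PQ.fob_obj [of x] by (simp del: PQ.fob_obj)
  next
    fix S S' S'' t s x assume t: "sm_trans (A \<otimes> B) C S S' t" and s: "sm_trans (A \<otimes> B) C S' S'' s"
      and "x \<in> Obj (A' \<otimes> B')"
    then show "?tr (\<lambda>x\<in>Obj (A \<otimes> B). s x \<cdot>\<^bsub>C\<^esub> t x) x = ?tr s x \<cdot>\<^bsub>C'\<^esub> ?tr t x"
      using PQ.fob_obj [of x] by (simp add: sm_transD(4-6) [OF t] sm_transD(4-6) [OF s] del: PQ.fob_obj)
  qed (auto intro: strict_sm_functor_comp PQ.strict_sm_functor_axioms R trans_family_PermCat_s
      T.permutative_tensor T'.permutative_tensor R.dom.permutative_axioms R.cod.permutative_axioms)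
  then show ?thesis
    by (simp add: PermCat_s_map_def Let_def PermCat_s_def)
qed

lemma bil_post_smf_comp:
  assumes "sm_functor C D F" "sm_functor D E G" "bilinear A B C H"
  shows "bil_post A B E (smf_comp C E G F) H = bil_post A B E G (bil_post A B D F H)"
proof -
  interpret F: sm_functor C D F by fact
  interpret G: sm_functor D E G by fact
  interpret H: bilinear A B C H by fact
  show ?thesis
    by (rule bil_eqI) (auto simp: fun_eq_iff bil_post_def)
qed

text \<open>The constraints of the two sides are the same composites bracketed differently, because
  \<open>R\<close> preserves composition.\<close>

lemma bil_pre_post:
  assumes "sm_functor A' A P" "sm_functor B' B Q" "strict_sm_functor C C' R" "bilinear A B C H"
  shows "bil_pre A' B' A B C' P Q (bil_post A B C' R H) = bil_post A' B' C' R (bil_pre A' B' A B C P Q H)"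
proof -
  interpret P: sm_functor A' A P by fact
  interpret Q: sm_functor B' B Q by fact
  interpret R: strict_sm_functor C C' R by fact
  interpret H: bilinear A B C H by fact
  show ?thesis
    by (rule bil_eqI) (auto simp: fun_eq_iff bil_pre_def bil_post_def)
qed

text \<open>By \<open>tensor_fct_univ\<close>, restricting \<open>S (P \<otimes> Q)\<close> along
  the universal map of \<open>A'\<close> and \<open>B'\<close> gives \<open>S\<close> after
  \<open>u(P-, Q-)\<close>; the rest is associativity. Besides naturality at objects this supplies
  the ends of the triples compared for arrows and for two-cells.\<close>

lemma comp_univ_natural_obj:
  assumes P: "sm_functor A' A P" and Q: "sm_functor B' B Q" and R: "strict_sm_functor C C' R"
    and S: "strict_sm_functor (A \<otimes> B) C S"
  shows "bil_post A' B' C' R (bil_pre A' B' A B C P Q (bil_post A B C S (tensor_univ A B))) =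
    bil_post A' B' C' (smf_comp (A' \<otimes> B') C' R (smf_comp (A' \<otimes> B') C S (tensor_fct A' B' A B P Q)))
      (tensor_univ A' B')"
proof -
  interpret P: sm_functor A' A P by fact
  interpret Q: sm_functor B' B Q by fact
  interpret R: strict_sm_functor C C' R by fact
  interpret S: strict_sm_functor "A \<otimes> B" C S by fact
  interpret tensor_functors A B A' B' P Q by unfold_locales
  interpret PQ: strict_sm_functor "A' \<otimes> B'" "A \<otimes> B" "tensor_fct A' B' A B P Q"
    by (rule strict_tensor_fct)
  have "bil_pre A' B' A B C P Q (bil_post A B C S T.u) =
      bil_post A' B' C S (bil_post A' B' T.T (tensor_fct A' B' A B P Q) T'.u)"
    using bil_pre_post [OF P Q S T.bilinear_univ] by (simp add: tensor_fct_univ)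
  also have "bil_post A' B' C' R \<dots> =
      bil_post A' B' C' (smf_comp T'.T C' R (smf_comp T'.T C S (tensor_fct A' B' A B P Q))) T'.u"
    using bil_post_smf_comp [OF PQ.sm_functor_axioms S.sm_functor_axioms T'.bilinear_univ]
      bil_post_smf_comp [OF sm_functor_comp [OF PQ.sm_functor_axioms S.sm_functor_axioms]
        R.sm_functor_axioms T'.bilinear_univ] by simp
  finally show ?thesis .
qed

section \<open>Naturality in two-cells\<close>

text \<open>Two naturality squares are pasted: one for \<open>r\<close> at a component of
  \<open>t\<close>, and the image under \<open>R\<close> of the one for \<open>t\<close> at
  \<open>k\<close>. With \<open>k\<close> a component of a two-cell in the variables
  \<open>A\<close> and \<open>B\<close>, this is the naturality of \<open>Bilin_map2\<close> and
  \<open>PermCat_s_map2\<close>.\<close>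

lemma nat_trans_double_square:
  assumes t: "nat_trans D C F G t" and r: "nat_trans C E R R' r" and k: "k \<in> Arr D"
  shows "far R' (t (Cod D k)) \<cdot>\<^bsub>E\<^esub> (r (fob F (Cod D k)) \<cdot>\<^bsub>E\<^esub> far R (far F k)) =
    (r (fob G (Cod D k)) \<cdot>\<^bsub>E\<^esub> far R (far G k)) \<cdot>\<^bsub>E\<^esub> far R (t (Dom D k))"
proof -
  interpret F: cat_functor D C F by (rule nat_transD(1) [OF t])
  interpret G: cat_functor D C G by (rule nat_transD(2) [OF t])
  interpret R: cat_functor C E R by (rule nat_transD(1) [OF r])
  interpret R': cat_functor C E R' by (rule nat_transD(2) [OF r])
  note [simp] = nat_transD(4-6) [OF t] nat_transD(4-6) [OF r] k
  have e: "far R' (t (Cod D k)) \<cdot>\<^bsub>E\<^esub> r (fob F (Cod D k)) = r (fob G (Cod D k)) \<cdot>\<^bsub>E\<^esub> far R (t (Cod D k))"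
    using nat_transD(7) [OF r, of "t (Cod D k)"] by simp
  have "far R (t (Cod D k)) \<cdot>\<^bsub>E\<^esub> far R (far F k) = far R (far G k) \<cdot>\<^bsub>E\<^esub> far R (t (Dom D k))"
    using arg_cong [OF nat_transD(7) [OF t k], of "far R"] by simp
  then show ?thesis
    by (simp add: R.cod.cmp_square_extend [OF e])
qed

text \<open>Strictness of \<open>R\<close> and \<open>R'\<close> is assumed apart from
  \<open>sm_trans\<close>, which only provides symmetric monoidal functors.\<close>

locale two_cells =
  fixes A :: "('oa, 'ma) perm" and B :: "('ob, 'mb) perm" and C :: "('oc, 'mc) perm"
    and A' :: "('oa', 'ma') perm" and B' :: "('ob', 'mb') perm" and C' :: "('oc', 'mc') perm"
    and P P' \<pi> Q Q' \<chi> R R' \<rho>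
  assumes p: "sm_trans A' A P P' \<pi>" and q: "sm_trans B' B Q Q' \<chi>"
    and R: "strict_sm_functor C C' R" and R': "strict_sm_functor C C' R'"
    and r: "sm_trans C C' R R' \<rho>"
begin

sublocale P: sm_functor A' A P by (rule sm_transD(1) [OF p])
sublocale P': sm_functor A' A P' by (rule sm_transD(2) [OF p])
sublocale Q: sm_functor B' B Q by (rule sm_transD(1) [OF q])
sublocale Q': sm_functor B' B Q' by (rule sm_transD(2) [OF q])
sublocale R: strict_sm_functor C C' R by (rule R)
sublocale R': strict_sm_functor C C' R' by (rule R')
sublocale PQ: tensor_functors A B A' B' P Q by unfold_locales
sublocale PQ': tensor_functors A B A' B' P' Q' by unfold_locales

lemmas trans_simps [simp] = sm_transD(4-6) [OF p] sm_transD(4-6) [OF q] sm_transD(4-6) [OF r]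

text \<open>The family is the vertical composite of \<open>R H(\<pi>, \<chi>)\<close> and of
  \<open>\<rho>\<close> at \<open>H(P'-, Q'-)\<close>, and both factors are already known to be
  bilinear transformations.\<close>

lemma bil_trans_map2:
  assumes H: "bilinear A B C H"
  shows "bil_trans A' B' C' (bil_post A' B' C' R (bil_pre A' B' A B C P Q H))
    (bil_post A' B' C' R' (bil_pre A' B' A B C P' Q' H))
    (\<lambda>(a, b)\<in>Obj A' \<times> Obj B'. \<rho> (fob H (fob P' a, fob Q' b)) \<cdot>\<^bsub>C'\<^esub> far R (far H (\<pi> a, \<chi> b)))"
    (is "bil_trans A' B' C' ?K ?L ?t")
proof -
  interpret H: bilinear A B C H by fact
  have K: "bilinear A' B' C (bil_pre A' B' A B C P' Q' H)"
    by (intro bilinear_pre H P'.sm_functor_axioms Q'.sm_functor_axioms)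
  note v = bil_trans_vcomp [OF bil_trans_post [OF R bil_trans_pre_trans [OF p q H]]
      bil_trans_post_trans [OF R R' r K]]
  then show ?thesis
    \<comment> \<open>The composite family equals the stated one once nested restrictions are
      removed.\<close>
    by (rule back_subst [of "bil_trans A' B' C' ?K ?L"]) (auto simp: fun_eq_iff)
qed

lemma nat_trans_Bilin:
  "nat_trans (Bilin A B C) (Bilin A' B' C')
    (Bilin_map A B C A' B' C' P Q R) (Bilin_map A B C A' B' C' P' Q' R')
    (Bilin_map2 A B C A' B' C' P Q R P' Q' R' \<pi> \<chi> \<rho>)"
proof -
  let ?c = "\<lambda>H. \<lambda>(a, b)\<in>Obj A' \<times> Obj B'. \<rho> (fob H (fob P' a, fob Q' b)) \<cdot>\<^bsub>C'\<^esub> far R (far H (\<pi> a, \<chi> b))"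
  have "nat_trans (Bilin A B C) (Bilin A' B' C')
      (Bilin_map A B C A' B' C' P Q R) (Bilin_map A B C A' B' C' P' Q' R')
      (\<lambda>H\<in>{H. bilinear A B C H}. (fob (Bilin_map A B C A' B' C' P Q R) H, ?c H,
        fob (Bilin_map A B C A' B' C' P' Q' R') H))"
    unfolding Bilin_def
  proof (rule trans_cat_nat_trans [OF _ _
        functor_Bilin_map [OF P.sm_functor_axioms Q.sm_functor_axioms R, unfolded Bilin_def]
        functor_Bilin_map [OF P'.sm_functor_axioms Q'.sm_functor_axioms R', unfolded Bilin_def]])
    fix H J t x assume t: "bil_trans A B C H J t" and "x \<in> Obj (prod_cat A' B')"
    then obtain a b where x [simp]: "x = (a, b)" "a \<in> Obj A'" "b \<in> Obj B'" by auto
    show "(\<lambda>(a, b)\<in>Obj A' \<times> Obj B'. far R' (t (fob P' a, fob Q' b))) x \<cdot>\<^bsub>C'\<^esub> ?c H x =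
        ?c J x \<cdot>\<^bsub>C'\<^esub> (\<lambda>(a, b)\<in>Obj A' \<times> Obj B'. far R (t (fob P a, fob Q b))) x"
      using nat_trans_double_square [OF bil_trans_nat_trans [OF t] sm_trans_nat_trans [OF r], of "(\<pi> a, \<chi> b)"]
      by simp
  qed (auto intro: trans_family_Bilin P.dom.permutative_axioms P.cod.permutative_axioms Q.dom.permutative_axioms
      Q.cod.permutative_axioms R.dom.permutative_axioms R.cod.permutative_axioms
      bil_trans_map2 simp: Bilin_map_def Bilin_def Let_def)
  then show ?thesis
    by (simp add: Bilin_map2_def Bilin_def)
qed

text \<open>The same vertical composite as in the bilinear case, with
  \<open>H(\<pi>, \<chi>)\<close> replaced by \<open>S\<close> applied to the tensor product of
  \<open>\<pi>\<close> and \<open>\<chi>\<close>.\<close>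

lemma sm_trans_map2:
  assumes S: "strict_sm_functor (A \<otimes> B) C S"
  shows "sm_trans (A' \<otimes> B') C'
    (smf_comp (A' \<otimes> B') C' R (smf_comp (A' \<otimes> B') C S (tensor_fct A' B' A B P Q)))
    (smf_comp (A' \<otimes> B') C' R' (smf_comp (A' \<otimes> B') C S (tensor_fct A' B' A B P' Q')))
    (\<lambda>x\<in>Obj (A' \<otimes> B'). \<rho> (fob S (fob (tensor_fct A' B' A B P' Q') x)) \<cdot>\<^bsub>C'\<^esub>
      far R (far S (tensor_trans A' B' A B \<pi> \<chi> x)))"
    (is "sm_trans _ _ ?K ?L ?t")
proof -
  interpret S: strict_sm_functor "A \<otimes> B" C S by fact
  note PQ' = strict_sm_functor.axioms(1) [OF PQ'.strict_tensor_fct]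
  note v = sm_trans_vcomp [OF
      sm_trans_whisker_left [OF sm_trans_whisker_left [OF sm_trans_tensor_trans [OF p q] S.sm_functor_axioms]
        R.sm_functor_axioms]
      sm_trans_whisker_right [OF r sm_functor_comp [OF PQ' S.sm_functor_axioms]]]
  then show ?thesis
    by (rule back_subst [of "sm_trans (A' \<otimes> B') C' ?K ?L"]) (auto simp: fun_eq_iff)
qed

lemma nat_trans_PermCat_s:
  "nat_trans (PermCat_s (A \<otimes> B) C) (PermCat_s (A' \<otimes> B') C')
    (PermCat_s_map A B C A' B' C' P Q R) (PermCat_s_map A B C A' B' C' P' Q' R')
    (PermCat_s_map2 A B C A' B' C' P Q R P' Q' R' \<pi> \<chi> \<rho>)"
proof -
  let ?PQ = "tensor_fct A' B' A B P Q" and ?PQ' = "tensor_fct A' B' A B P' Q'"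
  let ?c = "\<lambda>S. \<lambda>x\<in>Obj (A' \<otimes> B'). \<rho> (fob S (fob ?PQ' x)) \<cdot>\<^bsub>C'\<^esub> far R (far S (tensor_trans A' B' A B \<pi> \<chi> x))"
  note tr = sm_transD [OF sm_trans_tensor_trans [OF p q]]
  have "nat_trans (PermCat_s (A \<otimes> B) C) (PermCat_s (A' \<otimes> B') C')
      (PermCat_s_map A B C A' B' C' P Q R) (PermCat_s_map A B C A' B' C' P' Q' R')
      (\<lambda>S\<in>{F. strict_sm_functor (A \<otimes> B) C F}. (fob (PermCat_s_map A B C A' B' C' P Q R) S, ?c S,
        fob (PermCat_s_map A B C A' B' C' P' Q' R') S))"
    unfolding PermCat_s_def
  proof (rule trans_cat_nat_trans [OF _ _
        functor_PermCat_s_map [OF P.sm_functor_axioms Q.sm_functor_axioms R, unfolded PermCat_s_def]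
        functor_PermCat_s_map [OF P'.sm_functor_axioms Q'.sm_functor_axioms R', unfolded PermCat_s_def]])
    fix S S' t x assume t: "sm_trans (A \<otimes> B) C S S' t" and x: "x \<in> Obj (A' \<otimes> B')"
    show "(\<lambda>x\<in>Obj (A' \<otimes> B'). far R' (t (fob ?PQ' x))) x \<cdot>\<^bsub>C'\<^esub> ?c S x =
        ?c S' x \<cdot>\<^bsub>C'\<^esub> (\<lambda>x\<in>Obj (A' \<otimes> B'). far R (t (fob ?PQ x))) x"
      using nat_trans_double_square [OF sm_trans_nat_trans [OF t] sm_trans_nat_trans [OF r] tr(4) [OF x]]
        tr(5,6) [OF x] x by simp
  qed (auto intro: trans_family_PermCat_s PQ.T.permutative_tensor PQ.T'.permutative_tensor R.dom.permutative_axioms R.cod.permutative_axioms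
      sm_trans_map2 [simplified] simp: PermCat_s_map_def PermCat_s_def Let_def)
  then show ?thesis
    by (simp add: PermCat_s_map2_def PermCat_s_def)
qed

text \<open>The ends of the two triples agree by \<open>comp_univ_natural_obj\<close>. The families
  are compared on singletons, where the tensor product of the two transformations is a single
  \<open>TDot\<close>.\<close>

lemma comp_univ_natural2:
  assumes S: "S \<in> Obj (PermCat_s (A \<otimes> B) C)"
  shows "Bilin_map2 A B C A' B' C' P Q R P' Q' R' \<pi> \<chi> \<rho> (fob (comp_univ A B C) S) =
    far (comp_univ A' B' C') (PermCat_s_map2 A B C A' B' C' P Q R P' Q' R' \<pi> \<chi> \<rho> S)"
proof -
  have S': "strict_sm_functor (A \<otimes> B) C S" using S by (simp add: PermCat_s_def)
  interpret S: strict_sm_functor "A \<otimes> B" C S by fact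
  let ?M = "PermCat_s_map2 A B C A' B' C' P Q R P' Q' R' \<pi> \<chi> \<rho> S"
  interpret n: cat_functor "PermCat_s (A \<otimes> B) C" "PermCat_s (A' \<otimes> B') C'" "PermCat_s_map A B C A' B' C' P Q R"
    by (rule nat_transD(1) [OF nat_trans_PermCat_s])
  \<comment> \<open>\<open>far (comp_univ A' B' C')\<close> has its defining value on arrows only,
    so membership must be known before it can be unfolded.\<close>
  have M: "?M \<in> Arr (PermCat_s (A' \<otimes> B') C')"
    by (rule nat_transD(4) [OF nat_trans_PermCat_s S])
  have H: "bilinear A B C (bil_post A B C S PQ.T.u)"
    by (rule bilinear_post [OF S' PQ.T.bilinear_univ])
  \<comment> \<open>Even on a singleton \<open>tens_sum\<close> ends in an empty sum, which
    \<open>zero_right_arr\<close> removes.\<close>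
  have tens: "tensor_trans A' B' A B \<pi> \<chi> [(a, b)] = PQ.T.cls (TDot (\<pi> a) (\<chi> b))"
    "fob (tensor_fct A' B' A B P' Q') [(a, b)] = [(fob P' a, fob Q' b)]"
    if "a \<in> Obj A'" "b \<in> Obj B'" for a b
    using that PQ.T.T.zero_right_arr [of "PQ.T.cls (TDot (\<pi> a) (\<chi> b))"]
    by (simp_all add: tensor_trans_def tensor_fct_def)
  have "(\<lambda>(a, b)\<in>Obj A' \<times> Obj B'. \<rho> (fob (bil_post A B C S PQ.T.u) (fob P' a, fob Q' b)) \<cdot>\<^bsub>C'\<^esub>
        far R (far (bil_post A B C S PQ.T.u) (\<pi> a, \<chi> b))) =
      (\<lambda>(a, b)\<in>Obj A' \<times> Obj B'. (\<lambda>x\<in>Obj PQ.T'.T. \<rho> (fob S (fob (tensor_fct A' B' A B P' Q') x)) \<cdot>\<^bsub>C'\<^esub>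
        far R (far S (tensor_trans A' B' A B \<pi> \<chi> x))) (fob PQ.T'.u (a, b)))"
    by (auto simp: fun_eq_iff tens)
  then show ?thesis
    using M S S' H
    by (simp add: comp_univ_def Let_def PermCat_s_map2_def Bilin_map2_def PermCat_s_map_def Bilin_map_def
        Bilin_def PermCat_s_def comp_univ_natural_obj P.sm_functor_axioms Q.sm_functor_axioms
        P'.sm_functor_axioms Q'.sm_functor_axioms R R')
qed

end

text \<open>For arrows the ends are again \<open>comp_univ_natural_obj\<close>, and both families
  evaluate \<open>t\<close> at \<open>[(P a, Q b)]\<close> and then apply \<open>R\<close>.\<close>

lemma comp_univ_natural:
  assumes P: "sm_functor A' A P" and Q: "sm_functor B' B Q" and R: "strict_sm_functor C C' R"
  shows "comp_fct (PermCat_s (A \<otimes> B) C) (Bilin_map A B C A' B' C' P Q R) (comp_univ A B C) =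
    comp_fct (PermCat_s (A \<otimes> B) C) (comp_univ A' B' C') (PermCat_s_map A B C A' B' C' P Q R)"
proof (rule fct_eqI)
  let ?X = "PermCat_s (A \<otimes> B) C"
  interpret P: sm_functor A' A P by fact
  interpret Q: sm_functor B' B Q by fact
  interpret R: strict_sm_functor C C' R by fact
  interpret tensor_functors A B A' B' P Q by unfold_locales
  interpret M: cat_functor ?X "PermCat_s T'.T C'" "PermCat_s_map A B C A' B' C' P Q R"
    by (rule functor_PermCat_s_map [OF P Q R])
  interpret U: cat_functor ?X "Bilin A B C" "comp_univ A B C"
    by (rule T.functor_comp_univ [OF R.dom.permutative_axioms])
  have strict: "strict_sm_functor T'.T C' (smf_comp T'.T C' R (smf_comp T'.T C S (tensor_fct A' B' A B P Q)))"
    if "strict_sm_functor T.T C S" for S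
    by (intro strict_sm_functor_comp [OF _ R] strict_sm_functor_comp [OF strict_tensor_fct] that)
  have bil: "bilinear A B C (bil_post A B C S T.u)" if "strict_sm_functor T.T C S" for S
    by (rule bilinear_post [OF that T.bilinear_univ])
  show "fob (comp_fct ?X (Bilin_map A B C A' B' C' P Q R) (comp_univ A B C)) =
      fob (comp_fct ?X (comp_univ A' B' C') (PermCat_s_map A B C A' B' C' P Q R))"
    by (auto simp: fun_eq_iff comp_fct_def comp_univ_def PermCat_s_map_def Bilin_map_def Let_def
        PermCat_s_def Bilin_def strict bil comp_univ_natural_obj P Q R)
  show "far (comp_fct ?X (Bilin_map A B C A' B' C' P Q R) (comp_univ A B C)) =
      far (comp_fct ?X (comp_univ A' B' C') (PermCat_s_map A B C A' B' C' P Q R))"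
  proof
    fix f
    show "far (comp_fct ?X (Bilin_map A B C A' B' C' P Q R) (comp_univ A B C)) f =
      far (comp_fct ?X (comp_univ A' B' C') (PermCat_s_map A B C A' B' C' P Q R)) f"
    proof (cases "f \<in> Arr ?X")
      case True
      then obtain S t S' where f: "f = (S, t, S')" and S: "strict_sm_functor T.T C S"
        "strict_sm_functor T.T C S'"
        by (auto simp: PermCat_s_def arr_trans_cat)
      have tens: "fob (tensor_fct A' B' A B P Q) [(a, b)] = [(fob P a, fob Q b)]"
        if "a \<in> Obj A'" "b \<in> Obj B'" for a b
        using that by (simp add: tensor_fct_def)
      have "(\<lambda>(a, b)\<in>Obj A' \<times> Obj B'. far R ((\<lambda>(a, b)\<in>Obj A \<times> Obj B. t (fob T.u (a, b))) (fob P a, fob Q b))) =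
          (\<lambda>(a, b)\<in>Obj A' \<times> Obj B'. (\<lambda>x\<in>Obj T'.T. far R (t (fob (tensor_fct A' B' A B P Q) x))) (fob T'.u (a, b)))"
        by (auto simp: fun_eq_iff tens)
      then have "far (Bilin_map A B C A' B' C' P Q R) (far (comp_univ A B C) f) =
          far (comp_univ A' B' C') (far (PermCat_s_map A B C A' B' C' P Q R) f)"
        using U.far_simps(1) [OF True] M.far_simps(1) [OF True] True
        by (simp add: f comp_univ_def PermCat_s_map_def Bilin_map_def Let_def comp_univ_natural_obj P Q R S)
      then show ?thesis
        using True by (simp add: comp_fct_def)
    qed (simp add: comp_fct_def)
  qed
qed

text \<open>The comparison is strictly natural, so the condition for one-cells is an equality of
  functors. For two-cells, equality of components at each \<open>S\<close> is enough, since a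
  natural transformation is determined by its components. That the primed categories are permutative
  is part of the hypotheses on the functors.\<close>

theorem proposition5p3:
  fixes A :: "('oa, 'ma) perm" and B :: "('ob, 'mb) perm" and C :: "('oc, 'mc) perm"
  assumes "permutative A" and "permutative B" and "permutative C"
  shows "cat_isomorphism (PermCat_s (A \<otimes> B) C) (Bilin A B C) (comp_univ A B C) \<and>
    (\<forall>(A' :: ('oa', 'ma') perm) (B' :: ('ob', 'mb') perm) (C' :: ('oc', 'mc') perm) P Q R.
       sm_functor A' A P \<and> sm_functor B' B Q \<and> strict_sm_functor C C' R \<longrightarrow>
         cat_functor (PermCat_s (A \<otimes> B) C) (PermCat_s (A' \<otimes> B') C')
           (PermCat_s_map A B C A' B' C' P Q R) \<and>
         cat_functor (Bilin A B C) (Bilin A' B' C') (Bilin_map A B C A' B' C' P Q R) \<and>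
         comp_fct (PermCat_s (A \<otimes> B) C) (Bilin_map A B C A' B' C' P Q R) (comp_univ A B C) =
         comp_fct (PermCat_s (A \<otimes> B) C) (comp_univ A' B' C') (PermCat_s_map A B C A' B' C' P Q R)) \<and>
    (\<forall>(A' :: ('oa', 'ma') perm) (B' :: ('ob', 'mb') perm) (C' :: ('oc', 'mc') perm)
        P P' \<pi> Q Q' \<chi> R R' \<rho>.
       sm_trans A' A P P' \<pi> \<and> sm_trans B' B Q Q' \<chi> \<and>
       strict_sm_functor C C' R \<and> strict_sm_functor C C' R' \<and> sm_trans C C' R R' \<rho> \<longrightarrow>
         nat_trans (PermCat_s (A \<otimes> B) C) (PermCat_s (A' \<otimes> B') C')
           (PermCat_s_map A B C A' B' C' P Q R) (PermCat_s_map A B C A' B' C' P' Q' R')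
           (PermCat_s_map2 A B C A' B' C' P Q R P' Q' R' \<pi> \<chi> \<rho>) \<and>
         nat_trans (Bilin A B C) (Bilin A' B' C')
           (Bilin_map A B C A' B' C' P Q R) (Bilin_map A B C A' B' C' P' Q' R')
           (Bilin_map2 A B C A' B' C' P Q R P' Q' R' \<pi> \<chi> \<rho>) \<and>
         (\<forall>S \<in> Obj (PermCat_s (A \<otimes> B) C).
            Bilin_map2 A B C A' B' C' P Q R P' Q' R' \<pi> \<chi> \<rho> (fob (comp_univ A B C) S) =
            far (comp_univ A' B' C') (PermCat_s_map2 A B C A' B' C' P Q R P' Q' R' \<pi> \<chi> \<rho> S)))"
proof (intro conjI allI impI ballI; (elim conjE)?)
  show "cat_isomorphism (PermCat_s (A \<otimes> B) C) (Bilin A B C) (comp_univ A B C)"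
    using assms by (intro tensor_factors.isomorphism_comp_univ tensor_factors.intro)
qed (rule functor_PermCat_s_map functor_Bilin_map comp_univ_natural two_cells.nat_trans_PermCat_s
    two_cells.nat_trans_Bilin two_cells.comp_univ_natural2;
    (intro two_cells.intro)?; assumption)+

end
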